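(* Let $p(1)=p\in(1/2,1]$ and $p(-1)=q:=1-p$ (nearest-neighbour jump kernel with nonzero drift), and let $\alpha\in(c,1]^{\mathbb{Z}}$ be an environment such that $\liminf_{x\to-\infty}\alpha(x)=c$. Then for every $\eta_0\in\mathbb{N}^{\mathbb{Z}}$ and every bounded local nondecreasing function $h:\mathbf{X}\to\mathbb{R}$, the zero-range process $(\eta^\alpha_t)_{t\ge 0}$ in environment $\alpha$ started from $\eta_0$ satisfies $$\limsup_{t\to\infty}\mathbb{E}\,h(\eta_t^\alpha)\le\int_{\mathbf{X}}h(\eta)\,d\mu_c^\alpha(\eta).$$
   Context: Notation: $\mathbb{N}=\{0,1,2,\dots\}$, $\overline{\mathbb{N}}=\mathbb{N}\cup\{+\infty\}$, $\mathbf{X}=\overline{\mathbb{N}}^{\mathbb{Z}}$ with the coordinatewise order. Fix $c\in(0,1)$. An environment is a sequence $\alpha=(\alpha(x))_{x\in\mathbb{Z}}\in(c,1]^{\mathbb{Z}}$. Let $g:\mathbb{N}\to[0,+\infty)$ be nondecreasing with $g(0)=0<g(1)\le\lim_{n\to\infty}g(n)=1$, extended by $g(+\infty)=1$. Process: for a jump kernel $p(\cdot)$ (a probability measure on $\mathbb{Z}$), $(\eta^\alpha_t)_{t\ge0}$ is the Markov process on $\mathbf{X}$ with generator, for cylinder functions $f$, $$L^\alpha f(\eta)=\sum_{x,y\in\mathbb{Z}}\alpha(x)p(y-x)g(\eta(x))\,[f(\eta^{x,y})-f(\eta)],$$ where $\eta^{x,y}=\eta-\delta_x+\delta_y$ is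 obtained by moving one particle from $x$ to $y$ (a site with infinitely many particles keeps the value $+\infty$ when it loses or gains a particle). It is constructed as follows (Harris graphical construction): independent rate-$1$ Poisson clocks are attached to the sites; at each ring of the clock at $x$, at time $t$, independent marks $U$ uniform on $(0,1)$ and $Z\sim p(\cdot)$ are drawn, and if $U\le\alpha(x)g(\eta_{t-}(x))$ then one particle moves from $x$ to $x+Z$. $\mathbb{E}$ is expectation with respect to the clocks and marks ($\alpha$ and $\eta_0$ are deterministic). Invariant measures: for $\lambda\in[0,1)$, $\theta_\lambda$ is the probability measure on $\mathbb{N}$ with $\theta_\lambda(n)=Z(\lambda)^{-1}\lambda^n/g(n)!$, where $g(n)!=\prod_{k=1}^n g(k)$, $g(0)!=1$ and $Z(\lambda)=\sum_{n\ge0}\lambda^n/g(n)!$. For $\lambda\in[0,c]$, $\mu^\alpha_\lambda$ is the product measure on $\mathbf{X}$ whose marginal at site $x$ is $\theta_{\lambda/\alpha(x)}$. A function on $\mathbf{X}$ is local if it depends on finitely many coordinates. *)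

theory Defs
  imports "HOL-Probability.Probability"
begin

type_synonym config = "int \<Rightarrow> enat"

abbreviation config_space :: "config measure" where
  "config_space \<equiv> PiM UNIV (\<lambda>_. count_space UNIV)"

definition rate_function :: "(nat \<Rightarrow> real) \<Rightarrow> bool" where
  "rate_function g \<longleftrightarrow>
     (\<forall>n. 0 \<le> g n) \<and> mono g \<and> g 0 = 0 \<and> 0 < g 1 \<and> g 1 \<le> 1 \<and> g \<longlonglongrightarrow> 1"

definition rate_ext :: "(nat \<Rightarrow> real) \<Rightarrow> enat \<Rightarrow> real" where
  "rate_ext g k = (case k of enat n \<Rightarrow> g n | \<infinity> \<Rightarrow> 1)"

definition environment :: "real \<Rightarrow> (int \<Rightarrow> real) \<Rightarrow> bool" where
  "environment c \<alpha> \<longleftrightarrow> (\<forall>x. c < \<alpha> x \<and> \<alpha> x \<le> 1)"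

text \<open>On \<^typ>\<open>enat\<close> one has \<open>\<infinity> - 1 = \<infinity>\<close> and \<open>\<infinity> + 1 = \<infinity>\<close>, so infinite sites are unaffected.
  The truncated \<open>0 - 1 = 0\<close> is almost surely never used: the dynamics below moves a particle from
  \<open>x\<close> only if \<open>U \<le> \<alpha> x * rate_ext g (\<eta> x)\<close>, where \<open>U > 0\<close> and \<open>rate_ext g 0 = 0\<close>.\<close>

definition move :: "int \<Rightarrow> int \<Rightarrow> config \<Rightarrow> config" where
  "move x y \<eta> = (let \<zeta> = \<eta>(x := \<eta> x - 1) in \<zeta>(y := \<zeta> y + 1))"

text \<open>The Poisson clock at \<open>x\<close> is given by its i.i.d. \<open>Exp(1)\<close> waiting times \<open>W x 0, W x 1, \<dots>\<close>;
  the \<open>n\<close>-th ring carries the marks \<open>U x n\<close> and \<open>Z x n\<close>.\<close>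

definition ring_law :: "int pmf \<Rightarrow> (real \<times> real \<times> int) measure" where
  "ring_law K =
     density lborel (\<lambda>w. ennreal (exponential_density 1 w))
       \<Otimes>\<^sub>M (uniform_measure lborel {0<..<1} \<Otimes>\<^sub>M measure_pmf K)"

locale harris_system = prob_space M
  for M :: "'w measure" +
  fixes K :: "int pmf"
    and W U :: "int \<Rightarrow> nat \<Rightarrow> 'w \<Rightarrow> real"
    and Z :: "int \<Rightarrow> nat \<Rightarrow> 'w \<Rightarrow> int"
  assumes indep:
      "indep_vars (\<lambda>_. ring_law K) (\<lambda>(x, n) \<omega>. (W x n \<omega>, U x n \<omega>, Z x n \<omega>)) UNIV"
    and law: "\<And>x n. distr M (ring_law K) (\<lambda>\<omega>. (W x n \<omega>, U x n \<omega>, Z x n \<omega>)) = ring_law K"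

definition ring_time :: "(int \<Rightarrow> nat \<Rightarrow> real) \<Rightarrow> int \<Rightarrow> nat \<Rightarrow> real" where
  "ring_time w x n = (\<Sum>k\<le>n. w x k)"

text \<open>\<open>\<zeta>\<close> is the state just before time \<open>s\<close>. As each coordinate is piecewise constant, its left
  limit is the value it takes on some interval ending at \<open>s\<close>; that interval depends on the site.\<close>

definition state_before :: "(real \<Rightarrow> config) \<Rightarrow> real \<Rightarrow> config \<Rightarrow> bool" where
  "state_before \<xi> s \<zeta> \<longleftrightarrow> (\<forall>y. \<forall>\<^sub>F r in at_left s. \<xi> r y = \<zeta> y)"

text \<open>The graphical dynamics for one realisation \<open>w, u, z\<close> of waiting times and marks. The last
  clause says that a site keeps its value as long as no ring occurs at it or targets it.\<close>

definition harris_path ::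
  "(nat \<Rightarrow> real) \<Rightarrow> (int \<Rightarrow> real) \<Rightarrow> (int \<Rightarrow> nat \<Rightarrow> real) \<Rightarrow> (int \<Rightarrow> nat \<Rightarrow> real) \<Rightarrow>
   (int \<Rightarrow> nat \<Rightarrow> int) \<Rightarrow> config \<Rightarrow> (real \<Rightarrow> config) \<Rightarrow> bool" where
  "harris_path g \<alpha> w u z \<eta>\<^sub>0 \<xi> \<longleftrightarrow>
     \<xi> 0 = \<eta>\<^sub>0 \<and>
     (\<forall>x n. \<exists>\<zeta>. state_before \<xi> (ring_time w x n) \<zeta> \<and>
        \<xi> (ring_time w x n) =
          (if u x n \<le> \<alpha> x * rate_ext g (\<zeta> x) then move x (x + z x n) \<zeta> else \<zeta>)) \<and>
     (\<forall>y s t. 0 \<le> s \<longrightarrow> s \<le> t \<longrightarrow>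
        (\<forall>x n. s < ring_time w x n \<longrightarrow> ring_time w x n \<le> t \<longrightarrow> x \<noteq> y \<and> x + z x n \<noteq> y) \<longrightarrow>
        \<xi> t y = \<xi> s y)"

definition zero_range_process ::
  "'w measure \<Rightarrow> (nat \<Rightarrow> real) \<Rightarrow> (int \<Rightarrow> real) \<Rightarrow> (int \<Rightarrow> nat \<Rightarrow> 'w \<Rightarrow> real) \<Rightarrow>
   (int \<Rightarrow> nat \<Rightarrow> 'w \<Rightarrow> real) \<Rightarrow> (int \<Rightarrow> nat \<Rightarrow> 'w \<Rightarrow> int) \<Rightarrow> config \<Rightarrow>
   (real \<Rightarrow> 'w \<Rightarrow> config) \<Rightarrow> bool" where
  "zero_range_process M g \<alpha> W U Z \<eta>\<^sub>0 \<eta> \<longleftrightarrow>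
     (\<forall>t\<ge>0. \<eta> t \<in> M \<rightarrow>\<^sub>M config_space) \<and>
     (AE \<omega> in M. harris_path g \<alpha> (\<lambda>x n. W x n \<omega>) (\<lambda>x n. U x n \<omega>) (\<lambda>x n. Z x n \<omega>)
        \<eta>\<^sub>0 (\<lambda>t. \<eta> t \<omega>))"

definition g_fact :: "(nat \<Rightarrow> real) \<Rightarrow> nat \<Rightarrow> real" where
  "g_fact g n = (\<Prod>k=1..n. g k)"

definition partition_fun :: "(nat \<Rightarrow> real) \<Rightarrow> real \<Rightarrow> real" where
  "partition_fun g l = (\<Sum>n. l ^ n / g_fact g n)"

definition theta :: "(nat \<Rightarrow> real) \<Rightarrow> real \<Rightarrow> nat measure" where
  "theta g l =
     density (count_space UNIV) (\<lambda>n. ennreal (inverse (partition_fun g l) * l ^ n / g_fact g n))"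

definition mu :: "(nat \<Rightarrow> real) \<Rightarrow> (int \<Rightarrow> real) \<Rightarrow> real \<Rightarrow> config measure" where
  "mu g \<alpha> l = PiM UNIV (\<lambda>x. distr (theta g (l / \<alpha> x)) (count_space UNIV) enat)"

definition local_fun :: "(config \<Rightarrow> real) \<Rightarrow> bool" where
  "local_fun h \<longleftrightarrow> (\<exists>A. finite A \<and> (\<forall>\<eta> \<zeta>. (\<forall>x\<in>A. \<eta> x = \<zeta> x) \<longrightarrow> h \<eta> = h \<zeta>))"

end

theory Submission
  imports Defs
begin

text \<open>The zero-range process is attractive: adding particles to the initial state can only add
particles later. So it may be compared with a process in which all sites outside a finite set
\<open>\<Lambda>\<close> carry infinitely many particles. Such sites are inexhaustible reservoirs: whatever happens
outside a window \<open>{a..b}\<close> containing \<open>\<Lambda>\<close> and its neighbours is then irrelevant to the sites of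
\<open>\<Lambda>\<close>, on which the comparison process is a Markov chain with countably many states.

\<^bold>\<open>Equilibrium of the window.\<close> Suppose that \<open>\<phi>\<close> agrees with \<open>\<alpha>\<close> off \<open>\<Lambda>\<close>, is strictly below \<open>\<alpha>\<close>
on \<open>\<Lambda>\<close>, and satisfies \<open>\<phi> x = p * \<phi> (x - 1) + (1 - p) * \<phi> (x + 1)\<close> on \<open>\<Lambda>\<close>. Then the product of
the laws \<open>\<theta>\<close> with fugacity \<open>\<phi> x / \<alpha> x\<close> is invariant: the mean rate at which particles leave
\<open>x\<close> is \<open>\<phi> x\<close>, and harmonicity balances the flows (lemma \<open>equilibrium_stationary\<close>). The chain
converges to this law because it is lazy and can always be emptied towards the right
(\<open>window_chain_converges\<close>).

\<^bold>\<open>Choice of the window.\<close> Take for \<open>\<phi>\<close> the greatest function below \<open>\<alpha>\<close> that is subharmonic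
between \<open>a\<close> and \<open>b\<close>, and for \<open>\<Lambda>\<close> the set where it is strictly below \<open>\<alpha>\<close>: on that set it is
harmonic, and the remaining sites, which may be slow sites unable to carry the current, become
reservoirs. The random walk for which harmonicity is meant steps to the left with probability
\<open>p > 1/2\<close>, so it leaves \<open>(a, b)\<close> mostly through \<open>a\<close>; hence
\<open>\<phi> x \<le> \<alpha> a + ((1 - p) / p) ^ (b - x)\<close> by the maximum principle. By the hypothesis on the lower
limit, \<open>a\<close> can be chosen far to the left with \<open>\<alpha> a\<close> close to \<open>c\<close>; with \<open>b\<close> far to the right,
\<open>\<phi>\<close> is close to \<open>c\<close> on any prescribed finite set (\<open>fugacities_exist\<close>).

\<^bold>\<open>From clocks to the chain.\<close> The rings inside the window occur at the times of a Poisson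
process that is independent of the chain formed by the successive states. This is used in the
following form. For each realisation of the clocks, \<open>majorant n t \<zeta>\<close> is the value of \<open>h\<close> at
time \<open>t\<close> for the comparison process started from \<open>\<zeta>\<close>, replaced by a bound of \<open>h\<close> if at least
\<open>n\<close> rings have occurred. It is defined by recursion over the first ring, so its expectation
follows by induction from a decomposition of the clocks at the first ring
(\<open>first_ring_formula\<close>, which is where memorylessness enters), and turns out to be a Poisson
mixture of the powers of the transition operator (\<open>integral_majorant\<close>). Attractiveness gives
\<open>h (\<xi> t) \<le> majorant n t \<zeta>\<close> along every path (\<open>majorant_dominates\<close>).

Letting \<open>n\<close> and then \<open>t\<close> tend to infinity bounds the upper limit by the equilibrium
expectation of \<open>h\<close> in the window; letting \<open>\<phi>\<close> tend to \<open>c\<close> gives the claim, as the laws \<open>\<theta>\<close>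
depend continuously on the fugacity.\<close>

section \<open>Convergence of lazy Markov chains\<close>

definition kernel_op :: "('s \<Rightarrow> 's pmf) \<Rightarrow> ('s \<Rightarrow> real) \<Rightarrow> 's \<Rightarrow> real" where
  "kernel_op \<kappa> f s = measure_pmf.expectation (\<kappa> s) f"

lemma integrable_pmf_bounded:
  fixes f :: "'a \<Rightarrow> real"
  assumes "\<And>x. \<bar>f x\<bar> \<le> B"
  shows "integrable (measure_pmf p) f"
  by (rule measure_pmf.integrable_const_bound[where B = B]) (use assms in auto)

lemma expectation_pmf_bounds:
  fixes f :: "'a \<Rightarrow> real"
  assumes "\<And>x. \<bar>f x\<bar> \<le> B"
  shows "\<bar>measure_pmf.expectation p f\<bar> \<le> B"
proof -
  have "\<bar>measure_pmf.expectation p f\<bar> \<le> measure_pmf.expectation p (\<lambda>x. \<bar>f x\<bar>)"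
    by (rule integral_abs_bound)
  also have "\<dots> \<le> measure_pmf.expectation p (\<lambda>_. B)"
    using order_trans[OF abs_ge_zero assms[of undefined]]
    by (intro integral_mono integrable_pmf_bounded[where B = B]) (use assms in auto)
  finally show ?thesis by simp
qed

lemma expectation_bind_pmf:
  fixes f :: "'b \<Rightarrow> real"
  assumes "\<And>x. \<bar>f x\<bar> \<le> B"
  shows "measure_pmf.expectation (bind_pmf p \<kappa>) f =
         measure_pmf.expectation p (\<lambda>s. measure_pmf.expectation (\<kappa> s) f)"
  unfolding measure_pmf_bind
  by (rule integral_bind[where K = "count_space UNIV" and B = B and B' = 1])
    (use assms in \<open>auto simp: measure_pmf.emeasure_space_1 measure_pmf_in_subprob_algebra\<close>)

lemma abs_kernel_op_power_le:
  assumes "\<And>s. \<bar>f s\<bar> \<le> B"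
  shows "\<bar>(kernel_op \<kappa> ^^ n) f s\<bar> \<le> B"
proof (induction n arbitrary: s)
  case (Suc n)
  show ?case
    using expectation_pmf_bounds[OF Suc, of "\<kappa> s"] by (simp add: kernel_op_def[of \<kappa> _ s])
qed (use assms in auto)

lemma pmf_mult_square_le_expectation:
  fixes f :: "'a \<Rightarrow> real"
  assumes "\<And>x. \<bar>f x\<bar> \<le> B"
  shows "pmf p y * (f y)\<^sup>2 \<le> measure_pmf.expectation p (\<lambda>x. (f x)\<^sup>2)"
proof -
  have "pmf p y * (f y)\<^sup>2 = measure_pmf.expectation p (\<lambda>x. (f y)\<^sup>2 * indicator {y} x)"
    by (simp add: measure_pmf_single)
  also have "\<dots> \<le> measure_pmf.expectation p (\<lambda>x. (f x)\<^sup>2)"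
  proof (rule integral_mono)
    have "(f x)\<^sup>2 \<le> B\<^sup>2" for x using assms[of x]
        by (rule abs_le_square_iff[THEN iffD1, OF order_trans]) simp
    then show "integrable (measure_pmf p) (\<lambda>x. (f x)\<^sup>2)"
      by (intro integrable_pmf_bounded[where B = "B\<^sup>2"]) simp
    show "integrable (measure_pmf p) (\<lambda>x. (f y)\<^sup>2 * indicat_real {y} x)"
      by (intro integrable_pmf_bounded[where B = "(f y)\<^sup>2"]) (auto simp: indicator_def)
  qed (auto simp: indicator_def)
  finally show ?thesis .
qed

text \<open>In \<open>L\<^sup>2(\<mu>)\<close> the norms of the iterates decrease, and the loss at each step is the mean
conditional variance of the iterate along one transition. The losses are summable, so this
variance tends to zero; each single transition contributes to it with a fixed positive weight.\<close>

lemma kernel_power_difference_tendsto_0: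
  assumes stationary: "bind_pmf \<mu> \<kappa> = \<mu>"
    and bounded: "\<And>s. \<bar>f s\<bar> \<le> B"
    and s: "s \<in> set_pmf \<mu>" and s': "s' \<in> set_pmf (\<kappa> s)"
  shows "(\<lambda>n. (kernel_op \<kappa> ^^ n) f s' - (kernel_op \<kappa> ^^ Suc n) f s) \<longlonglongrightarrow> 0"
proof -
  define F where "F n = (kernel_op \<kappa> ^^ n) f" for n
  have F_bound: "\<bar>F n x\<bar> \<le> B" for n x
    unfolding F_def by (rule abs_kernel_op_power_le) (rule bounded)
  have F_Suc: "F (Suc n) x = measure_pmf.expectation (\<kappa> x) (F n)" for n x
    by (simp add: F_def kernel_op_def)
  have sq_bound: "(F n x)\<^sup>2 \<le> B\<^sup>2" for n x
    using F_bound[of n x] by (rule abs_le_square_iff[THEN iffD1, OF order_trans]) simp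
  have [simp]: "integrable (measure_pmf p) (F n)" for p n
    by (rule integrable_pmf_bounded) (rule F_bound)
  have [simp]: "integrable (measure_pmf p) (\<lambda>x. (F n x)\<^sup>2)" for p n
    by (rule integrable_pmf_bounded[where B = "B\<^sup>2"]) (simp add: sq_bound)
  define v where "v n = measure_pmf.expectation \<mu> (\<lambda>x. (F n x)\<^sup>2)" for n
  define w where "w n x = measure_pmf.expectation (\<kappa> x) (\<lambda>y. (F n y - F (Suc n) x)\<^sup>2)" for n x
  have w_eq: "w n x = measure_pmf.expectation (\<kappa> x) (\<lambda>y. (F n y)\<^sup>2) - (F (Suc n) x)\<^sup>2" for n x
    using measure_pmf.variance_eq[of "\<kappa> x" "F n"] by (simp add: w_def F_Suc)
  have E_bound: "\<bar>measure_pmf.expectation (\<kappa> x) (\<lambda>y. (F n y)\<^sup>2)\<bar> \<le> B\<^sup>2" for n x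
    by (rule expectation_pmf_bounds) (simp add: sq_bound)
  have [simp]: "integrable (measure_pmf \<mu>) (\<lambda>x. measure_pmf.expectation (\<kappa> x) (\<lambda>y. (F n y)\<^sup>2))" for n
    by (rule integrable_pmf_bounded) (rule E_bound)
  have [simp]: "integrable (measure_pmf \<mu>) (w n)" for n
    unfolding w_eq by simp
  have w_nonneg: "0 \<le> w n x" for n x
    unfolding w_def by (rule integral_nonneg_AE) simp
  have step: "v n - v (Suc n) = measure_pmf.expectation \<mu> (w n)" for n
  proof -
    have "v n = measure_pmf.expectation (bind_pmf \<mu> \<kappa>) (\<lambda>x. (F n x)\<^sup>2)"
      by (simp add: v_def stationary)
    also have "\<dots> = measure_pmf.expectation \<mu> (\<lambda>x. measure_pmf.expectation (\<kappa> x) (\<lambda>y. (F n y)\<^sup>2))"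
      by (rule expectation_bind_pmf[where B = "B\<^sup>2"]) (simp add: sq_bound)
    finally show ?thesis
      unfolding w_eq by (subst Bochner_Integration.integral_diff) (simp_all add: v_def)
  qed
  have v_nonneg: "0 \<le> v n" for n unfolding v_def by (rule integral_nonneg_AE) simp
  have "decseq v"
  proof (rule decseq_SucI)
    fix n
    have "0 \<le> measure_pmf.expectation \<mu> (w n)" by (rule integral_nonneg_AE) (simp add: w_nonneg)
    then show "v (Suc n) \<le> v n" using step[of n] by simp
  qed
  then obtain L where "v \<longlonglongrightarrow> L"
    using decseq_convergent[of v 0] v_nonneg by blast
  then have "(\<lambda>n. v n - v (Suc n)) \<longlonglongrightarrow> L - L"
    by (intro tendsto_diff) (simp_all add: LIMSEQ_Suc)
  then have lim0: "(\<lambda>n. v n - v (Suc n)) \<longlonglongrightarrow> 0" by simp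
  define k where "k = pmf \<mu> s * pmf (\<kappa> s) s'"
  have k_pos: "k > 0" using s s' by (simp add: k_def pmf_positive)
  have key: "k * (F n s' - F (Suc n) s)\<^sup>2 \<le> v n - v (Suc n)" for n
  proof -
    have "pmf (\<kappa> s) s' * (F n s' - F (Suc n) s)\<^sup>2 \<le> w n s"
      unfolding w_def
      by (rule pmf_mult_square_le_expectation[where B = "B + B"])
        (rule order_trans[OF abs_triangle_ineq4], intro add_mono F_bound)
    then have "k * (F n s' - F (Suc n) s)\<^sup>2 \<le> pmf \<mu> s * w n s"
      by (simp add: k_def mult.assoc mult_left_mono)
    also have "\<dots> = measure_pmf.expectation \<mu> (\<lambda>x. w n s * indicator {s} x)"
      by (simp add: measure_pmf_single)
    also have "\<dots> \<le> measure_pmf.expectation \<mu> (w n)"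
    proof (rule integral_mono)
      show "integrable (measure_pmf \<mu>) (\<lambda>x. w n s * indicat_real {s} x)"
        by (rule integrable_pmf_bounded[where B = "w n s"]) (auto simp: indicator_def w_nonneg)
    qed (auto simp: indicator_def w_nonneg)
    finally show ?thesis by (simp add: step)
  qed
  have "(\<lambda>n. k * (F n s' - F (Suc n) s)\<^sup>2) \<longlonglongrightarrow> 0"
    by (rule tendsto_sandwich[OF _ _ tendsto_const lim0]) (use key k_pos in auto)
  then have "(\<lambda>n. inverse k * (k * (F n s' - F (Suc n) s)\<^sup>2)) \<longlonglongrightarrow> inverse k * 0"
    by (rule tendsto_mult_left)
  then have "(\<lambda>n. (F n s' - F (Suc n) s)\<^sup>2) \<longlonglongrightarrow> 0"
    using k_pos by (simp add: mult.assoc[symmetric])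
  then have "(\<lambda>n. sqrt ((F n s' - F (Suc n) s)\<^sup>2)) \<longlonglongrightarrow> sqrt 0"
    by (rule tendsto_real_sqrt)
  then have "(\<lambda>n. F n s' - F (Suc n) s) \<longlonglongrightarrow> 0"
    by (simp add: tendsto_rabs_zero_iff)
  then show ?thesis by (simp add: F_def)
qed

text \<open>By the preceding lemma the iterates become equal along transitions, up to a shift of the
number of iterations that laziness removes. As all states lead to \<open>e\<close>, the iterates become
asymptotically constant on the support of \<open>\<mu>\<close>; the constant is the mean of \<open>f\<close>, which the
iterations preserve.\<close>

theorem kernel_powers_converge:
  assumes stationary: "bind_pmf \<mu> \<kappa> = \<mu>"
    and lazy: "\<And>s. s \<in> set_pmf \<mu> \<Longrightarrow> s \<in> set_pmf (\<kappa> s)"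
    and reach: "\<And>s. s \<in> set_pmf \<mu> \<Longrightarrow> (s, e) \<in> {(s, s'). s' \<in> set_pmf (\<kappa> s)}\<^sup>*"
    and bounded: "\<And>s. \<bar>f s\<bar> \<le> B"
    and s: "s \<in> set_pmf \<mu>"
  shows "(\<lambda>n. (kernel_op \<kappa> ^^ n) f s) \<longlonglongrightarrow> measure_pmf.expectation \<mu> f"
proof -
  define F where "F n = (kernel_op \<kappa> ^^ n) f" for n
  have F_bound: "\<bar>F n x\<bar> \<le> B" for n x
    unfolding F_def by (rule abs_kernel_op_power_le) (rule bounded)
  have edge: "(\<lambda>n. F n y - F n x) \<longlonglongrightarrow> 0" if x: "x \<in> set_pmf \<mu>" and y: "y \<in> set_pmf (\<kappa> x)" for x y
  proof -
    have "(\<lambda>n. (F n y - F (Suc n) x) - (F n x - F (Suc n) x)) \<longlonglongrightarrow> 0 - 0"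
      unfolding F_def using stationary bounded x y lazy[OF x]
      by (intro tendsto_diff kernel_power_difference_tendsto_0)
    then show ?thesis by simp
  qed
  have closed: "y \<in> set_pmf \<mu>" if "x \<in> set_pmf \<mu>" "y \<in> set_pmf (\<kappa> x)" for x y
    using that stationary by (metis UN_I set_bind_pmf)
  have "x \<in> set_pmf \<mu> \<longrightarrow> (\<lambda>n. F n e - F n x) \<longlonglongrightarrow> 0" if "(x, e) \<in> {(s, s'). s' \<in> set_pmf (\<kappa> s)}\<^sup>*" for x
    using that
  proof (induction rule: converse_rtrancl_induct)
    case (step y z)
    show ?case
    proof
      assume y: "y \<in> set_pmf \<mu>"
      have "z \<in> set_pmf \<mu>" using closed[OF y] step(1) by blast
      with step have "(\<lambda>n. F n e - F n z) \<longlonglongrightarrow> 0" by blast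
      moreover have "(\<lambda>n. F n z - F n y) \<longlonglongrightarrow> 0" using edge[OF y] step(1) by blast
      ultimately have "(\<lambda>n. (F n e - F n z) + (F n z - F n y)) \<longlonglongrightarrow> 0 + 0" by (rule tendsto_add)
      then show "(\<lambda>n. F n e - F n y) \<longlonglongrightarrow> 0" by simp
    qed
  qed simp
  then have to_e: "(\<lambda>n. F n e - F n x) \<longlonglongrightarrow> 0" if "x \<in> set_pmf \<mu>" for x
    using that reach by blast
  have diff: "(\<lambda>n. F n x - F n s) \<longlonglongrightarrow> 0" if "x \<in> set_pmf \<mu>" for x
  proof -
    have "(\<lambda>n. (F n e - F n s) - (F n e - F n x)) \<longlonglongrightarrow> 0 - 0"
      by (intro tendsto_diff to_e that s)
    then show ?thesis by simp
  qed
  have mean: "measure_pmf.expectation \<mu> (F n) = measure_pmf.expectation \<mu> f" for n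
  proof (induction n)
    case (Suc n)
    have "measure_pmf.expectation \<mu> (F (Suc n)) = measure_pmf.expectation (bind_pmf \<mu> \<kappa>) (F n)"
      by (subst expectation_bind_pmf[where B = B]) (simp_all add: F_bound, simp add:
          F_def kernel_op_def[abs_def])
    with Suc stationary show ?case by simp
  qed (simp add: F_def)
  have "(\<lambda>n. measure_pmf.expectation \<mu> (\<lambda>x. F n x - F n s)) \<longlonglongrightarrow> measure_pmf.expectation \<mu> (\<lambda>_. 0)"
  proof (rule integral_dominated_convergence[where w = "\<lambda>_. B + B"])
    show "AE x in measure_pmf \<mu>. (\<lambda>n. F n x - F n s) \<longlonglongrightarrow> 0"
      using diff by (simp add: AE_measure_pmf_iff)
    show "AE x in measure_pmf \<mu>. norm (F n x - F n s) \<le> B + B" for n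
      using order_trans[OF abs_triangle_ineq4 add_mono[OF F_bound F_bound]] by (intro AE_I2) simp
  qed auto
  then have "(\<lambda>n. measure_pmf.expectation \<mu> f - F n s) \<longlonglongrightarrow> 0"
    by (simp add: Bochner_Integration.integral_diff[OF integrable_pmf_bounded[OF F_bound]] mean)
  from tendsto_diff[OF tendsto_const[of "measure_pmf.expectation \<mu> f"] this]
  show ?thesis by (simp add: F_def)
qed

section \<open>The obstacle problem for the fugacities\<close>

definition subharmonic_between :: "real \<Rightarrow> int \<Rightarrow> int \<Rightarrow> (int \<Rightarrow> real) \<Rightarrow> bool" where
  "subharmonic_between p a b f \<longleftrightarrow>
     (\<forall>x. a < x \<longrightarrow> x < b \<longrightarrow> f x \<le> p * f (x - 1) + (1 - p) * f (x + 1))"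

text \<open>At the leftmost point where the maximum is attained, the left neighbour is strictly smaller
and has weight \<open>p > 0\<close>, so that point cannot be interior.\<close>

lemma maximum_principle:
  fixes f :: "int \<Rightarrow> real"
  assumes "subharmonic_between p a b f" "0 < p" "p \<le> 1"
    and "f a \<le> 0" "f b \<le> 0" and "a \<le> x" "x \<le> b"
  shows "f x \<le> 0"
proof -
  define m where "m = Max (f ` {a..b})"
  have le_m: "f y \<le> m" if "a \<le> y" "y \<le> b" for y
    unfolding m_def using that by (intro Max_ge) auto
  have "m \<in> f ` {a..b}" unfolding m_def using assms by (intro Max_in) auto
  then have ne: "{y \<in> {a..b}. f y = m} \<noteq> {}" by auto
  define y where "y = Min {y \<in> {a..b}. f y = m}"
  have fin: "finite {y \<in> {a..b}. f y = m}" by (rule finite_subset[of _ "{a..b}"]) auto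
  have "y \<in> {y \<in> {a..b}. f y = m}" unfolding y_def using ne fin by (intro Min_in)
  then have y: "a \<le> y" "y \<le> b" "f y = m" by auto
  have "m \<le> 0"
  proof (cases "y = a \<or> y = b")
    case True
    with y assms show ?thesis by auto
  next
    case False
    with y have y': "a < y" "y < b" by auto
    have "f (y - 1) \<noteq> m"
    proof
      assume "f (y - 1) = m"
      then have "y - 1 \<in> {y \<in> {a..b}. f y = m}" using y' by auto
      from Min_le[OF fin this] have "y \<le> y - 1" by (simp only: y_def)
      then show False by simp
    qed
    with le_m[of "y - 1"] y' have "p * f (y - 1) < p * m" using \<open>0 < p\<close> by simp
    moreover have "(1 - p) * f (y + 1) \<le> (1 - p) * m"
      using le_m[of "y + 1"] y' \<open>p \<le> 1\<close> by (intro mult_left_mono) auto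
    moreover have "f y \<le> p * f (y - 1) + (1 - p) * f (y + 1)"
      using assms(1) y' by (simp add: subharmonic_between_def)
    ultimately have False using y by (simp add: algebra_simps)
    then show ?thesis ..
  qed
  with le_m[of x] assms show ?thesis by simp
qed

definition subharmonic_minorants :: "real \<Rightarrow> (int \<Rightarrow> real) \<Rightarrow> int \<Rightarrow> int \<Rightarrow> (int \<Rightarrow> real) set" where
  "subharmonic_minorants p \<alpha> a b = {f. (\<forall>x. f x \<le> \<alpha> x) \<and> subharmonic_between p a b f}"

definition envelope :: "real \<Rightarrow> (int \<Rightarrow> real) \<Rightarrow> int \<Rightarrow> int \<Rightarrow> int \<Rightarrow> real" where
  "envelope p \<alpha> a b x = (SUP f\<in>subharmonic_minorants p \<alpha> a b. f x)"

context
  fixes p c :: real and \<alpha> :: "int \<Rightarrow> real" and a b :: int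
  assumes p: "0 \<le> p" "p \<le> 1" and c_le: "\<And>x. c \<le> \<alpha> x"
begin

lemma minorant_le_envelope: "f \<in> subharmonic_minorants p \<alpha> a b \<Longrightarrow> f x \<le> envelope p \<alpha> a b x"
  unfolding envelope_def
  by (rule cSUP_upper) (auto simp: bdd_above_def subharmonic_minorants_def intro!: exI[of _ "\<alpha> x"])

text \<open>The constant \<open>c\<close> raised to \<open>\<alpha> x\<close> at a point outside the open interval: this shows both that
the envelope is at least \<open>c\<close> and that it touches \<open>\<alpha>\<close> outside the interval.\<close>

lemma spike_minorant:
  assumes "x \<le> a \<or> b \<le> x"
  shows "(\<lambda>y. if y = x then \<alpha> x else c) \<in> subharmonic_minorants p \<alpha> a b"
proof -
  have "c \<le> p * (if y - 1 = x then \<alpha> x else c) + (1 - p) * (if y + 1 = x then \<alpha> x else c)" for y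
  proof -
    have "p * c \<le> p * (if y - 1 = x then \<alpha> x else c)"
      "(1 - p) * c \<le> (1 - p) * (if y + 1 = x then \<alpha> x else c)"
      using p c_le[of x] by (auto intro!: mult_left_mono)
    then show ?thesis by (simp add: algebra_simps)
  qed
  with assms c_le show ?thesis
    by (auto simp: subharmonic_minorants_def subharmonic_between_def)
qed

lemma minorants_nonempty: "subharmonic_minorants p \<alpha> a b \<noteq> {}"
  using spike_minorant[of a] by auto

lemma envelope_least:
  assumes "\<And>f. f \<in> subharmonic_minorants p \<alpha> a b \<Longrightarrow> f x \<le> m"
  shows "envelope p \<alpha> a b x \<le> m"
  unfolding envelope_def by (rule cSUP_least) (use minorants_nonempty assms in auto)

lemma envelope_le: "envelope p \<alpha> a b x \<le> \<alpha> x"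
  by (rule envelope_least) (auto simp: subharmonic_minorants_def)

lemma envelope_ge: "c \<le> envelope p \<alpha> a b x"
  using minorant_le_envelope[OF spike_minorant[of a], of x] c_le[of a] by (auto split: if_splits)

lemma envelope_outside: "x \<le> a \<or> b \<le> x \<Longrightarrow> envelope p \<alpha> a b x = \<alpha> x"
  using minorant_le_envelope[OF spike_minorant[of x], of x] envelope_le[of x] by auto

lemma envelope_subharmonic: "subharmonic_between p a b (envelope p \<alpha> a b)"
  unfolding subharmonic_between_def
proof (intro allI impI)
  fix x assume x: "a < x" "x < b"
  show "envelope p \<alpha> a b x \<le> p * envelope p \<alpha> a b (x - 1) + (1 - p) * envelope p \<alpha> a b (x + 1)"
  proof (rule envelope_least)
    fix f assume f: "f \<in> subharmonic_minorants p \<alpha> a b"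
    then have "f x \<le> p * f (x - 1) + (1 - p) * f (x + 1)"
      using x by (simp add: subharmonic_minorants_def subharmonic_between_def)
    also have "\<dots> \<le> p * envelope p \<alpha> a b (x - 1) + (1 - p) * envelope p \<alpha> a b (x + 1)"
      using p by (intro add_mono mult_left_mono minorant_le_envelope f) auto
    finally show "f x \<le> \<dots>" .
  qed
qed

text \<open>Where the envelope does not touch the obstacle, strict subharmonicity would leave room to
raise it at that single point, as raising one value only helps the inequality at the
neighbours.\<close>

lemma envelope_harmonic:
  assumes "envelope p \<alpha> a b x < \<alpha> x"
  shows "envelope p \<alpha> a b x = p * envelope p \<alpha> a b (x - 1) + (1 - p) * envelope p \<alpha> a b (x + 1)"
proof (rule antisym)
  define \<phi> where "\<phi> = envelope p \<alpha> a b"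
  define r where "r = p * \<phi> (x - 1) + (1 - p) * \<phi> (x + 1)"
  have x: "a < x" "x < b" using assms envelope_outside[of x] by force+
  show "envelope p \<alpha> a b x \<le> p * envelope p \<alpha> a b (x - 1) + (1 - p) * envelope p \<alpha> a b (x + 1)"
    using envelope_subharmonic x by (simp add: subharmonic_between_def)
  define f where "f = \<phi>(x := min (\<alpha> x) r)"
  have sub: "\<phi> y \<le> p * \<phi> (y - 1) + (1 - p) * \<phi> (y + 1)" if "a < y" "y < b" for y
    using envelope_subharmonic that by (simp add: \<phi>_def subharmonic_between_def)
  have f_ge: "\<phi> y \<le> f y" for y
    using sub[OF x] envelope_le[of x] by (auto simp: f_def r_def \<phi>_def)
  have "f y \<le> p * f (y - 1) + (1 - p) * f (y + 1)" if y: "a < y" "y < b" for y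
  proof -
    have "f y \<le> p * \<phi> (y - 1) + (1 - p) * \<phi> (y + 1)"
      using sub[OF y] by (auto simp: f_def r_def)
    also have "\<dots> \<le> p * f (y - 1) + (1 - p) * f (y + 1)"
      using p by (intro add_mono mult_left_mono f_ge) auto
    finally show ?thesis .
  qed
  then have "f \<in> subharmonic_minorants p \<alpha> a b"
    using envelope_le by (auto simp: subharmonic_minorants_def subharmonic_between_def f_def \<phi>_def)
  from minorant_le_envelope[OF this, of x] have "min (\<alpha> x) r \<le> envelope p \<alpha> a b x"
    by (simp add: f_def)
  with assms show "p * envelope p \<alpha> a b (x - 1) + (1 - p) * envelope p \<alpha> a b (x + 1)
      \<le> envelope p \<alpha> a b x"
    by (auto simp: r_def \<phi>_def)
qed

text \<open>The function \<open>((1 - p) / p) ^ (b - x)\<close> is harmonic; added to \<open>\<alpha> a\<close> it dominates the envelope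
at both end points, where the envelope equals \<open>\<alpha>\<close>. The bound stays useful because the ratio is
below \<open>1\<close> for a drift to the right.\<close>

lemma envelope_upper_bound:
  assumes p_half: "1/2 < p" and \<alpha>: "0 \<le> \<alpha> a" "\<alpha> b \<le> 1" and x: "a \<le> x" "x \<le> b"
  shows "envelope p \<alpha> a b x \<le> \<alpha> a + ((1 - p) / p) ^ nat (b - x)"
proof -
  define r where "r = (1 - p) / p"
  have r: "0 \<le> r" "1 - p = p * r" using p p_half by (auto simp: r_def)
  have sub: "subharmonic_between p a b (\<lambda>y. envelope p \<alpha> a b y - (\<alpha> a + r ^ nat (b - y)))"
    unfolding subharmonic_between_def
  proof (intro allI impI)
    fix y assume y: "a < y" "y < b"
    define n where "n = nat (b - y - 1)"
    have n: "nat (b - y) = Suc n" "nat (b - (y - 1)) = Suc (Suc n)" "nat (b - (y + 1)) = n"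
      using y by (auto simp: n_def)
    have "p * r ^ Suc (Suc n) + (1 - p) * r ^ n = r ^ Suc n * (p * r + p)"
      by (simp add: r(2) algebra_simps)
    also have "p * r + p = 1" using r(2) by simp
    finally have "p * r ^ Suc (Suc n) + (1 - p) * r ^ n = r ^ Suc n" by simp
    moreover have "envelope p \<alpha> a b y \<le> p * envelope p \<alpha> a b (y - 1) + (1 - p)
        * envelope p \<alpha> a b (y + 1)"
      using envelope_subharmonic y by (simp add: subharmonic_between_def)
    ultimately show "envelope p \<alpha> a b y - (\<alpha> a + r ^ nat (b - y)) \<le>
       p * (envelope p \<alpha> a b (y - 1) - (\<alpha> a + r ^ nat (b - (y - 1)))) +
       (1 - p) * (envelope p \<alpha> a b (y + 1) - (\<alpha> a + r ^ nat (b - (y + 1))))"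
      unfolding n by (simp add: algebra_simps)
  qed
  have "envelope p \<alpha> a b x - (\<alpha> a + r ^ nat (b - x)) \<le> 0"
    by (rule maximum_principle[OF sub _ _ _ _ x])
      (use p p_half r \<alpha> envelope_outside[of a] envelope_outside[of b] in auto)
  then show ?thesis by (simp add: r_def)
qed

end

text \<open>The profile is the envelope of \<open>\<alpha>\<close> for a left end with \<open>\<alpha> a\<close> near \<open>c\<close> and a right end far
away. The set \<open>A\<close> avoids the contact set because \<open>\<alpha>\<close> exceeds \<open>c\<close> there by a fixed amount.\<close>

lemma fugacities_exist:
  assumes env: "environment c \<alpha>" and c: "0 < c"
    and liminf: "Liminf at_bot (\<lambda>x. ereal (\<alpha> x)) = ereal c"
    and p: "1/2 < p" "p \<le> 1" and A: "finite A" and e: "0 < e"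
  obtains a b \<Lambda> \<phi> where "a < b" "\<Lambda> \<subseteq> {a<..<b}" "A \<subseteq> \<Lambda>"
    "\<And>x. c \<le> \<phi> x" "\<And>x. x \<in> \<Lambda> \<Longrightarrow> \<phi> x < \<alpha> x" "\<And>x. x \<notin> \<Lambda> \<Longrightarrow> \<phi> x = \<alpha> x"
    "\<And>x. x \<in> \<Lambda> \<Longrightarrow> \<phi> x = p * \<phi> (x - 1) + (1 - p) * \<phi> (x + 1)"
    "\<And>x. x \<in> A \<Longrightarrow> \<phi> x \<le> c + e"
proof -
  \<comment> \<open>at most half the distance from \<open>c\<close> to \<open>\<alpha>\<close> on \<open>A\<close>, so that a profile within \<open>d\<close> of \<open>c\<close> stays below \<open>\<alpha>\<close> there\<close>
  define d where "d = Min (insert e ((\<lambda>x. (\<alpha> x - c) / 2) ` A))"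
  have d_in: "d \<in> insert e ((\<lambda>x. (\<alpha> x - c) / 2) ` A)"
    unfolding d_def using A by (intro Min_in) auto
  then have d: "0 < d" using e env by (auto simp: environment_def)
  have d_e: "d \<le> e" and d_A: "x \<in> A \<Longrightarrow> d \<le> (\<alpha> x - c) / 2" for x
  proof -
    show "d \<le> e" unfolding d_def using A by (intro Min_le) auto
    show "d \<le> (\<alpha> x - c) / 2" if "x \<in> A" unfolding d_def using A that by (intro Min_le) auto
  qed
  obtain l where l: "\<And>x. x \<in> A \<Longrightarrow> l < x" "\<And>x. x \<in> A \<Longrightarrow> x < - l"
  proof
    fix x assume "x \<in> A"
    then have "\<bar>x\<bar> \<le> Max (abs ` A)" using A by (intro Max_ge) auto
    then show "- (Max (abs ` A)) - 1 < x" "x < - (- (Max (abs ` A)) - 1)" by auto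
  qed
  obtain a where a: "a \<le> l" "\<alpha> a < c + d / 2"
  proof -
    have "\<exists>a\<le>l. \<alpha> a < c + d / 2"
    proof (rule ccontr)
      assume "\<not> ?thesis"
      then have "\<forall>\<^sub>F x in at_bot. ereal (c + d / 2) \<le> ereal (\<alpha> x)"
        unfolding eventually_at_bot_linorder by (intro exI[of _ l]) (auto simp: not_less)
      then have "ereal (c + d / 2) \<le> Liminf at_bot (\<lambda>x. ereal (\<alpha> x))"
        by (rule Liminf_bounded)
      with liminf d show False by simp
    qed
    then show ?thesis using that by blast
  qed
  have "(1 - p) / p < 1" "0 \<le> (1 - p) / p" using p by auto
  then obtain n where n: "((1 - p) / p) ^ n < d / 2"
    using real_arch_pow_inv[of "d / 2" "(1 - p) / p"] d by auto
  define b where "b = max (- l) (l + 1) + int n"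
  define \<phi> where "\<phi> = envelope p \<alpha> a b"
  define \<Lambda> where "\<Lambda> = {x. \<phi> x < \<alpha> x}"
  have p': "0 \<le> p" "p \<le> 1" using p by auto
  have c_le: "c \<le> \<alpha> x" and \<alpha>1: "\<alpha> x \<le> 1" for x using env by (auto simp: environment_def less_imp_le)
  note rules = envelope_le envelope_ge envelope_outside envelope_harmonic envelope_upper_bound
  note rules = rules[where p = p and c = c and \<alpha> = \<alpha> and a = a and b = b, OF p' c_le]
  have bound: "\<phi> x \<le> c + d" if x: "x \<in> A" for x
  proof -
    have xb: "a \<le> x" "x \<le> b" using l[OF x] a by (auto simp: b_def)
    have "\<phi> x \<le> \<alpha> a + ((1 - p) / p) ^ nat (b - x)"
      unfolding \<phi>_def using p(1) c c_le[of a] \<alpha>1 xb by (intro rules) auto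
    also have "((1 - p) / p) ^ nat (b - x) \<le> ((1 - p) / p) ^ n"
      using p l[OF x] by (intro power_decreasing) (auto simp: b_def)
    finally show ?thesis using n a by simp
  qed
  show thesis
  proof (rule that[of a b \<Lambda> \<phi>])
    show "a < b" using a by (auto simp: b_def)
    show "\<Lambda> \<subseteq> {a<..<b}" 
    proof
      fix x assume "x \<in> \<Lambda>"
      then have "\<not> (x \<le> a \<or> b \<le> x)" using rules(3)[of x] by (auto simp: \<Lambda>_def \<phi>_def)
      then show "x \<in> {a<..<b}" by auto
    qed
    show "A \<subseteq> \<Lambda>"
    proof
      fix x assume x: "x \<in> A"
      show "x \<in> \<Lambda>" using bound[OF x] d_A[OF x] d by (auto simp: \<Lambda>_def)
    qed
    show "\<phi> x = p * \<phi> (x - 1) + (1 - p) * \<phi> (x + 1)" if "x \<in> \<Lambda>" for x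
      using that rules(4)[of x] by (simp add: \<Lambda>_def \<phi>_def)
    show "x \<notin> \<Lambda> \<Longrightarrow> \<phi> x = \<alpha> x" for x
      using rules(1)[of x] by (auto simp: \<Lambda>_def \<phi>_def)
    show "c \<le> \<phi> x" for x by (simp add: \<phi>_def rules)
    show "x \<in> A \<Longrightarrow> \<phi> x \<le> c + e" for x using bound[of x] d_e by auto
  qed (simp add: \<Lambda>_def)
qed

section \<open>Equilibrium between infinite reservoirs\<close>

lemma rate_functionD:
  assumes "rate_function g"
  shows "g 0 = 0" "0 \<le> g n" "g n \<le> 1" "0 < n \<Longrightarrow> 0 < g n"
proof -
  from assms have g: "0 \<le> g n" "mono g" "g 0 = 0" "0 < g 1" "g \<longlonglongrightarrow> 1"
    by (auto simp: rate_function_def)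
  show "g 0 = 0" "0 \<le> g n" by fact+
  show "g n \<le> 1" using incseq_le[of g 1] g by simp
  show "0 < n \<Longrightarrow> 0 < g n" using monoD[OF \<open>mono g\<close>, of 1 n] g by simp
qed

lemma rate_ext_simps [simp]: "rate_ext g (enat n) = g n" "rate_ext g \<infinity> = 1"
  by (simp_all add: rate_ext_def)

lemma rate_ext_bounds:
  assumes "rate_function g"
  shows "0 \<le> rate_ext g k" "rate_ext g k \<le> 1"
  using rate_functionD[OF assms] by (cases k; simp)+

lemma g_fact_Suc: "g_fact g (Suc n) = g_fact g n * g (Suc n)"
  by (simp add: g_fact_def prod.nat_ivl_Suc' mult.commute)

lemma g_fact_0 [simp]: "g_fact g 0 = 1"
  by (simp add: g_fact_def)

lemma g_fact_pos: "rate_function g \<Longrightarrow> 0 < g_fact g n"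
  unfolding g_fact_def by (intro prod_pos) (auto intro: rate_functionD(4))

lemma summable_partition:
  assumes g: "rate_function g" and l: "0 \<le> l" "l < 1"
  shows "summable (\<lambda>n. l ^ n / g_fact g n)"
proof -
  have "g \<longlonglongrightarrow> 1" using g by (simp add: rate_function_def)
  moreover obtain m where m: "l < m" "m < 1" using l dense by blast
  ultimately have "\<forall>\<^sub>F n in sequentially. m < g n" by (intro order_tendstoD)
  then obtain N where N: "\<And>n. N \<le> n \<Longrightarrow> m < g n" by (auto simp: eventually_sequentially)
  show ?thesis
  proof (rule summable_ratio_test[where c = "l / m" and N = N])
    show "l / m < 1" using l m by simp
    fix n assume n: "N \<le> n"
    have "l ^ Suc n / g_fact g (Suc n) = (l / g (Suc n)) * (l ^ n / g_fact g n)"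
      by (simp add: g_fact_Suc)
    also have "\<dots> \<le> l / m * (l ^ n / g_fact g n)"
      using N[of "Suc n"] n l m g_fact_pos[OF g, of n]
      by (intro mult_right_mono divide_left_mono) (auto intro: less_imp_le)
    finally show "norm (l ^ Suc n / g_fact g (Suc n)) \<le> l / m * norm (l ^ n / g_fact g n)"
      using g_fact_pos[OF g] l by (simp add: less_imp_le)
  qed
qed

lemma partition_fun_ge_1:
  assumes g: "rate_function g" and l: "0 \<le> l" "l < 1"
  shows "1 \<le> partition_fun g l"
proof -
  have "(\<Sum>n\<in>{0}. l ^ n / g_fact g n) \<le> (\<Sum>n. l ^ n / g_fact g n)"
    by (rule sum_le_suminf[OF summable_partition[OF g l]])
      (auto intro!: divide_nonneg_nonneg less_imp_le[OF g_fact_pos[OF g]] simp: l)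
  then show ?thesis by (simp add: partition_fun_def)
qed

definition theta_pmf :: "(nat \<Rightarrow> real) \<Rightarrow> real \<Rightarrow> nat pmf" where
  "theta_pmf g l = embed_pmf (\<lambda>n. inverse (partition_fun g l) * l ^ n / g_fact g n)"

lemma pmf_theta_pmf:
  assumes g: "rate_function g" and l: "0 \<le> l" "l < 1"
  shows "pmf (theta_pmf g l) n = inverse (partition_fun g l) * l ^ n / g_fact g n"
  unfolding theta_pmf_def
proof (rule pmf_embed_pmf)
  let ?w = "\<lambda>n. inverse (partition_fun g l) * l ^ n / g_fact g n"
  note pos = g_fact_pos[OF g] partition_fun_ge_1[OF g l]
  show nonneg: "0 \<le> ?w n" for n
    using pos(1)[of n] pos(2) l by simp
  have "?w sums (inverse (partition_fun g l) * partition_fun g l)"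
    unfolding partition_fun_def times_divide_eq_right[symmetric]
    by (intro sums_mult summable_sums summable_partition g l)
  then have "?w sums 1" using pos(2) by simp
  then have "(\<Sum>n. ennreal (?w n)) = 1"
    using nonneg by (subst suminf_ennreal2) (auto simp: sums_iff)
  then show "(\<integral>\<^sup>+ n. ennreal (?w n) \<partial>count_space UNIV) = 1"
    by (simp add: nn_integral_count_space_nat)
qed

lemma theta_eq_theta_pmf:
  assumes g: "rate_function g" and l: "0 \<le> l" "l < 1"
  shows "theta g l = measure_pmf (theta_pmf g l)"
  unfolding theta_def by (simp add: pmf_theta_pmf[OF assms, symmetric] measure_pmf_eq_density)

lemma expectation_pmf_nat_sums:
  fixes f :: "nat \<Rightarrow> real"
  assumes "\<And>n. \<bar>f n\<bar> \<le> B"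
  shows "(\<lambda>n. pmf p n * f n) sums measure_pmf.expectation p f"
proof -
  have "integrable (measure_pmf p) f" using assms by (rule integrable_pmf_bounded)
  then have "integrable (count_space UNIV) (\<lambda>n. pmf p n * f n)"
    by (simp add: measure_pmf_eq_density integrable_real_density)
  from sums_integral_count_space_nat[OF this]
  show ?thesis by (simp add: measure_pmf_eq_density integral_real_density)
qed

text \<open>Shifting the summation index turns the weight \<open>l ^ n / g_fact g n\<close> times \<open>g n\<close> into \<open>l\<close> times
the preceding weight. This is the only property of \<open>\<theta>\<close> behind the invariance of the product
laws.\<close>

lemma theta_balance:
  fixes F :: "nat \<Rightarrow> real"
  assumes g: "rate_function g" and l: "0 \<le> l" "l < 1" and F: "\<And>n. \<bar>F n\<bar> \<le> B"
  shows "measure_pmf.expectation (theta_pmf g l) (\<lambda>n. g n * F n) =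
         l * measure_pmf.expectation (theta_pmf g l) (\<lambda>n. F (Suc n))"
proof -
  let ?p = "pmf (theta_pmf g l)"
  have gF: "\<bar>g n * F n\<bar> \<le> B" for n
    using mult_mono[OF rate_functionD(3)[OF g, of n] F[of n]] rate_functionD(2)[OF g, of n]
    by (simp add: abs_mult)
  have shift: "?p (Suc n) * (g (Suc n) * F (Suc n)) = l * (?p n * F (Suc n))" for n
  proof -
    have "?p (Suc n) * g (Suc n) = l * ?p n"
      using rate_functionD(4)[OF g, of "Suc n"] g_fact_pos[OF g, of n]
      by (simp add: pmf_theta_pmf[OF g l] g_fact_Suc)
    then show ?thesis by (metis mult.assoc)
  qed
  have "(\<lambda>n. ?p (Suc n) * (g (Suc n) * F (Suc n))) sums
        (measure_pmf.expectation (theta_pmf g l) (\<lambda>n. g n * F n))"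
    using expectation_pmf_nat_sums[of "\<lambda>n. g n * F n" B "theta_pmf g l", OF gF]
    by (subst sums_Suc_iff) (simp add: rate_functionD(1)[OF g])
  moreover have "(\<lambda>n. l * (?p n * F (Suc n))) sums
        (l * measure_pmf.expectation (theta_pmf g l) (\<lambda>n. F (Suc n)))"
    by (intro sums_mult expectation_pmf_nat_sums[where B = B] F)
  ultimately show ?thesis unfolding shift by (rule sums_unique2)
qed

text \<open>The default value of the product distribution is \<open>\<infinity>\<close>: the sites outside \<open>\<Lambda>\<close> are the
reservoirs.\<close>

definition equilibrium :: "(nat \<Rightarrow> real) \<Rightarrow> (int \<Rightarrow> real) \<Rightarrow> (int \<Rightarrow> real) \<Rightarrow> int set \<Rightarrow> config pmf" where
  "equilibrium g \<alpha> \<phi> \<Lambda> = Pi_pmf \<Lambda> \<infinity> (\<lambda>x. map_pmf enat (theta_pmf g (\<phi> x / \<alpha> x)))"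

text \<open>One ring of the window: as all clocks have the same rate, the next ring is uniform on \<open>I\<close>.\<close>

definition ring_kernel ::
  "(nat \<Rightarrow> real) \<Rightarrow> (int \<Rightarrow> real) \<Rightarrow> int pmf \<Rightarrow> int set \<Rightarrow> config \<Rightarrow> config pmf" where
  "ring_kernel g \<alpha> K I \<zeta> =
     bind_pmf (pmf_of_set I) (\<lambda>i. bind_pmf (bernoulli_pmf (\<alpha> i * rate_ext g (\<zeta> i)))
       (\<lambda>m. if m then map_pmf (\<lambda>z. move i (i + z) \<zeta>) K else return_pmf \<zeta>))"

lemma kernel_op_ring_kernel:
  fixes f :: "config \<Rightarrow> real"
  assumes I: "finite I" "I \<noteq> {}" and f: "\<And>\<zeta>. \<bar>f \<zeta>\<bar> \<le> B"
    and rate: "\<And>i. 0 \<le> \<alpha> i * rate_ext g (\<zeta> i)" "\<And>i. \<alpha> i * rate_ext g (\<zeta> i) \<le> 1"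
  shows "kernel_op (ring_kernel g \<alpha> K I) f \<zeta> =
    (\<Sum>i\<in>I. \<alpha> i * rate_ext g (\<zeta> i) * measure_pmf.expectation K (\<lambda>z. f (move i (i + z) \<zeta>))
            + (1 - \<alpha> i * rate_ext g (\<zeta> i)) * f \<zeta>) / real (card I)"
  unfolding kernel_op_def ring_kernel_def
  using rate I
  by (simp add: expectation_bind_pmf[of f B, OF f] integral_pmf_of_set[OF I(2,1)])
    (intro disjI2 sum.cong refl, simp add: mult.commute)

lemma move_add: "y \<noteq> x \<Longrightarrow> move x y (\<eta>(x := \<eta> x + 1)) = \<eta>(y := \<eta> y + 1)"
proof -
  have "k + 1 - 1 = k" for k :: enat by (cases k) (auto simp: one_enat_def)
  then show "y \<noteq> x \<Longrightarrow> move x y (\<eta>(x := \<eta> x + 1)) = \<eta>(y := \<eta> y + 1)"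
    by (auto simp: move_def Let_def fun_eq_iff)
qed

text \<open>The parameter \<open>\<phi>\<close> is the fugacity profile: \<open>\<phi> x\<close> is the mean rate at which particles leave \<open>x\<close>
in equilibrium. At a reservoir this is the full rate \<open>\<alpha> x\<close>. Both end points \<open>a\<close> and \<open>b\<close> are
reservoirs, so all jumps into or out of \<open>\<Lambda>\<close> are caused by rings in \<open>{a..b}\<close>.\<close>

locale window =
  fixes g :: "nat \<Rightarrow> real" and \<alpha> \<phi> :: "int \<Rightarrow> real" and p :: real and K :: "int pmf"
    and a b :: int and \<Lambda> :: "int set"
  assumes g: "rate_function g"
    and \<alpha>: "\<And>x. 0 < \<alpha> x" "\<And>x. \<alpha> x \<le> 1"
    and p: "0 < p" "p \<le> 1" and K: "pmf K 1 = p" "pmf K (- 1) = 1 - p"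
    and ab: "a < b" and \<Lambda>: "\<Lambda> \<subseteq> {a<..<b}"
    and \<phi>_nonneg: "\<And>x. 0 \<le> \<phi> x"
    and subcritical: "\<And>x. x \<in> \<Lambda> \<Longrightarrow> \<phi> x < \<alpha> x"
    and reservoir: "\<And>x. x \<notin> \<Lambda> \<Longrightarrow> \<phi> x = \<alpha> x"
    and harmonic: "\<And>x. x \<in> \<Lambda> \<Longrightarrow> \<phi> x = p * \<phi> (x - 1) + (1 - p) * \<phi> (x + 1)"
begin

abbreviation "\<mu> \<equiv> equilibrium g \<alpha> \<phi> \<Lambda>"
abbreviation "\<kappa> \<equiv> ring_kernel g \<alpha> K {a..b}"

lemma finite_\<Lambda>: "finite \<Lambda>"
  using \<Lambda> by (rule finite_subset) simp

lemma set_K: "set_pmf K \<subseteq> {1, - 1}"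
proof -
  have "measure_pmf.prob K {1, -1} = 1"
    by (subst measure_measure_pmf_finite) (auto simp: K)
  then have "AE z in K. z \<in> {1, -1}" by (subst measure_pmf.AE_in_set_eq_1) auto
  then show ?thesis by (auto simp: AE_measure_pmf_iff)
qed

lemma expectation_K: "measure_pmf.expectation K f = p * f 1 + (1 - p) * f (- 1)"
  for f :: "int \<Rightarrow> real"
  by (subst integral_measure_pmf_real[of "{1, -1}"]) (use set_K in \<open>auto simp: K\<close>)

lemma rate_bounds:
  "0 \<le> \<alpha> i * rate_ext g k" "\<alpha> i * rate_ext g k \<le> 1"
  using rate_ext_bounds[OF g, of k] \<alpha>[of i] by (auto intro: mult_le_one)

lemma fugacity: "x \<in> \<Lambda> \<Longrightarrow> 0 \<le> \<phi> x / \<alpha> x" "x \<in> \<Lambda> \<Longrightarrow> \<phi> x / \<alpha> x < 1"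
  using subcritical[of x] \<phi>_nonneg[of x] \<alpha>(1)[of x] by auto

lemma set_\<mu>_outside: "\<eta> \<in> set_pmf \<mu> \<Longrightarrow> x \<notin> \<Lambda> \<Longrightarrow> \<eta> x = \<infinity>"
  using set_Pi_pmf_subset[OF finite_\<Lambda>] by (fastforce simp: equilibrium_def)

lemma set_\<mu>_iff:
  "\<eta> \<in> set_pmf \<mu> \<longleftrightarrow> (\<forall>x\<in>\<Lambda>. \<eta> x \<in> enat ` set_pmf (theta_pmf g (\<phi> x / \<alpha> x))) \<and> (\<forall>x. x \<notin> \<Lambda> \<longrightarrow> \<eta> x = \<infinity>)"
  by (auto simp: equilibrium_def set_Pi_pmf[OF finite_\<Lambda>] PiE_dflt_def)

lemma balance_inside:
  fixes F :: "config \<Rightarrow> real"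
  assumes x: "x \<in> \<Lambda>" and F: "\<And>\<eta>. \<bar>F \<eta>\<bar> \<le> B"
  shows "measure_pmf.expectation \<mu> (\<lambda>\<eta>. rate_ext g (\<eta> x) * F \<eta>) =
         \<phi> x / \<alpha> x * measure_pmf.expectation \<mu> (\<lambda>\<eta>. F (\<eta>(x := \<eta> x + 1)))"
proof -
  define \<theta> where "\<theta> = theta_pmf g (\<phi> x / \<alpha> x)"
  define R where "R = Pi_pmf (\<Lambda> - {x}) \<infinity> (\<lambda>x. map_pmf enat (theta_pmf g (\<phi> x / \<alpha> x)))"
  have \<mu>_eq: "\<mu> = bind_pmf \<theta> (\<lambda>n. map_pmf (\<lambda>\<eta>. \<eta>(x := enat n)) R)"
  proof -
    have "\<mu> = Pi_pmf (insert x (\<Lambda> - {x})) \<infinity> (\<lambda>x. map_pmf enat (theta_pmf g (\<phi> x / \<alpha> x)))"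
      using x by (simp add: equilibrium_def insert_absorb)
    also have "\<dots> = map_pmf (\<lambda>(y, f). f(x := y)) (pair_pmf (map_pmf enat \<theta>) R)"
      by (subst Pi_pmf_insert) (use finite_\<Lambda> in \<open>auto simp: \<theta>_def R_def\<close>)
    also have "\<dots> = bind_pmf \<theta> (\<lambda>n. map_pmf (\<lambda>\<eta>. \<eta>(x := enat n)) R)"
      by (simp add: pair_pmf_def map_pmf_def bind_assoc_pmf bind_return_pmf)
    finally show ?thesis .
  qed
  define H where "H n = measure_pmf.expectation R (\<lambda>\<eta>. F (\<eta>(x := enat n)))" for n
  have H: "\<bar>H n\<bar> \<le> B" for n unfolding H_def by (rule expectation_pmf_bounds) (rule F)
  have rF: "\<bar>rate_ext g (\<eta> x) * F \<eta>\<bar> \<le> B" for \<eta>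
    using mult_mono[OF rate_ext_bounds(2)[OF g, of "\<eta> x"] F[of \<eta>]] rate_ext_bounds(1)[OF g, of "\<eta> x"]
    by (simp add: abs_mult)
  have "measure_pmf.expectation \<mu> (\<lambda>\<eta>. rate_ext g (\<eta> x) * F \<eta>)
      = measure_pmf.expectation \<theta> (\<lambda>n. g n * H n)"
    unfolding \<mu>_eq by (subst expectation_bind_pmf[OF rF]) (simp add: H_def)
  also have "\<dots> = \<phi> x / \<alpha> x * measure_pmf.expectation \<theta> (\<lambda>n. H (Suc n))"
    unfolding \<theta>_def using g fugacity[OF x] H by (rule theta_balance)
  also have "measure_pmf.expectation \<theta> (\<lambda>n. H (Suc n))
      = measure_pmf.expectation \<mu> (\<lambda>\<eta>. F (\<eta>(x := \<eta> x + 1)))"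
    unfolding \<mu>_eq by (subst expectation_bind_pmf[OF F]) (simp add: H_def one_enat_def)
  finally show ?thesis .
qed

text \<open>The identity of \<open>theta_balance\<close> at a single site. For a reservoir it is trivial, since
\<open>rate_ext g \<infinity> = 1\<close> and an additional particle does not change the state; so sites of both
kinds can be treated alike below.\<close>

lemma balance:
  fixes F :: "config \<Rightarrow> real"
  assumes F: "\<And>\<eta>. \<bar>F \<eta>\<bar> \<le> B"
  shows "measure_pmf.expectation \<mu> (\<lambda>\<eta>. \<alpha> x * rate_ext g (\<eta> x) * F \<eta>) =
         \<phi> x * measure_pmf.expectation \<mu> (\<lambda>\<eta>. F (\<eta>(x := \<eta> x + 1)))"
proof (cases "x \<in> \<Lambda>")
  case True
  have "measure_pmf.expectation \<mu> (\<lambda>\<eta>. \<alpha> x * rate_ext g (\<eta> x) * F \<eta>) =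
        \<alpha> x * measure_pmf.expectation \<mu> (\<lambda>\<eta>. rate_ext g (\<eta> x) * F \<eta>)"
    by (simp add: mult.assoc)
  with balance_inside[OF True F] \<alpha>(1)[of x] show ?thesis by simp
next
  case False
  have "measure_pmf.expectation \<mu> (\<lambda>\<eta>. \<alpha> x * rate_ext g (\<eta> x) * F \<eta>) =
        measure_pmf.expectation \<mu> (\<lambda>\<eta>. \<phi> x * F (\<eta>(x := \<eta> x + 1)))"
  proof (rule integral_cong_AE)
    show "AE \<eta> in \<mu>. \<alpha> x * rate_ext g (\<eta> x) * F \<eta> = \<phi> x * F (\<eta>(x := \<eta> x + 1))"
      unfolding AE_measure_pmf_iff
    proof
      fix \<eta> assume "\<eta> \<in> set_pmf \<mu>"
      then have "\<eta> x = \<infinity>" using False by (rule set_\<mu>_outside)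
      moreover from this have "\<eta>(x := \<eta> x + 1) = \<eta>" by (simp add: fun_eq_iff)
      ultimately show "\<alpha> x * rate_ext g (\<eta> x) * F \<eta> = \<phi> x * F (\<eta>(x := \<eta> x + 1))"
        using reservoir[OF False] by simp
    qed
  qed simp_all
  then show ?thesis by simp
qed

text \<open>Here \<open>d y\<close> will be the change of an expectation caused by an extra particle at \<open>y\<close>. Summation
by parts moves the differences onto \<open>\<phi>\<close>, where they vanish by harmonicity.\<close>

lemma generator_sum_zero:
  fixes d :: "int \<Rightarrow> real"
  assumes d: "\<And>y. y \<notin> \<Lambda> \<Longrightarrow> d y = 0"
  shows "(\<Sum>i\<in>{a..b}. \<phi> i * (p * d (i + 1) + (1 - p) * d (i - 1) - d i)) = 0"
proof -
  have restrict: "(\<Sum>i\<in>J. w i * d i) = (\<Sum>i\<in>\<Lambda>. w i * d i)" if "\<Lambda> \<subseteq> J" "finite J" for w J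
    using that d by (intro sum.mono_neutral_right) auto
  have "(\<Sum>i\<in>{a..b}. \<phi> i * d (i + 1)) = (\<Sum>i\<in>{a+1..b+1}. \<phi> (i - 1) * d i)"
    by (rule sum.reindex_bij_witness[of _ "\<lambda>i. i - 1" "\<lambda>i. i + 1"]) auto
  also have "\<dots> = (\<Sum>i\<in>\<Lambda>. \<phi> (i - 1) * d i)" using \<Lambda> by (intro restrict) auto
  finally have right: "(\<Sum>i\<in>{a..b}. \<phi> i * d (i + 1)) = (\<Sum>i\<in>\<Lambda>. \<phi> (i - 1) * d i)" .
  have "(\<Sum>i\<in>{a..b}. \<phi> i * d (i - 1)) = (\<Sum>i\<in>{a-1..b-1}. \<phi> (i + 1) * d i)"
    by (rule sum.reindex_bij_witness[of _ "\<lambda>i. i + 1" "\<lambda>i. i - 1"]) auto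
  also have "\<dots> = (\<Sum>i\<in>\<Lambda>. \<phi> (i + 1) * d i)" using \<Lambda> by (intro restrict) auto
  finally have left: "(\<Sum>i\<in>{a..b}. \<phi> i * d (i - 1)) = (\<Sum>i\<in>\<Lambda>. \<phi> (i + 1) * d i)" .
  have mid: "(\<Sum>i\<in>{a..b}. \<phi> i * d i) = (\<Sum>i\<in>\<Lambda>. \<phi> i * d i)" using \<Lambda> by (intro restrict) auto
  have "(\<Sum>i\<in>{a..b}. \<phi> i * (p * d (i + 1) + (1 - p) * d (i - 1) - d i)) =
     p * (\<Sum>i\<in>{a..b}. \<phi> i * d (i + 1)) + (1 - p) * (\<Sum>i\<in>{a..b}. \<phi> i * d (i - 1)) - (\<Sum>i\<in>{a..b}. \<phi> i * d i)"
    by (simp add: sum_distrib_left sum.distrib sum_subtractf algebra_simps)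
  also have "\<dots> = (\<Sum>i\<in>\<Lambda>. (p * \<phi> (i - 1) + (1 - p) * \<phi> (i + 1) - \<phi> i) * d i)"
    unfolding right left mid by (simp add: sum_distrib_left sum.distrib sum_subtractf algebra_simps)
  also have "\<dots> = 0" using harmonic by (intro sum.neutral) auto
  finally show ?thesis .
qed

text \<open>By \<open>balance\<close>, a jump from \<open>i\<close> to \<open>y\<close> contributes \<open>\<phi> i\<close> times the expectation with an extra
particle at \<open>y\<close>, and the loss term contributes \<open>\<phi> i\<close> times the expectation with an extra
particle at \<open>i\<close>. Subtracting \<open>E0\<close> from all of them leaves the sum of \<open>generator_sum_zero\<close>.\<close>

lemma equilibrium_invariant:
  fixes f :: "config \<Rightarrow> real"
  assumes f: "\<And>\<eta>. \<bar>f \<eta>\<bar> \<le> B"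
  shows "measure_pmf.expectation \<mu> (kernel_op \<kappa> f) = measure_pmf.expectation \<mu> f"
proof -
  define E where "E y = measure_pmf.expectation \<mu> (\<lambda>\<eta>. f (\<eta>(y := \<eta> y + 1)))" for y
  define E0 where "E0 = measure_pmf.expectation \<mu> f"
  have E_outside: "E y = E0" if "y \<notin> \<Lambda>" for y
    unfolding E_def E0_def
  proof (rule integral_cong_AE)
    show "AE \<eta> in \<mu>. f (\<eta>(y := \<eta> y + 1)) = f \<eta>"
      unfolding AE_measure_pmf_iff
    proof
      fix \<eta> assume "\<eta> \<in> set_pmf \<mu>"
      then have "\<eta>(y := \<eta> y + 1) = \<eta>" using set_\<mu>_outside[OF _ that] by (auto simp: fun_eq_iff)
      then show "f (\<eta>(y := \<eta> y + 1)) = f \<eta>" by simp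
    qed
  qed simp_all
  define r where "r i \<eta> = \<alpha> i * rate_ext g (\<eta> i)" for i \<eta>
  have r: "0 \<le> r i \<eta>" "r i \<eta> \<le> 1" for i \<eta> unfolding r_def by (rule rate_bounds)+
  have r_mult: "\<bar>r i \<eta> * t\<bar> \<le> B" if "\<bar>t\<bar> \<le> B" for i \<eta> t
    using mult_mono[OF r(2)[of i \<eta>] that] r(1)[of i \<eta>] by (simp add: abs_mult)
  have int_r: "integrable (measure_pmf \<mu>) (\<lambda>\<eta>. r i \<eta> * F \<eta>)" if "\<And>\<eta>. \<bar>F \<eta>\<bar> \<le> B" for i F
    by (rule integrable_pmf_bounded[where B = B]) (rule r_mult, rule that)
  have jump: "measure_pmf.expectation \<mu> (\<lambda>\<eta>. r i \<eta> * f (move i y \<eta>)) = \<phi> i * E y" if "y \<noteq> i" for i y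
    unfolding r_def E_def using balance[of "\<lambda>\<eta>. f (move i y \<eta>)" B i] f that by (simp add: move_add)
  have stay: "measure_pmf.expectation \<mu> (\<lambda>\<eta>. r i \<eta> * f \<eta>) = \<phi> i * E i" for i
    unfolding r_def E_def using f by (rule balance)
  let ?T = "\<lambda>i \<eta>. p * (r i \<eta> * f (move i (i + 1) \<eta>)) + (1 - p) * (r i \<eta> * f (move i (i - 1) \<eta>))
      - r i \<eta> * f \<eta>"
  let ?S = "\<lambda>\<eta>. (\<Sum>i\<in>{a..b}. r i \<eta> * (p * f (move i (i + 1) \<eta>) + (1 - p) * f (move i (i - 1) \<eta>))
      + (1 - r i \<eta>) * f \<eta>)"
  have op: "kernel_op \<kappa> f \<eta> =
    f \<eta> + (\<Sum>i\<in>{a..b}. ?T i \<eta>)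
      / real (card {a..b})" for \<eta>
  proof -
    have "?S \<eta>
      = (\<Sum>i\<in>{a..b}. f \<eta> + (?T i \<eta>))"
      by (intro sum.cong) (simp_all add: algebra_simps)
    also have "\<dots> = real (card {a..b}) * f \<eta> + (\<Sum>i\<in>{a..b}. ?T i \<eta>)"
      by (simp add: sum.distrib)
    finally have sum_eq: "?S \<eta> = \<dots>" .
    have "kernel_op \<kappa> f \<eta> = ?S \<eta> / real (card {a..b})"
      unfolding r_def
      by (subst kernel_op_ring_kernel[where B = B])
          (use ab f rate_bounds in \<open>simp_all add: expectation_K\<close>)
    then show ?thesis
      unfolding sum_eq using ab by (simp add: add_divide_distrib)
  qed
  have int_f: "integrable (measure_pmf \<mu>) f" by (rule integrable_pmf_bounded) (rule f)
  have int_terms: "integrable (measure_pmf \<mu>) (?T i)" for i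
    by (intro Bochner_Integration.integrable_diff Bochner_Integration.integrable_add
        integrable_mult_right int_r f)
  have "measure_pmf.expectation \<mu> (kernel_op \<kappa> f) = E0 + (\<Sum>i\<in>{a..b}.
     measure_pmf.expectation \<mu> (?T i)) / real (card {a..b})"
    unfolding op E0_def using int_f int_terms
    by (subst Bochner_Integration.integral_add) (auto simp: Bochner_Integration.integral_sum
        simp del: card_atLeastAtMost_int)
  also have "(\<Sum>i\<in>{a..b}. measure_pmf.expectation \<mu> (?T i))
     = (\<Sum>i\<in>{a..b}. \<phi> i * (p * (E (i + 1) - E0) + (1 - p) * (E (i - 1) - E0) - (E i - E0)))"
  proof (rule sum.cong[OF refl])
    fix i
    have "measure_pmf.expectation \<mu> (?T i)
      = p * (\<phi> i * E (i + 1)) + (1 - p) * (\<phi> i * E (i - 1)) - \<phi> i * E i"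
      by (subst Bochner_Integration.integral_diff,
          (intro Bochner_Integration.integrable_add integrable_mult_right int_r f)+,
          subst Bochner_Integration.integral_add, (intro integrable_mult_right int_r f)+)
              (simp add: jump stay)
    then show "measure_pmf.expectation \<mu> (?T i)
      = \<phi> i * (p * (E (i + 1) - E0) + (1 - p) * (E (i - 1) - E0) - (E i - E0))"
      by (simp add: algebra_simps)
  qed
  also have "\<dots> = 0"
    by (rule generator_sum_zero) (simp add: E_outside)
  finally show ?thesis by (simp add: E0_def)
qed

lemma equilibrium_stationary: "bind_pmf \<mu> \<kappa> = \<mu>"
proof (rule pmf_eqI)
  fix s
  have ind: "\<bar>indicator {s} \<eta> :: real\<bar> \<le> 1" for \<eta> :: config by (simp add: indicator_def)
  have "pmf (bind_pmf \<mu> \<kappa>) s = measure_pmf.expectation (bind_pmf \<mu> \<kappa>) (indicator {s})"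
    by (simp add: measure_pmf_single)
  also have "\<dots> = measure_pmf.expectation \<mu> (kernel_op \<kappa> (indicator {s}))"
    by (subst expectation_bind_pmf[OF ind]) (simp add: kernel_op_def[abs_def])
  also have "\<dots> = measure_pmf.expectation \<mu> (indicator {s})"
    by (rule equilibrium_invariant) (rule ind)
  finally show "pmf (bind_pmf \<mu> \<kappa>) s = pmf \<mu> s" by (simp add: measure_pmf_single)
qed

lemma right_jump_possible:
  assumes "i \<in> {a..b}" "0 < rate_ext g (\<zeta> i)"
  shows "move i (i + 1) \<zeta> \<in> set_pmf (\<kappa> \<zeta>)"
proof -
  let ?r = "\<alpha> i * rate_ext g (\<zeta> i)"
  have "pmf (bernoulli_pmf ?r) True = ?r" using rate_bounds by simp
  then have T: "True \<in> set_pmf (bernoulli_pmf ?r)"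
    using assms \<alpha>(1)[of i] by (simp add: set_pmf_iff)
  have "1 \<in> set_pmf K" using K p by (simp add: set_pmf_iff)
  then have "move i (i + 1) \<zeta> \<in> set_pmf (if True then map_pmf (\<lambda>z. move i (i + z) \<zeta>) K
      else return_pmf \<zeta>)"
    by auto
  with T have "move i (i + 1) \<zeta> \<in> set_pmf (bind_pmf (bernoulli_pmf ?r)
       (\<lambda>m. if m then map_pmf (\<lambda>z. move i (i + z) \<zeta>) K else return_pmf \<zeta>))"
    unfolding set_bind_pmf by (rule UN_I)
  moreover have "i \<in> set_pmf (pmf_of_set {a..b})"
    using assms(1) ab by (subst set_pmf_of_set) auto
  ultimately show ?thesis
    unfolding ring_kernel_def set_bind_pmf[of "pmf_of_set {a..b}"] by blast
qed

lemma move_infinite: "\<zeta> x = \<infinity> \<Longrightarrow> \<zeta> y = \<infinity> \<Longrightarrow> move x y \<zeta> = \<zeta>"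
  by (auto simp: move_def Let_def fun_eq_iff)

text \<open>A jump from the reservoir \<open>b\<close> to the reservoir \<open>b + 1\<close> changes nothing and has positive
probability.\<close>

lemma kernel_lazy:
  assumes "\<zeta> \<in> set_pmf \<mu>"
  shows "\<zeta> \<in> set_pmf (\<kappa> \<zeta>)"
proof -
  have "b \<notin> \<Lambda>" "b + 1 \<notin> \<Lambda>" using \<Lambda> by auto
  then have inf: "\<zeta> b = \<infinity>" "\<zeta> (b + 1) = \<infinity>" using set_\<mu>_outside[OF assms] by auto
  then have "move b (b + 1) \<zeta> \<in> set_pmf (\<kappa> \<zeta>)" using ab by (intro right_jump_possible) auto
  then show ?thesis using move_infinite[OF inf] by simp
qed

definition empty_window :: config where
  "empty_window x = (if x \<in> \<Lambda> then 0 else \<infinity>)"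

text \<open>Jumps to the right have positive probability wherever there is a particle. Weighting each
particle by its distance to \<open>b\<close>, such a jump decreases the total weight, also when it ends in
a reservoir.\<close>

lemma reach_empty_window:
  assumes "\<And>x. x \<notin> \<Lambda> \<Longrightarrow> \<zeta> x = \<infinity>" "\<And>x. x \<in> \<Lambda> \<Longrightarrow> \<zeta> x \<noteq> \<infinity>"
  shows "(\<zeta>, empty_window) \<in> {(s, s'). s' \<in> set_pmf (\<kappa> s)}\<^sup>*"
  using assms
proof (induction "\<Sum>x\<in>\<Lambda>. the_enat (\<zeta> x) * nat (b - x)" arbitrary: \<zeta> rule: less_induct)
  case less
  show ?case
  proof (cases "\<exists>x\<in>\<Lambda>. \<zeta> x \<noteq> 0")
    case False
    then have "\<zeta> = empty_window" using less.prems by (auto simp: empty_window_def fun_eq_iff)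
    then show ?thesis by simp
  next
    case True
    then obtain x where x: "x \<in> \<Lambda>" "\<zeta> x \<noteq> 0" by auto
    then obtain n where n: "\<zeta> x = enat (Suc n)"
      using less.prems(2)[of x] by (metis enat_0_iff(1) not0_implies_Suc not_infinity_eq)
    have xb: "a < x" "x < b" using x \<Lambda> by auto
    define \<zeta>' where "\<zeta>' = move x (x + 1) \<zeta>"
    have \<zeta>': "\<zeta>' y = (if y = x then enat n else if y = x + 1 then \<zeta> y + 1 else \<zeta> y)" for y
      by (simp add: \<zeta>'_def move_def Let_def n one_enat_def)
    have step: "(\<zeta>, \<zeta>') \<in> {(s, s'). s' \<in> set_pmf (\<kappa> s)}"
      unfolding \<zeta>'_def using right_jump_possible[of x \<zeta>] xb n rate_functionD(4)[OF g, of "Suc n"] by simp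
    let ?w = "\<lambda>y. nat (b - y)"
    have pointwise: "the_enat (\<zeta>' y) * ?w y + (if y = x then ?w x else 0) =
        the_enat (\<zeta> y) * ?w y + (if y = x + 1 then ?w (x + 1) else 0)" if "y \<in> \<Lambda>" for y
    proof -
      have "\<zeta> y \<noteq> \<infinity>" using less.prems(2) that by blast
      then obtain k where "\<zeta> y = enat k" by blast
      then show ?thesis by (auto simp: \<zeta>' n one_enat_def)
    qed
    have "(\<Sum>y\<in>\<Lambda>. the_enat (\<zeta>' y) * ?w y) + ?w x =
        (\<Sum>y\<in>\<Lambda>. the_enat (\<zeta>' y) * ?w y + (if y = x then ?w x else 0))"
      using x finite_\<Lambda> by (simp add: sum.distrib)
    also have "\<dots> = (\<Sum>y\<in>\<Lambda>. the_enat (\<zeta> y) * ?w y + (if y = x + 1 then ?w (x + 1) else 0))"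
      by (rule sum.cong[OF refl pointwise])
    also have "\<dots> \<le> (\<Sum>y\<in>\<Lambda>. the_enat (\<zeta> y) * ?w y) + ?w (x + 1)"
      using finite_\<Lambda> by (simp add: sum.distrib)
    finally have "(\<Sum>y\<in>\<Lambda>. the_enat (\<zeta>' y) * ?w y) < (\<Sum>y\<in>\<Lambda>. the_enat (\<zeta> y) * ?w y)"
      using xb by simp
    moreover have "\<zeta>' y = \<infinity>" if "y \<notin> \<Lambda>" for y using less.prems(1)[OF that] that x by (auto simp: \<zeta>')
    moreover have "\<zeta>' y \<noteq> \<infinity>" if "y \<in> \<Lambda>" for y
      using less.prems(2)[OF that] by (auto simp: \<zeta>' one_enat_def plus_eq_infty_iff_enat)
    ultimately have "(\<zeta>', empty_window) \<in> {(s, s'). s' \<in> set_pmf (\<kappa> s)}\<^sup>*"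
      by (rule less.hyps)
    with step show ?thesis by (rule converse_rtrancl_into_rtrancl)
  qed
qed

text \<open>Every finite state is charged, so the chain may be started above any given finite
configuration.\<close>

lemma finite_state_in_set_\<mu>:
  assumes "\<And>x. x \<in> \<Lambda> \<Longrightarrow> \<zeta> x \<noteq> \<infinity>" "\<And>x. x \<notin> \<Lambda> \<Longrightarrow> \<zeta> x = \<infinity>" "\<And>x. x \<in> \<Lambda> \<Longrightarrow> 0 < \<phi> x"
  shows "\<zeta> \<in> set_pmf \<mu>"
  unfolding set_\<mu>_iff
proof (intro conjI ballI allI impI)
  fix x assume x: "x \<in> \<Lambda>"
  then obtain n where n: "\<zeta> x = enat n" using assms(1) by blast
  have "0 < pmf (theta_pmf g (\<phi> x / \<alpha> x)) n"
    using g_fact_pos[OF g, of n] partition_fun_ge_1[OF g fugacity[OF x]] assms(3)[OF x] \<alpha>(1)[of x]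
    by (simp add: pmf_theta_pmf[OF g fugacity[OF x]])
  then show "\<zeta> x \<in> enat ` set_pmf (theta_pmf g (\<phi> x / \<alpha> x))"
    using n by (auto simp: set_pmf_iff)
qed (use assms in auto)

theorem window_chain_converges:
  fixes f :: "config \<Rightarrow> real"
  assumes f: "\<And>\<eta>. \<bar>f \<eta>\<bar> \<le> B" and \<zeta>: "\<zeta> \<in> set_pmf \<mu>"
  shows "(\<lambda>n. (kernel_op \<kappa> ^^ n) f \<zeta>) \<longlonglongrightarrow> measure_pmf.expectation \<mu> f"
proof (rule kernel_powers_converge[OF equilibrium_stationary kernel_lazy _ f \<zeta>])
  fix s assume "s \<in> set_pmf \<mu>"
  then show "(s, empty_window) \<in> {(s, s'). s' \<in> set_pmf (\<kappa> s)}\<^sup>*"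
    by (intro reach_empty_window) (auto simp: set_\<mu>_iff)
qed

end

section \<open>Exponential clocks and memorylessness\<close>

type_synonym mark = "real \<times> int"
text \<open>A realisation of all clocks is a function on \<open>int \<times> nat\<close> whose value at \<open>(x, n)\<close> consists of
the waiting time before the \<open>n\<close>-th ring at \<open>x\<close> and its marks. Under \<open>data_law\<close> these values
are independent.\<close>

type_synonym clock_data = "int \<times> nat \<Rightarrow> real \<times> mark"

definition mark_law :: "int pmf \<Rightarrow> mark measure" where
  "mark_law K = uniform_measure lborel {0<..<1} \<Otimes>\<^sub>M measure_pmf K"

definition wait_law :: "real measure" where
  "wait_law = density lborel (\<lambda>w. ennreal (exponential_density 1 w))"

definition data_law :: "int pmf \<Rightarrow> clock_data measure" where
  "data_law K = PiM UNIV (\<lambda>_. ring_law K)"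

lemma ring_law_eq: "ring_law K = wait_law \<Otimes>\<^sub>M mark_law K"
  by (simp add: ring_law_def wait_law_def mark_law_def)

lemma prob_space_wait_law: "prob_space wait_law"
  unfolding wait_law_def by (rule prob_space_exponential_density) simp

lemma prob_space_unit_interval: "prob_space (uniform_measure lborel {0<..<1::real})"
  by (rule prob_space_uniform_measure) auto

lemma prob_space_mark_law: "prob_space (mark_law K)"
  unfolding mark_law_def
  by (intro prob_space_pair prob_space_unit_interval prob_space_measure_pmf)

lemma prob_space_ring_law: "prob_space (ring_law K)"
  unfolding ring_law_eq by (intro prob_space_pair prob_space_wait_law prob_space_mark_law)

lemma prob_space_data_law: "prob_space (data_law K)"
  unfolding data_law_def by (intro prob_space_PiM prob_space_ring_law)

lemma sets_wait_law [simp, measurable_cong]: "sets wait_law = sets borel"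
  by (simp add: wait_law_def)

lemma sets_mark_law [simp, measurable_cong]: "sets (mark_law K) = sets (borel \<Otimes>\<^sub>M count_space UNIV)"
  unfolding mark_law_def by (intro sets_pair_measure_cong) simp_all

lemma sets_ring_law [simp, measurable_cong]:
  "sets (ring_law K) = sets (borel \<Otimes>\<^sub>M (borel \<Otimes>\<^sub>M count_space UNIV))"
  unfolding ring_law_eq by (intro sets_pair_measure_cong) simp_all

lemma sets_data_law [simp, measurable_cong]:
  "sets (data_law K) = sets (PiM UNIV (\<lambda>_. borel \<Otimes>\<^sub>M (borel \<Otimes>\<^sub>M count_space UNIV)))"
  unfolding data_law_def by (intro sets_PiM_cong) simp_all

lemma space_wait_law [simp]: "space wait_law = UNIV"
  by (simp add: wait_law_def)

lemma space_mark_law [simp]: "space (mark_law K) = UNIV"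
  by (simp add: mark_law_def space_pair_measure)

lemma space_ring_law [simp]: "space (ring_law K) = UNIV"
  by (simp add: ring_law_eq space_pair_measure)

lemma space_data_law [simp]: "space (data_law K) = UNIV"
  by (simp add: data_law_def space_PiM PiE_UNIV_domain)

lemma AE_wait_law_pos: "AE w in wait_law. 0 < w"
proof -
  have "AE w in lborel. w \<noteq> (0::real)" by (rule AE_lborel_singleton)
  then show ?thesis
    unfolding wait_law_def
    by (subst AE_density) (auto simp: exponential_density_def elim!: eventually_mono)
qed

lemma AE_wait_law_neq: "AE w in wait_law. w \<noteq> c"
  unfolding wait_law_def
  using AE_lborel_singleton[of c] by (subst AE_density) (auto elim!: eventually_mono)

lemma AE_ring_law_fst: "AE w in wait_law. P w \<Longrightarrow> AE v in ring_law K. P (fst v)"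
  unfolding ring_law_eq
proof (rule AE_distrD[where M' = wait_law])
  assume "AE w in wait_law. P w"
  then show "AE w in distr (wait_law \<Otimes>\<^sub>M mark_law K) wait_law fst. P w"
    by (simp only: prob_space.distr_pair_fst[OF prob_space_mark_law])
qed (rule measurable_fst)

lemma AE_ring_law_snd: "AE m in mark_law K. P m \<Longrightarrow> AE v in ring_law K. P (snd v)"
proof -
  assume "AE m in mark_law K. P m"
  then obtain N where N: "{m. \<not> P m} \<subseteq> N" "N \<in> null_sets (mark_law K)"
    by (auto simp: eventually_ae_filter)
  interpret sigma_finite_measure "mark_law K"
    by (intro prob_space_imp_sigma_finite prob_space_mark_law)
  have "UNIV \<times> N \<in> null_sets (ring_law K)"
    unfolding ring_law_eq using N sets.top[of wait_law] by (intro times_in_null_sets2) auto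
  then show "AE v in ring_law K. P (snd v)"
    by (rule AE_I') (use N in auto)
qed

lemma AE_data_law_all:
  assumes "AE v in ring_law K. P v"
  shows "AE d in data_law K. \<forall>y. P (d y)"
proof -
  interpret product_prob_space "\<lambda>_::int \<times> nat. ring_law K" UNIV
    by (simp add: product_prob_space_def product_sigma_finite_def prob_space_ring_law
        prob_space_imp_sigma_finite product_prob_space_axioms_def)
  have "AE d in data_law K. P (d y)" for y
    unfolding data_law_def by (rule AE_component[OF _ assms]) simp
  then show ?thesis by (subst AE_all_countable) blast
qed

text \<open>Inserting a ring at the front of the clock at \<open>i\<close>. Its use is to single out the value at
\<open>(i, 0)\<close> as a variable that is independent of everything else.\<close>

definition prepend_ring :: "int \<Rightarrow> real \<times> mark \<Rightarrow> clock_data \<Rightarrow> clock_data" where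
  "prepend_ring i v d = (\<lambda>(j, n). if j = i then (case n of 0 \<Rightarrow> v | Suc m \<Rightarrow> d (i, m)) else d (j, n))"

lemma measurable_prepend_ring [measurable]:
  "(\<lambda>(v, d). prepend_ring i v d) \<in> ring_law K \<Otimes>\<^sub>M data_law K \<rightarrow>\<^sub>M data_law K"
proof -
  have "(\<lambda>x. prepend_ring i (fst x) (snd x) y) \<in> ring_law K \<Otimes>\<^sub>M data_law K \<rightarrow>\<^sub>M ring_law K" for y
    by (cases y) (auto simp: prepend_ring_def data_law_def split: nat.splits intro!:
        measurable_compose[OF measurable_snd measurable_component_singleton])
  then show ?thesis
    unfolding data_law_def[of K] split_beta'
    by (intro measurable_PiM_single') (auto simp: PiE_UNIV_domain data_law_def)
qed

lemma distr_prepend_ring: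
  "distr (ring_law K \<Otimes>\<^sub>M data_law K) (data_law K) (\<lambda>(v, d). prepend_ring i v d) = data_law K"
proof -
  let ?I = "UNIV - {(i, 0::nat)}" and ?R = "ring_law K"
  define \<sigma> where "\<sigma> = (\<lambda>(j, n). if j = i then (j, n - 1) else (j, n :: nat))"
  have "inj_on \<sigma> ?I"
    by (auto simp: inj_on_def \<sigma>_def split: if_splits)
  then have tail: "distr (data_law K) (PiM ?I (\<lambda>_. ?R)) (\<lambda>d. \<lambda>y\<in>?I. d (\<sigma> y)) = PiM ?I (\<lambda>_. ?R)"
    unfolding data_law_def by (intro distr_PiM_reindex prob_space_ring_law) auto
  have meas_tail: "(\<lambda>d. \<lambda>y\<in>?I. d (\<sigma> y)) \<in> data_law K \<rightarrow>\<^sub>M PiM ?I (\<lambda>_. ?R)"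
    unfolding data_law_def by (intro measurable_restrict measurable_component_singleton) auto
  have meas_ins: "(\<lambda>(v, d). d((i, 0) := v)) \<in> ?R \<Otimes>\<^sub>M PiM ?I (\<lambda>_. ?R) \<rightarrow>\<^sub>M data_law K"
  proof -
    have "(\<lambda>(v, d). d((i, 0) := v)) \<in> ?R \<Otimes>\<^sub>M PiM ?I (\<lambda>_. ?R) \<rightarrow>\<^sub>M PiM (insert (i, 0) ?I) (\<lambda>_. ?R)"
      by measurable
    then show ?thesis by (simp add: data_law_def insert_UNIV)
  qed
  have ins: "distr (?R \<Otimes>\<^sub>M PiM ?I (\<lambda>_. ?R)) (data_law K) (\<lambda>(v, d). d((i, 0) := v)) = data_law K"
    using distr_pair_PiM_eq_PiM[of ?I "\<lambda>_. ?R" "(i, 0)"] prob_space_ring_law[of K]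
    by (simp add: data_law_def insert_UNIV)
  have pair: "?R \<Otimes>\<^sub>M PiM ?I (\<lambda>_. ?R) =
      distr (?R \<Otimes>\<^sub>M data_law K) (?R \<Otimes>\<^sub>M PiM ?I (\<lambda>_. ?R)) (\<lambda>(v, d). (v, \<lambda>y\<in>?I. d (\<sigma> y)))"
  proof -
    have "?R \<Otimes>\<^sub>M PiM ?I (\<lambda>_. ?R) =
        distr ?R ?R (\<lambda>v. v) \<Otimes>\<^sub>M distr (data_law K) (PiM ?I (\<lambda>_. ?R)) (\<lambda>d. \<lambda>y\<in>?I. d (\<sigma> y))"
      by (simp add: tail distr_id2)
    also have "\<dots> = distr (?R \<Otimes>\<^sub>M data_law K) (?R \<Otimes>\<^sub>M PiM ?I (\<lambda>_. ?R)) (\<lambda>(v, d). (v, \<lambda>y\<in>?I. d (\<sigma> y)))"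
      by (rule pair_measure_distr[OF _ meas_tail])
        (auto simp: tail intro!: prob_space_imp_sigma_finite prob_space_PiM prob_space_ring_law)
    finally show ?thesis .
  qed
  have comp: "(\<lambda>(v, d). d((i, 0) := v)) \<circ> (\<lambda>(v, d). (v, \<lambda>y\<in>?I. d (\<sigma> y))) = (\<lambda>(v, d). prepend_ring i v d)"
    by (auto simp: fun_eq_iff prepend_ring_def \<sigma>_def split: nat.splits)
  have "data_law K = distr (distr (?R \<Otimes>\<^sub>M data_law K) (?R \<Otimes>\<^sub>M PiM ?I (\<lambda>_. ?R))
      (\<lambda>(v, d). (v, \<lambda>y\<in>?I. d (\<sigma> y)))) (data_law K) (\<lambda>(v, d). d((i, 0) := v))"
    unfolding pair[symmetric] by (rule ins[symmetric])
  also have "\<dots> = distr (?R \<Otimes>\<^sub>M data_law K) (data_law K) (\<lambda>(v, d). prepend_ring i v d)"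
    using meas_tail by (subst distr_distr[OF meas_ins]) (measurable, simp add: comp)
  finally show ?thesis by simp
qed

text \<open>Memorylessness of the exponential law, jointly with the marks: the density at \<open>w + x\<close> is
\<open>exp (- w)\<close> times the density at \<open>x\<close>. The inequality \<open>w \<le> fst v\<close> is not strict because the
density is positive at \<open>0\<close>, which makes the two sides agree without an exceptional null set.\<close>

lemma emeasure_ring_law_memoryless:
  assumes w: "0 \<le> w" and A: "A \<in> sets (ring_law K)"
  shows "emeasure (ring_law K) {v. w \<le> fst v \<and> (fst v - w, snd v) \<in> A} =
         ennreal (exp (- w)) * emeasure (ring_law K) A"
proof -
  interpret Q: sigma_finite_measure "mark_law K"
    by (intro prob_space_imp_sigma_finite prob_space_mark_law)
  have A': "A \<in> sets (wait_law \<Otimes>\<^sub>M mark_law K)" using A by (simp add: ring_law_eq[symmetric])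
  define q where "q x = emeasure (mark_law K) (Pair x -` A)" for x
  have q [measurable]: "q \<in> borel_measurable borel"
    unfolding q_def using Q.measurable_emeasure_Pair[OF A'] by simp
  let ?S = "{v. w \<le> fst v \<and> (fst v - w, snd v) \<in> A}"
  have S: "?S \<in> sets (wait_law \<Otimes>\<^sub>M mark_law K)"
  proof -
    have "(\<lambda>v. (fst v - w, snd v)) \<in> wait_law \<Otimes>\<^sub>M mark_law K \<rightarrow>\<^sub>M wait_law \<Otimes>\<^sub>M mark_law K" by measurable
    from measurable_sets[OF this A'] 
    have "(\<lambda>v. (fst v - w, snd v)) -` A \<in> sets (wait_law \<Otimes>\<^sub>M mark_law K)"
        by (simp add: space_pair_measure)
    moreover have "{v \<in> space (wait_law \<Otimes>\<^sub>M mark_law K). w \<le> fst v}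
        \<in> sets (wait_law \<Otimes>\<^sub>M mark_law K)" by measurable
    ultimately have "{v \<in> space (wait_law \<Otimes>\<^sub>M mark_law K). w
        \<le> fst v} \<inter> (\<lambda>v. (fst v - w, snd v)) -` A \<in> sets (wait_law \<Otimes>\<^sub>M mark_law K)"
      by (rule sets.Int[rotated])
    also have "{v \<in> space (wait_law \<Otimes>\<^sub>M mark_law K). w \<le> fst v} \<inter> (\<lambda>v. (fst v - w, snd v)) -` A = ?S"
      by (auto simp: space_pair_measure)
    finally show ?thesis .
  qed
  have "emeasure (ring_law K) ?S = (\<integral>\<^sup>+ x. emeasure (mark_law K) (Pair x -` ?S) \<partial>wait_law)"
    unfolding ring_law_eq by (rule Q.emeasure_pair_measure_alt[OF S])
  also have "\<dots> = (\<integral>\<^sup>+ x. q (x - w) * indicator {w..} x \<partial>wait_law)"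
    by (intro nn_integral_cong) (auto simp: q_def indicator_def vimage_def)
  also have "\<dots> = (\<integral>\<^sup>+ x. ennreal (exponential_density 1 x) * (q (x - w) * indicator {w..} x) \<partial>lborel)"
    unfolding wait_law_def by (subst nn_integral_density) auto
  also have "\<dots> = (\<integral>\<^sup>+ x. ennreal (exponential_density 1 (w + x))
      * (q ((w + x) - w) * indicator {w..} (w + x)) \<partial>lborel)"
    by (subst nn_integral_real_affine[where c = 1 and t = w]) auto
  also have "\<dots> = (\<integral>\<^sup>+ x. ennreal (exp (- w)) * (ennreal (exponential_density 1 x) * q x) \<partial>lborel)"
  proof (intro nn_integral_cong)
    fix x
    have "exponential_density 1 (w + x) = exp (- w) * exponential_density 1 x" if "0 \<le> x"
      using that w by (simp add: exponential_density_def exp_add[symmetric])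
    then show "ennreal (exponential_density 1 (w + x)) * (q ((w + x) - w) * indicator {w..} (w + x)) =
       ennreal (exp (- w)) * (ennreal (exponential_density 1 x) * q x)"
      by (cases "0 \<le> x") (auto simp: ennreal_mult' exponential_density_def mult.assoc)
  qed
  also have "\<dots> = ennreal (exp (- w)) * (\<integral>\<^sup>+ x. q x \<partial>wait_law)"
    unfolding wait_law_def by (simp add: nn_integral_cmult nn_integral_density)
  also have "(\<integral>\<^sup>+ x. q x \<partial>wait_law) = emeasure (ring_law K) A"
    unfolding ring_law_eq q_def by (rule Q.emeasure_pair_measure_alt[OF A', symmetric])
  finally show ?thesis .
qed

text \<open>Letting time \<open>w\<close> pass for the clocks in \<open>J\<close>: only their first waiting times are shortened. On
the event \<open>silent J w\<close> none of these clocks has rung before.\<close>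

definition age :: "int set \<Rightarrow> real \<Rightarrow> clock_data \<Rightarrow> clock_data" where
  "age J w d = (\<lambda>y. if y \<in> J \<times> {0} then (fst (d y) - w, snd (d y)) else d y)"

definition silent :: "int set \<Rightarrow> real \<Rightarrow> clock_data set" where
  "silent J w = {d. \<forall>j\<in>J. w \<le> fst (d (j, 0))}"

lemma measurable_data_component: "(\<lambda>d. d y) \<in> data_law K \<rightarrow>\<^sub>M ring_law K"
  unfolding data_law_def by (rule measurable_component_singleton) simp

lemma measurable_wait_component: "(\<lambda>d. fst (d y)) \<in> borel_measurable (data_law K)"
proof -
  have "fst \<in> ring_law K \<rightarrow>\<^sub>M borel" by measurable
  from measurable_compose[OF measurable_data_component this] show ?thesis .
qed

lemma measurable_data_lawI:
  assumes "\<And>y. (\<lambda>x. f x y) \<in> M \<rightarrow>\<^sub>M ring_law K"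
  shows "f \<in> M \<rightarrow>\<^sub>M data_law K"
  unfolding data_law_def
  by (rule measurable_PiM_single') (use assms in \<open>auto simp: PiE_UNIV_domain\<close>)

lemma measurable_age:
  "(\<lambda>(w, d). age J w d) \<in> borel \<Otimes>\<^sub>M data_law K \<rightarrow>\<^sub>M data_law K"
  unfolding split_beta'
proof (rule measurable_data_lawI)
  show "(\<lambda>x. age J (fst x) (snd x) y) \<in> borel \<Otimes>\<^sub>M data_law K \<rightarrow>\<^sub>M ring_law K" for y
  proof (cases "y \<in> J \<times> {0}")
    case True
    have [measurable]: "(\<lambda>x. snd x y) \<in> borel \<Otimes>\<^sub>M data_law K \<rightarrow>\<^sub>M ring_law K"
      by (rule measurable_compose[OF measurable_snd measurable_data_component])
    have "(\<lambda>x. (fst (snd x y) - fst x, snd (snd x y))) \<in> borel \<Otimes>\<^sub>M data_law K \<rightarrow>\<^sub>M ring_law K"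
      by measurable
    with True show ?thesis by (simp add: age_def)
  next
    case False
    then show ?thesis by (simp add: age_def)
  qed
qed

lemma silent_sets [measurable]: "finite J \<Longrightarrow> silent J w \<in> sets (data_law K)"
proof -
  assume "finite J"
  note measurable_wait_component[measurable]
  from \<open>finite J\<close> have "{d \<in> space (data_law K). \<forall>j\<in>J. w \<le> fst (d (j, 0))} \<in> sets (data_law K)"
    by measurable
  then show ?thesis by (simp add: silent_def)
qed

text \<open>If the clocks in \<open>J\<close> have been silent up to time \<open>w\<close>, the remaining data are distributed as at
the start; the factor is the probability of this silence. Both sides are compared on
rectangles, where \<open>emeasure_ring_law_memoryless\<close> applies to each coordinate separately.\<close>

lemma distr_age:
  fixes w :: real
  assumes J: "finite J" and w: "0 \<le> w"
  shows "distr (density (data_law K) (indicator (silent J w))) (data_law K) (age J w) =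
         density (data_law K) (\<lambda>_. ennreal (exp (- (real (card J) * w))))"
proof (rule measure_eqI_PiM_infinite)
  let ?R = "ring_law K"
  let ?L = "distr (density (data_law K) (indicator (silent J w))) (data_law K) (age J w)"
  let ?Rt = "density (data_law K) (\<lambda>_. ennreal (exp (- (real (card J) * w))))"
  show sets: "sets ?L = sets (PiM UNIV (\<lambda>_. ?R))" "sets ?Rt = sets (PiM UNIV (\<lambda>_. ?R))"
    by (simp_all add: data_law_def)
  have age_meas: "age J w \<in> data_law K \<rightarrow>\<^sub>M data_law K"
    using measurable_compose[OF measurable_Pair1'[of w borel] measurable_age[of J K]] by simp
  have sil: "silent J w \<in> sets (data_law K)" using J by (rule silent_sets)
  have emb: "emeasure (data_law K) (prod_emb UNIV (\<lambda>_. ?R) L (Pi\<^sub>E L A)) = (\<Prod>y\<in>L. emeasure ?R (A y))"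
    if "finite L" "\<And>y. y \<in> L \<Longrightarrow> A y \<in> sets ?R" for L A
    unfolding data_law_def by (rule emeasure_PiM_emb) (use that prob_space_ring_law in auto)
  have emb_eq: "prod_emb UNIV (\<lambda>_. ?R) L (Pi\<^sub>E L A) = {d. \<forall>y\<in>L. d y \<in> A y}" for L and A ::
      "_ \<Rightarrow> (real \<times> mark) set"
    by (auto simp: prod_emb_def PiE_UNIV_domain PiE_iff)
  show "finite_measure ?L"
  proof (rule finite_measure.finite_measure_distr)
    have top: "UNIV \<in> sets (data_law K)" using sets.top[of "data_law K"] by (simp only: space_data_law)
    have "emeasure (density (data_law K) (indicator (silent J w))) UNIV
        = emeasure (data_law K) (silent J w)"
      using sil top by (subst emeasure_density) (simp_all del: sets_data_law)
    also have "\<dots> < \<infinity>"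
      using prob_space.emeasure_le_1[OF prob_space_data_law, of K "silent J w"]
      by (auto intro: le_less_trans)
    finally show "finite_measure (density (data_law K) (indicator (silent J w)))"
      by (intro finite_measureI) simp
  qed (use age_meas in simp)
  fix A and L :: "(int \<times> nat) set"
  assume L: "finite L" and A: "\<And>y. y \<in> L \<Longrightarrow> A y \<in> sets ?R"
  let ?X = "{d. \<forall>y\<in>L. d y \<in> A y}"
  have X: "?X \<in> sets (data_law K)"
    unfolding emb_eq[symmetric] data_law_def by (rule sets_PiM_I) (use L A in auto)
  define A' where "A' y = {v. (y \<in> J \<times> {0} \<longrightarrow> w \<le> fst v) \<and>
     (y \<in> L \<longrightarrow> (if y \<in> J \<times> {0} then (fst v - w, snd v) else v) \<in> A y)}" for y
  define q where "q y = (if y \<in> L then emeasure ?R (A y) else 1)" for y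
  have UNIV1: "emeasure ?R UNIV = 1"
    using prob_space.emeasure_space_1[OF prob_space_ring_law[of K]] by simp
  have A'_eq: "emeasure ?R (A' y) = (if y \<in> J \<times> {0} then ennreal (exp (- w)) else 1) * q y" for y
  proof (cases "y \<in> J \<times> {0}")
    case True
    define A'' where "A'' = (if y \<in> L then A y else UNIV)"
    have "A'' \<in> sets ?R" using A sets.top[of ?R] by (auto simp: A''_def)
    moreover have "A' y = {v. w \<le> fst v \<and> (fst v - w, snd v) \<in> A''}" using True
        by (auto simp: A'_def A''_def)
    ultimately have "emeasure ?R (A' y) = ennreal (exp (- w)) * emeasure ?R A''"
      using emeasure_ring_law_memoryless[OF w] by simp
    with True UNIV1 show ?thesis by (simp add: q_def A''_def)
  next
    case False
    then have "A' y = (if y \<in> L then A y else UNIV)" by (auto simp: A'_def)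
    with False UNIV1 show ?thesis by (simp add: q_def)
  qed
  have A'_sets: "A' y \<in> sets ?R" for y
  proof -
    have "{v \<in> space ?R. w \<le> fst v} \<in> sets ?R" by measurable
    moreover have "(\<lambda>v. (fst v - w, snd v)) \<in> ?R \<rightarrow>\<^sub>M ?R" by measurable
    then have "y \<in> L \<Longrightarrow> (\<lambda>v. (fst v - w, snd v)) -` A y \<in> sets ?R" 
      using measurable_sets[OF _ A, of "(\<lambda>v. (fst v - w, snd v))" ?R y] by simp
    moreover have "A' y = (if y \<in> J \<times> {0} then {v. w \<le> fst v} else UNIV) \<inter>
       (if y \<in> L then if y \<in> J \<times> {0} then (\<lambda>v. (fst v - w, snd v)) -` A y else A y else UNIV)"
      by (auto simp: A'_def)
    ultimately show ?thesis using A sets.top[of ?R] by auto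
  qed
  have pre: "age J w -` ?X \<inter> silent J w = {d. \<forall>y\<in>L \<union> J \<times> {0}. d y \<in> A' y}"
    by (auto simp: age_def silent_def A'_def)
  have "emeasure ?L ?X = emeasure (density (data_law K) (indicator (silent J w))) (age J w -` ?X)"
    using X age_meas by (subst emeasure_distr) auto
  also have "\<dots> = emeasure (data_law K) (age J w -` ?X \<inter> silent J w)"
  proof -
    have "age J w -` ?X \<in> sets (data_law K)" using measurable_sets[OF age_meas X] by simp
    then show ?thesis using sil
      by (subst emeasure_density) (auto simp: indicator_inter_arith[symmetric] Int_commute)
  qed
  also have "\<dots> = (\<Prod>y\<in>L \<union> J \<times> {0}. emeasure ?R (A' y))"
    using emb[of "L \<union> J \<times> {0}" A'] L J A'_sets unfolding pre emb_eq by blast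
  also have "\<dots> = (\<Prod>y\<in>L \<union> J \<times> {0}. if y \<in> J \<times> {0} then ennreal (exp (- w)) else 1)
      * (\<Prod>y\<in>L \<union> J \<times> {0}. q y)"
    unfolding A'_eq by (rule prod.distrib)
  also have "(\<Prod>y\<in>L \<union> J \<times> {0}. if y \<in> J \<times> {0} then ennreal (exp (- w)) else 1)
      = (\<Prod>y\<in>J \<times> {0::nat}. ennreal (exp (- w)))"
    using L J by (intro prod.mono_neutral_cong_right) auto
  also have "\<dots> = ennreal (exp (- (real (card J) * w)))"
    by (simp add: card_cartesian_product ennreal_power exp_of_nat_mult[symmetric])
  also have "(\<Prod>y\<in>L \<union> J \<times> {0}. q y) = (\<Prod>y\<in>L. emeasure ?R (A y))"
    using L J by (intro prod.mono_neutral_cong_right) (auto simp: q_def)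
  also have "\<dots> = emeasure (data_law K) ?X"
    unfolding emb_eq[symmetric] by (rule emb[symmetric]) (use L A in auto)
  also have "ennreal (exp (- (real (card J) * w))) * emeasure (data_law K) ?X = emeasure ?Rt ?X"
    using X by (simp add: emeasure_density_const)
  finally show "emeasure ?L (prod_emb UNIV (\<lambda>_. ?R) L (Pi\<^sub>E L A))
      = emeasure ?Rt (prod_emb UNIV (\<lambda>_. ?R) L (Pi\<^sub>E L A))"
    unfolding emb_eq .
qed

section \<open>The first ring of the window\<close>

text \<open>The data seen from the time of the first ring, if that ring occurs at \<open>i\<close>: the clock at \<open>i\<close>
moves to its next waiting time, the other clocks of \<open>I\<close> lose the time that has passed, and the
clocks outside \<open>I\<close> are left alone, as the window does not look at them.\<close>

definition after_ring :: "int set \<Rightarrow> int \<Rightarrow> clock_data \<Rightarrow> clock_data" where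
  "after_ring I i d = (\<lambda>(j, n). if j = i then d (i, Suc n)
     else if j \<in> I \<and> n = 0 then (fst (d (j, 0)) - fst (d (i, 0)), snd (d (j, 0))) else d (j, n))"

definition fires_first :: "int set \<Rightarrow> int \<Rightarrow> clock_data set" where
  "fires_first I i = {d. \<forall>j\<in>I. fst (d (i, 0)) \<le> fst (d (j, 0))}"

lemma after_ring_prepend_ring: "after_ring I i (prepend_ring i v d) = age (I - {i}) (fst v) d"
  by (auto simp: after_ring_def prepend_ring_def age_def fun_eq_iff)

lemma prepend_ring_fires_first:
  "prepend_ring i v d \<in> fires_first I i \<longleftrightarrow> d \<in> silent (I - {i}) (fst v)"
  by (auto simp: fires_first_def prepend_ring_def silent_def)

lemma prepend_ring_0 [simp]: "prepend_ring i v d (i, 0) = v"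
  by (simp add: prepend_ring_def)

lemma measurable_after_ring: "after_ring I i \<in> data_law K \<rightarrow>\<^sub>M data_law K"
proof (rule measurable_data_lawI)
  fix y :: "int \<times> nat"
  obtain j n where y: "y = (j, n)" by (cases y)
  have pair: "(\<lambda>x. (x (j, 0), x (i, 0))) \<in> data_law K \<rightarrow>\<^sub>M ring_law K \<Otimes>\<^sub>M ring_law K"
    by (intro measurable_Pair measurable_data_component)
  have "(\<lambda>(v, u). (fst v - fst u, snd v)) \<in> ring_law K \<Otimes>\<^sub>M ring_law K \<rightarrow>\<^sub>M ring_law K" by measurable
  from measurable_compose[OF pair this]
  have "(\<lambda>x. (fst (x (j, 0)) - fst (x (i, 0)), snd (x (j, 0)))) \<in> data_law K \<rightarrow>\<^sub>M ring_law K" by simp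
  then show "(\<lambda>x. after_ring I i x y) \<in> data_law K \<rightarrow>\<^sub>M ring_law K"
    using measurable_data_component by (simp add: after_ring_def y)
qed

lemma fires_first_sets: "finite I \<Longrightarrow> fires_first I i \<in> sets (data_law K)"
proof -
  assume "finite I"
  have "{d \<in> space (data_law K). fst (d (i, 0)) \<le> fst (d (j, 0))} \<in> sets (data_law K)" for j
    by (rule borel_measurable_le[OF measurable_wait_component measurable_wait_component])
  from sets.sets_Collect_finite_All[OF this \<open>finite I\<close>]
  have "{d \<in> space (data_law K). \<forall>j\<in>I. fst (d (i, 0)) \<le> fst (d (j, 0))} \<in> sets (data_law K)" .
  then show ?thesis by (simp add: fires_first_def)
qed

lemma integral_age:
  fixes F :: "clock_data \<Rightarrow> real"
  assumes J: "finite J" and w: "0 \<le> w" and F: "F \<in> borel_measurable (data_law K)"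
  shows "(\<integral>d. indicator (silent J w) d * F (age J w d) \<partial>data_law K) =
         exp (- (real (card J) * w)) * (\<integral>d. F d \<partial>data_law K)"
proof -
  have age_meas: "age J w \<in> data_law K \<rightarrow>\<^sub>M data_law K"
    using measurable_compose[OF measurable_Pair1'[of w borel] measurable_age[of J K]] by simp
  have sil: "silent J w \<in> sets (data_law K)" using J by (rule silent_sets)
  have Fage: "(\<lambda>d. F (age J w d)) \<in> borel_measurable (data_law K)"
    by (rule measurable_compose[OF age_meas F])
  let ?L = "density (data_law K) (indicator (silent J w))"
  have L: "?L = density (data_law K) (\<lambda>d. ennreal (indicator (silent J w) d))"
    by (simp add: ennreal_indicator)
  have "(\<integral>d. indicator (silent J w) d * F (age J w d) \<partial>data_law K) = (\<integral>d. F (age J w d) \<partial>?L)"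
    unfolding L by (subst integral_real_density) (use Fage sil in auto)
  also have "\<dots> = (\<integral>d. F d \<partial>distr ?L (data_law K) (age J w))"
    using age_meas F by (subst integral_distr) auto
  also have "\<dots> = exp (- (real (card J) * w)) * (\<integral>d. F d \<partial>data_law K)"
    unfolding distr_age[OF J w] using F by (subst integral_real_density) auto
  finally show ?thesis .
qed

lemma prob_silent:
  assumes "finite J" "0 \<le> w"
  shows "(\<integral>d. indicator (silent J w) d \<partial>data_law K) = exp (- (real (card J) * w))"
  using integral_age[OF assms, of "\<lambda>_. 1" K] prob_space.prob_space[OF prob_space_data_law[of K]] by simp

text \<open>Conditionally on the first ring of \<open>I\<close> occurring at \<open>i\<close>, with waiting time and mark \<open>v\<close>, the
data seen afterwards are fresh. The exponential factor is the probability that the other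
clocks are silent up to that time. Writing the data as \<open>prepend_ring i v d\<close> turns the event
into \<open>silent\<close> and the shifted data into \<open>age\<close>, for fixed \<open>v\<close>.\<close>

theorem first_ring_formula:
  fixes F :: "(real \<times> mark) \<times> clock_data \<Rightarrow> real"
  assumes I: "finite I" and i: "i \<in> I"
    and F [measurable]: "F \<in> borel_measurable (ring_law K \<Otimes>\<^sub>M data_law K)"
    and bound: "\<And>x. \<bar>F x\<bar> \<le> C"
  shows "(\<integral>d. indicator (fires_first I i) d * F (d (i, 0), after_ring I i d) \<partial>data_law K) =
         (\<integral>v. exp (- (real (card I - 1) * fst v)) * (\<integral>d. F (v, d) \<partial>data_law K) \<partial>ring_law K)"
proof -
  interpret D: prob_space "data_law K" by (rule prob_space_data_law)
  interpret R: prob_space "ring_law K" by (rule prob_space_ring_law)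
  interpret P: pair_prob_space "ring_law K" "data_law K" ..
  define G where "G d = indicator (fires_first I i) d * F (d (i, 0), after_ring I i d)" for d
  have G: "G \<in> borel_measurable (data_law K)"
  proof -
    have "(\<lambda>d. (d (i, 0), after_ring I i d)) \<in> data_law K \<rightarrow>\<^sub>M ring_law K \<Otimes>\<^sub>M data_law K"
      by (intro measurable_Pair measurable_data_component measurable_after_ring)
    from measurable_compose[OF this F] show ?thesis
      unfolding G_def[abs_def] using fires_first_sets[OF I]
          by (intro borel_measurable_times borel_measurable_indicator)
  qed
  have G_bound: "\<bar>G d\<bar> \<le> C" for d
    using bound[of "(d (i, 0), after_ring I i d)"] order_trans[OF abs_ge_zero bound[of undefined]]
    by (auto simp: G_def indicator_def)
  have "(\<integral>d. G d \<partial>data_law K)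
      = (\<integral>d. G d \<partial>distr (ring_law K \<Otimes>\<^sub>M data_law K) (data_law K) (\<lambda>(v, d). prepend_ring i v d))"
    by (simp only: distr_prepend_ring)
  also have "\<dots> = (\<integral>x. G (prepend_ring i (fst x) (snd x)) \<partial>(ring_law K \<Otimes>\<^sub>M data_law K))"
    using G by (subst integral_distr) (auto simp: split_beta')
  also have "\<dots> = (\<integral>v. (\<integral>d. G (prepend_ring i v d) \<partial>data_law K) \<partial>ring_law K)"
  proof (subst P.integral_fst'[symmetric])
    have "(\<lambda>x. G (prepend_ring i (fst x) (snd x))) \<in> borel_measurable (ring_law K \<Otimes>\<^sub>M data_law K)"
      using measurable_compose[OF measurable_prepend_ring G] by (simp add: split_beta')
    then show "integrable (ring_law K \<Otimes>\<^sub>M data_law K) (\<lambda>x. G (prepend_ring i (fst x) (snd x)))"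
      by (intro P.integrable_const_bound[where B = C]) (auto simp: G_bound)
  qed simp
  also have "\<dots> = (\<integral>v. exp (- (real (card I - 1) * fst v)) * (\<integral>d. F (v, d) \<partial>data_law K) \<partial>ring_law K)"
  proof (rule integral_cong_AE)
    have inner: "(\<integral>d. G (prepend_ring i v d) \<partial>data_law K) =
        exp (- (real (card I - 1) * fst v)) * (\<integral>d. F (v, d) \<partial>data_law K)" if v: "0 < fst v" for v
    proof -
      have "(\<lambda>d. F (v, d)) \<in> borel_measurable (data_law K)" by measurable
      then have "(\<integral>d. indicator (silent (I - {i}) (fst v)) d * F (v, age (I - {i}) (fst v) d)
          \<partial>data_law K) =
          exp (- (real (card (I - {i})) * fst v)) * (\<integral>d. F (v, d) \<partial>data_law K)"
        using I v by (intro integral_age) auto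
      moreover have "G (prepend_ring i v d) =
          indicator (silent (I - {i}) (fst v)) d * F (v, age (I - {i}) (fst v) d)" for d
        by (simp add: G_def after_ring_prepend_ring prepend_ring_fires_first indicator_def)
      ultimately show ?thesis using I i by simp
    qed
    show "AE v in ring_law K. (\<integral>d. G (prepend_ring i v d) \<partial>data_law K) =
        exp (- (real (card I - 1) * fst v)) * (\<integral>d. F (v, d) \<partial>data_law K)"
      using AE_ring_law_fst[OF AE_wait_law_pos, of K] by eventually_elim (rule inner)
    show "(\<lambda>v. \<integral>d. G (prepend_ring i v d) \<partial>data_law K) \<in> borel_measurable (ring_law K)"
      using measurable_compose[OF measurable_prepend_ring G]
      by (intro D.borel_measurable_lebesgue_integral) (simp add: split_beta')
    show "(\<lambda>v. exp (- (real (card I - 1) * fst v)) * (\<integral>d. F (v, d) \<partial>data_law K))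
        \<in> borel_measurable (ring_law K)"
      by (intro borel_measurable_times D.borel_measurable_lebesgue_integral) measurable
  qed
  finally show ?thesis by (simp add: G_def)
qed

lemma integral_ring_law_product:
  fixes \<phi> :: "real \<Rightarrow> real" and \<psi> :: "mark \<Rightarrow> real"
  assumes \<phi> [measurable]: "\<phi> \<in> borel_measurable borel" and \<phi>_bound: "\<And>w. \<bar>\<phi> w\<bar> \<le> C"
    and \<psi> [measurable]: "\<psi> \<in> borel_measurable (borel \<Otimes>\<^sub>M count_space UNIV)" and \<psi>_bound: "\<And>m. \<bar>\<psi> m\<bar> \<le> C'"
  shows "integrable (ring_law K) (\<lambda>v. \<phi> (fst v) * \<psi> (snd v))"
    and "(\<integral>v. \<phi> (fst v) * \<psi> (snd v) \<partial>ring_law K) = (\<integral>w. \<phi> w \<partial>wait_law) * (\<integral>m. \<psi> m \<partial>mark_law K)"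
proof -
  interpret W: prob_space wait_law by (rule prob_space_wait_law)
  interpret Q: prob_space "mark_law K" by (rule prob_space_mark_law)
  interpret P: pair_prob_space wait_law "mark_law K" ..
  have "\<bar>\<phi> w * \<psi> m\<bar> \<le> C * C'" for w m
    using mult_mono[OF \<phi>_bound[of w] \<psi>_bound[of m]] order_trans[OF abs_ge_zero \<phi>_bound]
        by (simp add: abs_mult)
  then have int: "integrable (wait_law \<Otimes>\<^sub>M mark_law K) (\<lambda>v. \<phi> (fst v) * \<psi> (snd v))"
    by (intro P.integrable_const_bound[where B = "C * C'"]) auto
  then show "integrable (ring_law K) (\<lambda>v. \<phi> (fst v) * \<psi> (snd v))" by (simp add: ring_law_eq)
  show "(\<integral>v. \<phi> (fst v) * \<psi> (snd v) \<partial>ring_law K) = (\<integral>w. \<phi> w \<partial>wait_law) * (\<integral>m. \<psi> m \<partial>mark_law K)"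
    unfolding ring_law_eq by (subst P.integral_fst'[OF int, symmetric]) simp
qed

lemma integral_wait_law_Icc:
  fixes \<phi> :: "real \<Rightarrow> real"
  assumes "\<phi> \<in> borel_measurable borel"
  shows "(\<integral>w. indicator {0..t} w * \<phi> w \<partial>wait_law) = (\<integral>w. (exp (- w) * \<phi> w) * indicator {0..t} w \<partial>lborel)"
  unfolding wait_law_def using assms
  by (subst integral_real_density)
    (auto simp: exponential_density_def indicator_def intro!: Bochner_Integration.integral_cong)

definition poisson_weight :: "real \<Rightarrow> nat \<Rightarrow> real" where
  "poisson_weight s m = exp (- s) * s ^ m / fact m"

lemma poisson_weight_nonneg: "0 \<le> s \<Longrightarrow> 0 \<le> poisson_weight s m"
  by (simp add: poisson_weight_def)

lemma poisson_weight_sums: "poisson_weight s sums 1"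
proof -
  have "(\<lambda>m. exp (- s) * (s ^ m /\<^sub>R fact m)) sums (exp (- s) * exp s)"
    by (intro sums_mult exp_converges)
  then show ?thesis by (simp add: poisson_weight_def[abs_def] exp_minus divide_inverse_commute mult_ac)
qed

lemma poisson_weight_le_1: "0 \<le> s \<Longrightarrow> poisson_weight s m \<le> 1"
  using sum_le_suminf[OF sums_summable[OF poisson_weight_sums], of "{m}" s] poisson_weight_nonneg[of s]
    sums_unique[OF poisson_weight_sums[of s]] by simp

text \<open>A first ring at rate \<open>k\<close> followed by \<open>m\<close> rings in the remaining time. As \<open>wait_law\<close>
contributes one factor \<open>exp (- w)\<close>, the factor coming from the other clocks is
\<open>exp (- ((k - 1) * w))\<close>.\<close>

lemma poisson_convolution:
  assumes k: "0 < k" and t: "0 \<le> t"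
  shows "(\<integral>w. indicator {0..t} w * (exp (- ((k - 1) * w)) * poisson_weight (k * (t - w)) m) \<partial>wait_law) =
         poisson_weight (k * t) (Suc m) / k"
proof -
  have "(\<integral>w. indicator {0..t} w * (exp (- ((k - 1) * w)) * poisson_weight (k * (t - w)) m) \<partial>wait_law) =
     (\<integral>w. (exp (- w) * (exp (- ((k - 1) * w)) * poisson_weight (k * (t - w)) m))
         * indicator {0..t} w \<partial>lborel)"
    by (rule integral_wait_law_Icc) (simp add: poisson_weight_def)
  also have "\<dots> = (\<integral>w. (exp (- (k * t)) * (k * (t - w)) ^ m / fact m) * indicator {0..t} w \<partial>lborel)"
  proof (intro Bochner_Integration.integral_cong refl)
    fix w :: real
    have "exp (- w) * (exp (- ((k - 1) * w)) * exp (- (k * (t - w)))) = exp (- (k * t))"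
      by (simp add: exp_add[symmetric] algebra_simps)
    then show "exp (- w) * (exp (- ((k - 1) * w)) * poisson_weight (k * (t - w)) m) * indicator {0..t} w
       = exp (- (k * t)) * (k * (t - w)) ^ m / fact m * indicator {0..t} w"
      unfolding poisson_weight_def by (metis (no_types, lifting) mult.assoc times_divide_eq_right)
  qed
  also have "\<dots> = (- exp (- (k * t)) * (k * (t - t)) ^ Suc m / (fact (Suc m) * k)) -
     (- exp (- (k * t)) * (k * (t - 0)) ^ Suc m / (fact (Suc m) * k))"
  proof (rule integral_FTC_Icc_real[OF t])
    fix w
    have "((\<lambda>w. - exp (- (k * t)) * (k * (t - w)) ^ Suc m / (fact (Suc m) * k)) has_real_derivative
       - exp (- (k * t)) * (real (Suc m) * (k * (t - w)) ^ m * (- k)) / (fact (Suc m) * k)) (at w)"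
      using k by (auto intro!: derivative_eq_intros simp del: power_Suc fact_Suc of_nat_Suc)
    moreover have "- exp (- (k * t)) * (real (Suc m) * (k * (t - w)) ^ m * (- k)) / (fact (Suc m) * k)
       = exp (- (k * t)) * (k * (t - w)) ^ m / fact m"
      using k by (simp add: divide_simps del: of_nat_Suc)
    ultimately show "((\<lambda>w. - exp (- (k * t)) * (k * (t - w)) ^ Suc m
        / (fact (Suc m) * k)) has_real_derivative
       exp (- (k * t)) * (k * (t - w)) ^ m / fact m) (at w)" by simp
  qed (auto intro!: continuous_intros)
  also have "\<dots> = poisson_weight (k * t) (Suc m) / k"
    by (simp add: poisson_weight_def)
  finally show ?thesis .
qed

lemma exponential_integral:
  assumes k: "0 < k" and t: "0 \<le> t"
  shows "(\<integral>w. indicator {0..t} w * exp (- ((k - 1) * w)) \<partial>wait_law) = (1 - exp (- (k * t))) / k"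
proof -
  have "(\<integral>w. indicator {0..t} w * exp (- ((k - 1) * w)) \<partial>wait_law) =
     (\<integral>w. (exp (- w) * exp (- ((k - 1) * w))) * indicator {0..t} w \<partial>lborel)"
    by (rule integral_wait_law_Icc) simp
  also have "\<dots> = (\<integral>w. exp (- (k * w)) * indicator {0..t} w \<partial>lborel)"
    by (intro Bochner_Integration.integral_cong refl) (simp add: exp_add[symmetric] algebra_simps)
  also have "\<dots> = (- exp (- (k * t)) / k) - (- exp (- (k * 0)) / k)"
    by (rule integral_FTC_Icc_real[OF t])
      (use k in \<open>auto intro!: derivative_eq_intros continuous_intros\<close>)
  finally show ?thesis by (simp add: diff_divide_distrib)
qed

definition ring_effect :: "(nat \<Rightarrow> real) \<Rightarrow> (int \<Rightarrow> real) \<Rightarrow> int \<Rightarrow> mark \<Rightarrow> config \<Rightarrow> config" where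
  "ring_effect g \<alpha> i m \<zeta> = (if fst m \<le> \<alpha> i * rate_ext g (\<zeta> i) then move i (i + snd m) \<zeta> else \<zeta>)"

lemma integral_ring_effect:
  fixes f :: "config \<Rightarrow> real"
  assumes r: "0 \<le> \<alpha> i * rate_ext g (\<zeta> i)" "\<alpha> i * rate_ext g (\<zeta> i) \<le> 1" and f: "\<And>\<zeta>. \<bar>f \<zeta>\<bar> \<le> C"
  shows "(\<integral>m. f (ring_effect g \<alpha> i m \<zeta>) \<partial>mark_law K) =
     \<alpha> i * rate_ext g (\<zeta> i) * measure_pmf.expectation K (\<lambda>z. f (move i (i + z) \<zeta>)) +
     (1 - \<alpha> i * rate_ext g (\<zeta> i)) * f \<zeta>"
proof -
  define r where "r = \<alpha> i * rate_ext g (\<zeta> i)"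
  let ?U = "uniform_measure lborel {0<..<1::real}"
  interpret U: prob_space ?U by (rule prob_space_unit_interval)
  interpret P: pair_prob_space ?U "measure_pmf K" ..
  define A where "A = measure_pmf.expectation K (\<lambda>z. f (move i (i + z) \<zeta>))"
  have int: "integrable (?U \<Otimes>\<^sub>M measure_pmf K) (\<lambda>m. f (ring_effect g \<alpha> i m \<zeta>))"
    by (rule P.integrable_const_bound[where B = C]) (auto simp: f ring_effect_def if_distrib[of f])
  have U_r: "measure ?U {..r} = r"
  proof (cases "r = 1")
    case True
    then have "{0<..<1} \<inter> {..r} = {0<..<1}" by auto
    with True show ?thesis by (simp add: measure_uniform_measure)
  next
    case False
    then have "{0<..<1} \<inter> {..r} = {0<..r}" using assms(2) by (auto simp: r_def)
    then show ?thesis using assms(1) by (simp add: measure_uniform_measure r_def)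
  qed
  have "(\<integral>m. f (ring_effect g \<alpha> i m \<zeta>) \<partial>mark_law K) =
      (\<integral>u. (\<integral>z. f (ring_effect g \<alpha> i (u, z) \<zeta>) \<partial>measure_pmf K) \<partial>?U)"
    unfolding mark_law_def by (rule P.integral_fst'[OF int, symmetric])
  also have "\<dots> = (\<integral>u. indicator {..r} u * (A - f \<zeta>) + f \<zeta> \<partial>?U)"
  proof (intro Bochner_Integration.integral_cong refl)
    fix u
    show "(\<integral>z. f (ring_effect g \<alpha> i (u, z) \<zeta>) \<partial>measure_pmf K) = indicator {..r} u * (A - f \<zeta>) + f \<zeta>"
      by (cases "u \<le> r") (simp_all add: ring_effect_def A_def r_def[symmetric])
  qed
  also have "\<dots> = r * (A - f \<zeta>) + f \<zeta>"
  proof -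
    have ind: "integrable ?U (indicator {..r} :: real \<Rightarrow> real)"
      by (rule U.integrable_const_bound[where B = 1]) (auto simp: indicator_def)
    have "(\<integral>u. indicator {..r} u * (A - f \<zeta>) + f \<zeta> \<partial>?U) = measure ?U {..r} * (A - f \<zeta>) + f \<zeta>"
      using ind U.prob_space by (subst Bochner_Integration.integral_add)
          (auto simp del: measure_uniform_measure)
    then show ?thesis by (simp only: U_r)
  qed
  finally show ?thesis by (simp add: A_def r_def algebra_simps)
qed

lemma measurable_ring_effect:
  assumes H: "\<And>\<zeta>. (\<lambda>x. H (fst x) \<zeta> (snd x)) \<in> borel_measurable (borel \<Otimes>\<^sub>M N)"
  shows "(\<lambda>x. H (fst x) (ring_effect g \<alpha> i (fst (snd x)) \<zeta>) (snd (snd x)))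
    \<in> borel_measurable (borel \<Otimes>\<^sub>M ((borel \<Otimes>\<^sub>M count_space UNIV) \<Otimes>\<^sub>M N))"
proof -
  let ?P = "borel \<Otimes>\<^sub>M ((borel \<Otimes>\<^sub>M count_space UNIV) \<Otimes>\<^sub>M N)"
  have fixed: "(\<lambda>x. H (fst x) \<xi> (snd (snd x))) \<in> borel_measurable ?P" for \<xi>
  proof -
    have "(\<lambda>x. (fst x, snd (snd x))) \<in> ?P \<rightarrow>\<^sub>M borel \<Otimes>\<^sub>M N" by measurable
    from measurable_compose[OF this H] show ?thesis by simp
  qed
  have "(\<lambda>x. snd (fst (snd x))) \<in> ?P \<rightarrow>\<^sub>M count_space UNIV" by measurable
  then have jump: "(\<lambda>x. H (fst x) (move i (i + snd (fst (snd x))) \<zeta>) (snd (snd x)))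
      \<in> borel_measurable ?P"
    by (rule measurable_compose_countable[OF fixed])
  have "(\<lambda>x. if fst (fst (snd x)) \<le> \<alpha> i * rate_ext g (\<zeta> i)
      then H (fst x) (move i (i + snd (fst (snd x))) \<zeta>) (snd (snd x))
      else H (fst x) \<zeta> (snd (snd x))) \<in> borel_measurable ?P"
    by (intro measurable_If jump fixed) measurable
  then show ?thesis by (rule measurable_cong[THEN iffD1, rotated]) (simp add: ring_effect_def)
qed

text \<open>The bound \<open>B\<close> replaces the observable once the number of rings taken into account is used up.
This ends the recursion over the rings and can only increase the value.\<close>

locale majorised_window = window +
  fixes h :: "config \<Rightarrow> real" and B :: real
  assumes h_bound: "\<And>\<zeta>. \<bar>h \<zeta>\<bar> \<le> B"
begin

primrec majorant :: "nat \<Rightarrow> real \<Rightarrow> config \<Rightarrow> clock_data \<Rightarrow> real" where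
  "majorant 0 t \<zeta> d = B"
| "majorant (Suc n) t \<zeta> d =
     (if \<forall>i\<in>{a..b}. t < fst (d (i, 0)) then h \<zeta> else 0) +
     (\<Sum>i\<in>{a..b}. if d \<in> fires_first {a..b} i \<and> fst (d (i, 0)) \<le> t
        then majorant n (t - fst (d (i, 0))) (ring_effect g \<alpha> i (snd (d (i, 0))) \<zeta>)
            (after_ring {a..b} i d)
        else 0)"

lemma B_nonneg: "0 \<le> B"
  using order_trans[OF abs_ge_zero h_bound] .

lemma majorant_bounded: "\<exists>C. \<forall>t \<zeta> d. \<bar>majorant n t \<zeta> d\<bar> \<le> C"
proof (induction n)
  case 0
  show ?case using B_nonneg by auto
next
  case (Suc n)
  then obtain C where C: "\<And>t \<zeta> d. \<bar>majorant n t \<zeta> d\<bar> \<le> C" by auto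
  have C0: "0 \<le> C" using order_trans[OF abs_ge_zero C] .
  have "\<bar>majorant (Suc n) t \<zeta> d\<bar> \<le> B + (\<Sum>i\<in>{a..b}. C)" for t \<zeta> d
    unfolding majorant.simps
    by (intro order_trans[OF abs_triangle_ineq] add_mono order_trans[OF sum_abs] sum_mono)
      (auto simp: h_bound B_nonneg C C0)
  then show ?case by blast
qed

lemma measurable_majorant:
  "(\<lambda>x. majorant n (fst x) \<zeta> (snd x)) \<in> borel_measurable (borel \<Otimes>\<^sub>M data_law K)"
proof (induction n arbitrary: \<zeta>)
  case (Suc n)
  let ?P = "borel \<Otimes>\<^sub>M data_law K"
  have wait [measurable]: "(\<lambda>x. fst (snd x y)) \<in> borel_measurable ?P" for y
    by (rule measurable_compose[OF measurable_snd measurable_wait_component])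
  have comp [measurable]: "(\<lambda>x. snd x y) \<in> ?P \<rightarrow>\<^sub>M ring_law K" for y
    by (rule measurable_compose[OF measurable_snd measurable_data_component])
  have effect: "(\<lambda>x. majorant n (fst x
      - fst (snd x (i, 0))) (ring_effect g \<alpha> i (snd (snd x (i, 0))) \<zeta>)
      (after_ring {a..b} i (snd x))) \<in> borel_measurable ?P" for i
  proof -
    have "snd \<in> ring_law K \<rightarrow>\<^sub>M (borel \<Otimes>\<^sub>M count_space UNIV)" by measurable
    from measurable_compose[OF comp this]
    have "(\<lambda>x. (fst x - fst (snd x (i, 0)), snd (snd x (i, 0)), after_ring {a..b} i (snd x)))
        \<in> ?P \<rightarrow>\<^sub>M borel \<Otimes>\<^sub>M ((borel \<Otimes>\<^sub>M count_space UNIV) \<Otimes>\<^sub>M data_law K)"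
      by (intro measurable_Pair measurable_compose[OF measurable_snd measurable_after_ring]) measurable
    from measurable_compose[OF this measurable_ring_effect[of "majorant n" "data_law K" g \<alpha> i \<zeta>,
        OF Suc]] show ?thesis by simp
  qed
  have first: "{x \<in> space ?P. snd x \<in> fires_first {a..b} i \<and> fst (snd x (i, 0)) \<le> fst x} \<in> sets ?P" for i
    unfolding fires_first_def by measurable
  have "{x \<in> space ?P. \<forall>i\<in>{a..b}. fst x < fst (snd x (i, 0))} \<in> sets ?P" by measurable
  then show ?case
    unfolding majorant.simps
    by (intro borel_measurable_add borel_measurable_sum measurable_If effect first) auto
qed simp

lemma measurable_majorant_fixed_time: "majorant n t \<zeta> \<in> borel_measurable (data_law K)"
  using measurable_compose[OF measurable_Pair1'[of t borel] measurable_majorant[of n \<zeta>]] by simp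

lemma measurable_majorant_after_ring:
  "(\<lambda>x. majorant n (t - fst (fst x)) (ring_effect g \<alpha> i (snd (fst x)) \<zeta>) (snd x))
     \<in> borel_measurable (ring_law K \<Otimes>\<^sub>M data_law K)"
proof -
  have "(\<lambda>x. (t - fst (fst x), snd (fst x), snd x)) \<in> ring_law K \<Otimes>\<^sub>M data_law K \<rightarrow>\<^sub>M
      borel \<Otimes>\<^sub>M ((borel \<Otimes>\<^sub>M count_space UNIV) \<Otimes>\<^sub>M data_law K)" by measurable
  from measurable_compose[OF this measurable_ring_effect[of "majorant n" "data_law K" g \<alpha> i \<zeta>,
      OF measurable_majorant]]
  show ?thesis by simp
qed

end

section \<open>Expectation of the majorant\<close>

context majorised_window
begin

abbreviation (input) "total_rate \<equiv> real (card {a..b})"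

text \<open>Measured relative to \<open>B\<close>, the contribution of at least \<open>n\<close> rings to the expectation of
\<open>majorant n\<close> is zero.\<close>

definition excess :: "nat \<Rightarrow> config \<Rightarrow> real" where
  "excess m \<zeta> = (kernel_op \<kappa> ^^ m) h \<zeta> - B"

lemma total_rate_pos: "0 < total_rate"
  using ab by simp

lemma excess_bound: "\<bar>excess m \<zeta>\<bar> \<le> 2 * B"
  using abs_kernel_op_power_le[of h B m \<kappa> \<zeta>, OF h_bound] by (simp add: excess_def)

lemma kernel_op_excess: "kernel_op \<kappa> (excess m) \<zeta> = excess (Suc m) \<zeta>"
proof -
  have "integrable (\<kappa> \<zeta>) ((kernel_op \<kappa> ^^ m) h)"
    by (rule integrable_pmf_bounded[where B = B]) (rule abs_kernel_op_power_le, rule h_bound)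
  then show ?thesis by (simp add: excess_def[abs_def] kernel_op_def[of \<kappa> _ \<zeta>])
qed

lemma sum_ring_effects:
  assumes "\<And>\<zeta>. \<bar>f \<zeta>\<bar> \<le> C"
  shows "(\<Sum>i\<in>{a..b}. \<integral>m. f (ring_effect g \<alpha> i m \<zeta>) \<partial>mark_law K) = total_rate * kernel_op \<kappa> f \<zeta>"
  using kernel_op_ring_kernel[of "{a..b}" f C \<alpha> g \<zeta> K] integral_ring_effect[OF rate_bounds, of f C]
      assms rate_bounds ab
  by simp

lemma integral_no_ring:
  assumes t: "0 \<le> t"
  shows "(\<integral>d. (if \<forall>i\<in>{a..b}. t < fst (d (i, 0)) then h \<zeta> else 0) \<partial>data_law K)
      = exp (- (total_rate * t)) * h \<zeta>"
proof -
  have "(\<integral>d. (if \<forall>i\<in>{a..b}. t < fst (d (i, 0)) then h \<zeta> else 0) \<partial>data_law K) =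
      (\<integral>d. indicator (silent {a..b} t) d * h \<zeta> \<partial>data_law K)"
  proof (rule integral_cong_AE)
    have "AE d in data_law K. \<forall>y. fst (d y) \<noteq> t"
      by (intro AE_data_law_all AE_ring_law_fst AE_wait_law_neq)
    then show "AE d in data_law K. (if \<forall>i\<in>{a..b}. t < fst (d (i, 0)) then h \<zeta> else 0)
        = indicator (silent {a..b} t) d * h \<zeta>"
    proof eventually_elim
      case (elim d)
      then have "t < fst (d y) \<longleftrightarrow> t \<le> fst (d y)" for y by (metis less_le)
      then show ?case by (simp add: silent_def indicator_def)
    qed
    have "{d \<in> space (data_law K). t < fst (d (i, 0))} \<in> sets (data_law K)" for i
      by (rule borel_measurable_less[OF _ measurable_wait_component]) simp
    then have "{d \<in> space (data_law K). \<forall>i\<in>{a..b}. t < fst (d (i, 0))} \<in> sets (data_law K)"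
      by (rule sets.sets_Collect_finite_All) simp
    then show "(\<lambda>d. if \<forall>i\<in>{a..b}. t < fst (d (i, 0)) then h \<zeta> else 0) \<in> borel_measurable (data_law K)"
      by (intro measurable_If) auto
    show "(\<lambda>d. indicator (silent {a..b} t) d * h \<zeta>) \<in> borel_measurable (data_law K)"
      using silent_sets[of "{a..b}" t K]
          by (intro borel_measurable_times borel_measurable_indicator) auto
  qed
  also have "\<dots> = exp (- (total_rate * t)) * h \<zeta>"
    using prob_silent[of "{a..b}" t K] t by simp
  finally show ?thesis .
qed

text \<open>Induction on \<open>n\<close> with \<open>first_ring_formula\<close>: the effect of the first ring turns \<open>excess m\<close> into
\<open>excess (Suc m)\<close> on summing over its position, and the integral over its time turns the \<open>m\<close>-th
Poisson weight into the next one. Thus the number of rings up to time \<open>t\<close> has a Poisson law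
and is independent of the states visited.\<close>

lemma integral_majorant:
  assumes "0 \<le> t"
  shows "(\<integral>d. majorant n t \<zeta> d \<partial>data_law K) = B + (\<Sum>m<n. poisson_weight (total_rate * t) m * excess m \<zeta>)"
  using assms
proof (induction n arbitrary: t \<zeta>)
  case 0
  show ?case using prob_space.prob_space[OF prob_space_data_law[of K]] by simp
next
  case (Suc n)
  interpret D: prob_space "data_law K" by (rule prob_space_data_law)
  note t = \<open>0 \<le> t\<close>
  obtain C where C: "\<And>t \<zeta> d. \<bar>majorant n t \<zeta> d\<bar> \<le> C" using majorant_bounded by blast
  \<comment> \<open>the contribution of a first ring at \<open>i\<close>, as a function of that ring and of the data after it\<close>
  define F where "F i x = (if fst (fst x) \<le> t
      then majorant n (t - fst (fst x)) (ring_effect g \<alpha> i (snd (fst x)) \<zeta>) (snd x) else 0)" for i x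
  have F_meas: "F i \<in> borel_measurable (ring_law K \<Otimes>\<^sub>M data_law K)" for i
    unfolding F_def by (intro measurable_If measurable_majorant_after_ring) measurable
  have F_bound: "\<bar>F i x\<bar> \<le> C" for i x using C order_trans[OF abs_ge_zero C] by (simp add: F_def)
  define T where "T i d = indicator (fires_first {a..b} i) d
      * F i (d (i, 0), after_ring {a..b} i d)" for i d
  have T_int: "integrable (data_law K) (T i)" for i
  proof (rule D.integrable_const_bound[where B = C])
    have "(\<lambda>d. (d (i, 0), after_ring {a..b} i d)) \<in> data_law K \<rightarrow>\<^sub>M ring_law K \<Otimes>\<^sub>M data_law K"
      by (intro measurable_Pair measurable_data_component measurable_after_ring)
    from measurable_compose[OF this F_meas] show "T i \<in> borel_measurable (data_law K)"
      unfolding T_def[abs_def] using fires_first_sets[of "{a..b}"]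
      by (intro borel_measurable_times borel_measurable_indicator) auto
    show "AE d in data_law K. norm (T i d) \<le> C"
      using F_bound order_trans[OF abs_ge_zero F_bound] by (intro AE_I2) (simp add: T_def indicator_def)
  qed
  let ?T0 = "\<lambda>d. if \<forall>i\<in>{a..b}. t < fst (d (i, 0)) then h \<zeta> else 0"
  have majorant_eq: "majorant (Suc n) t \<zeta> d = ?T0 d + (\<Sum>i\<in>{a..b}. T i d)" for d
    unfolding majorant.simps
    by (intro arg_cong2[where f = "(+)"] sum.cong refl) (simp add: T_def F_def indicator_def)
  have T0_int: "integrable (data_law K) ?T0"
  proof -
    have "?T0 = (\<lambda>d. majorant (Suc n) t \<zeta> d - (\<Sum>i\<in>{a..b}. T i d))"
        by (simp only: majorant_eq add_diff_cancel_right')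
    moreover obtain C' where "\<And>d. \<bar>majorant (Suc n) t \<zeta> d\<bar> \<le> C'" using majorant_bounded[of "Suc n"]
        by blast
    then have "integrable (data_law K) (majorant (Suc n) t \<zeta>)"
      by (intro D.integrable_const_bound[where B = C'] measurable_majorant_fixed_time) auto
    ultimately show ?thesis using T_int
        by (simp only:) (intro Bochner_Integration.integrable_diff Bochner_Integration.integrable_sum)
  qed
  \<comment> \<open>the factors depending on the time \<open>w\<close> of the first ring; the indicator of \<open>{0..t}\<close> makes them bounded\<close>
  define disc where "disc w = indicator {0..t} w * exp (- ((total_rate - 1) * w))" for w
  define disc' where "disc' m w = indicator {0..t} w
      * (exp (- ((total_rate - 1) * w)) * poisson_weight (total_rate * (t - w)) m)" for m w
  have k1: "0 \<le> total_rate - 1" using ab by simp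
  have disc: "\<bar>disc w\<bar> \<le> 1" for w
    using k1 by (simp add: disc_def indicator_def)
  have disc': "\<bar>disc' m w\<bar> \<le> 1" for m w
  proof (cases "w \<in> {0..t}")
    case True
    then have "0 \<le> total_rate * (t - w)" using total_rate_pos by auto
    from poisson_weight_nonneg[OF this, of m] poisson_weight_le_1[OF this, of m] True k1
    show ?thesis by (auto simp: disc'_def abs_mult intro!: mult_le_one)
  qed (simp add: disc'_def)
  have meas: "disc \<in> borel_measurable borel" "disc' m \<in> borel_measurable borel" for m
    unfolding disc_def[abs_def] disc'_def[abs_def] poisson_weight_def by measurable
  have effect_meas: "(\<lambda>m. f (ring_effect g \<alpha> i m \<zeta>))
      \<in> borel_measurable (borel \<Otimes>\<^sub>M count_space UNIV)" for f :: "config \<Rightarrow> real" and i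
    unfolding ring_effect_def if_distrib[of f] by measurable
  define e where "e m i = (\<integral>v. excess m (ring_effect g \<alpha> i v \<zeta>) \<partial>mark_law K)" for m i
  have T_integral: "(\<integral>d. T i d \<partial>data_law K) =
      B * ((1 - exp (- (total_rate * t))) / total_rate)
          + (\<Sum>m<n. poisson_weight (total_rate * t) (Suc m) / total_rate * e m i)" if i: "i
          \<in> {a..b}" for i
  proof -
    have "(\<integral>d. T i d \<partial>data_law K) = (\<integral>v. exp (- (real (card {a..b} - 1) * fst v))
        * (\<integral>d. F i (v, d) \<partial>data_law K) \<partial>ring_law K)"
      unfolding T_def by (rule first_ring_formula[OF _ i F_meas F_bound]) simp
    also have "\<dots> = (\<integral>v. disc (fst v) * B
        + (\<Sum>m<n. disc' m (fst v) * excess m (ring_effect g \<alpha> i (snd v) \<zeta>)) \<partial>ring_law K)"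
    proof (rule integral_cong_AE)
      show "(\<lambda>v. exp (- (real (card {a..b} - 1) * fst v)) * (\<integral>d. F i (v, d) \<partial>data_law K))
          \<in> borel_measurable (ring_law K)"
        using F_meas[of i] by (intro borel_measurable_times D.borel_measurable_lebesgue_integral) auto
      have "(\<lambda>v. excess m (ring_effect g \<alpha> i (snd v) \<zeta>)) \<in> borel_measurable (ring_law K)" for m
      proof -
        have "snd \<in> ring_law K \<rightarrow>\<^sub>M (borel \<Otimes>\<^sub>M count_space UNIV)" by measurable
        from measurable_compose[OF this effect_meas] show ?thesis .
      qed
      moreover have "(\<lambda>v. disc (fst v)) \<in> borel_measurable (ring_law K)" "(\<lambda>v. disc' m (fst v))
          \<in> borel_measurable (ring_law K)" for m
        using meas by measurable
      ultimately show "(\<lambda>v. disc (fst v) * B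
          + (\<Sum>m<n. disc' m (fst v) * excess m (ring_effect g \<alpha> i (snd v) \<zeta>)))
          \<in> borel_measurable (ring_law K)"
        by (intro borel_measurable_add borel_measurable_times borel_measurable_sum
            borel_measurable_const) auto
      show "AE v in ring_law K. exp (- (real (card {a..b} - 1) * fst v)) * (\<integral>d. F i (v, d) \<partial>data_law K) =
         disc (fst v) * B + (\<Sum>m<n. disc' m (fst v) * excess m (ring_effect g \<alpha> i (snd v) \<zeta>))"
        using AE_ring_law_fst[OF AE_wait_law_pos, of K]
      proof eventually_elim
        case (elim v)
        show ?case
        proof (cases "fst v \<le> t")
          case True
          then have "(\<integral>d. F i (v, d) \<partial>data_law K) = B
              + (\<Sum>m<n. poisson_weight (total_rate * (t - fst v)) m
              * excess m (ring_effect g \<alpha> i (snd v) \<zeta>))"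
            unfolding F_def by (simp add: Suc.IH)
          moreover have "real (card {a..b} - 1) = total_rate - 1" using ab by (simp add: of_nat_diff)
          ultimately show ?thesis using True elim
            by (simp add: disc_def disc'_def distrib_left sum_distrib_left mult.assoc)
        next
          case False
          then show ?thesis by (simp add: F_def disc_def disc'_def)
        qed
      qed
    qed
    also have "\<dots> = (\<integral>w. disc w \<partial>wait_law) * B + (\<Sum>m<n. (\<integral>w. disc' m w \<partial>wait_law) * e m i)"
    proof -
      note const = integral_ring_law_product[OF meas(1) disc, of "\<lambda>_. B" B K]
      have prod: "integrable (ring_law K) (\<lambda>v. disc' m (fst v) * excess m (ring_effect g \<alpha> i (snd v) \<zeta>))"
        "(\<integral>v. disc' m (fst v) * excess m (ring_effect g \<alpha> i (snd v) \<zeta>) \<partial>ring_law K)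
            = (\<integral>w. disc' m w \<partial>wait_law) * e m i" for m
        using integral_ring_law_product[OF meas(2) disc' effect_meas[of "excess m" i], where C'
            = "2 * B" and K = K] excess_bound
        by (simp_all add: e_def)
      have "(\<integral>m. B \<partial>mark_law K) = B"
        using prob_space.prob_space[OF prob_space_mark_law[of K]] by simp
      then show ?thesis
        using const prod B_nonneg
        by (subst Bochner_Integration.integral_add)
          (auto simp: Bochner_Integration.integral_sum e_def intro!: Bochner_Integration.integrable_sum)
    qed
    also have "\<dots> = (1 - exp (- (total_rate * t))) / total_rate * B
        + (\<Sum>m<n. poisson_weight (total_rate * t) (Suc m) / total_rate * e m i)"
      unfolding disc_def disc'_def
      by (simp only: exponential_integral[OF total_rate_pos t] poisson_convolution[OF total_rate_pos t])
    finally show ?thesis by (simp only: mult.commute)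
  qed
  have e_sum: "(\<Sum>i\<in>{a..b}. e m i) = total_rate * excess (Suc m) \<zeta>" for m
    unfolding e_def by (subst sum_ring_effects[OF excess_bound]) (simp only: kernel_op_excess)
  have "(\<integral>d. majorant (Suc n) t \<zeta> d \<partial>data_law K) = (\<integral>d. ?T0 d \<partial>data_law K)
      + (\<Sum>i\<in>{a..b}. \<integral>d. T i d \<partial>data_law K)"
    unfolding majorant_eq using T0_int T_int
    by (subst Bochner_Integration.integral_add) (auto simp: Bochner_Integration.integral_sum intro!:
        Bochner_Integration.integrable_sum)
  also have "(\<Sum>i\<in>{a..b}. \<integral>d. T i d \<partial>data_law K) =
      (\<Sum>i\<in>{a..b}. B * ((1 - exp (- (total_rate * t))) / total_rate)
          + (\<Sum>m<n. poisson_weight (total_rate * t) (Suc m) / total_rate * e m i))"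
    by (rule sum.cong[OF refl T_integral])
  also have "\<dots> = B * (1 - exp (- (total_rate * t))) + (\<Sum>m<n. poisson_weight (total_rate * t) (Suc m)
      / total_rate * (\<Sum>i\<in>{a..b}. e m i))"
    using total_rate_pos by (simp add: sum.distrib sum.swap[of _ _ "{a..b}"] sum_distrib_left del:
        card_atLeastAtMost_int)
  also have "\<dots> = B * (1 - exp (- (total_rate * t))) + (\<Sum>m<n. poisson_weight (total_rate * t) (Suc m)
      * excess (Suc m) \<zeta>)"
    unfolding e_sum using total_rate_pos ab by (simp del: card_atLeastAtMost_int)
  also have "(\<integral>d. ?T0 d \<partial>data_law K) = exp (- (total_rate * t)) * h \<zeta>"
    by (rule integral_no_ring[OF t])
  also have "exp (- (total_rate * t)) * h \<zeta>
      + (B * (1 - exp (- (total_rate * t))) + (\<Sum>m<n. poisson_weight (total_rate * t) (Suc m)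
      * excess (Suc m) \<zeta>))
     = B + (\<Sum>m<Suc n. poisson_weight (total_rate * t) m * excess m \<zeta>)"
    by (subst sum.lessThan_Suc_shift) (simp add: poisson_weight_def excess_def algebra_simps)
  finally show ?case .
qed

end

section \<open>Pathwise domination by attractiveness\<close>

definition event_time :: "clock_data \<Rightarrow> int \<Rightarrow> nat \<Rightarrow> real" where
  "event_time d = ring_time (\<lambda>x n. fst (d (x, n)))"

text \<open>Properties of almost every realisation. Ties must be excluded because two simultaneous rings
would not act one after the other. All the properties persist when the first ring is removed.\<close>

definition regular_data :: "int set \<Rightarrow> clock_data \<Rightarrow> bool" where
  "regular_data I d \<longleftrightarrow>
     (\<forall>i\<in>I. \<forall>n. 0 < fst (d (i, n)) \<and> 0 < fst (snd (d (i, n))) \<and> snd (snd (d (i, n))) \<in> {1, - 1}) \<and>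
     (\<forall>i\<in>I. \<forall>j\<in>I. i \<noteq> j \<longrightarrow> (\<forall>n m. event_time d i n \<noteq> event_time d j m))"

text \<open>The part of \<open>harris_path\<close> that concerns the window. Unlike the latter it does not mention
rings outside \<open>I\<close>, which is what allows time to be shifted to the first ring of the window.\<close>

definition window_path ::
  "(nat \<Rightarrow> real) \<Rightarrow> (int \<Rightarrow> real) \<Rightarrow> int set \<Rightarrow> int set \<Rightarrow> clock_data \<Rightarrow> (real \<Rightarrow> config) \<Rightarrow> bool" where
  "window_path g \<alpha> I \<Lambda> d \<xi> \<longleftrightarrow>
     (\<forall>i\<in>I. \<forall>n. \<exists>\<zeta>. state_before \<xi> (event_time d i n) \<zeta> \<and>
        \<xi> (event_time d i n) = ring_effect g \<alpha> i (snd (d (i, n))) \<zeta>) \<and>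
     (\<forall>y\<in>\<Lambda>. \<forall>s t. 0 \<le> s \<longrightarrow> s \<le> t \<longrightarrow>
        (\<forall>i\<in>I. \<forall>n. s < event_time d i n \<longrightarrow> event_time d i n \<le> t \<longrightarrow> i \<noteq> y \<and> i + snd (snd (d (i, n))) \<noteq> y) \<longrightarrow>
        \<xi> t y = \<xi> s y)"

lemma regular_data_no_ties:
  "regular_data I d \<Longrightarrow> i \<in> I \<Longrightarrow> j \<in> I \<Longrightarrow> i \<noteq> j \<Longrightarrow> event_time d i n \<noteq> event_time d j m"
  unfolding regular_data_def by blast

lemma event_time_0 [simp]: "event_time d i 0 = fst (d (i, 0))"
  by (simp add: event_time_def ring_time_def)

lemma event_time_Suc: "event_time d i (Suc n) = event_time d i n + fst (d (i, Suc n))"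
  by (simp add: event_time_def ring_time_def)

lemma event_time_ge_first:
  assumes "\<And>n. 0 < fst (d (i, n))"
  shows "fst (d (i, 0)) \<le> event_time d i n"
proof (induction n)
  case (Suc n)
  then show ?case using assms[of "Suc n"] by (simp add: event_time_Suc)
qed simp

lemma after_ring_time_self:
  "event_time (after_ring I i d) i n = event_time d i (Suc n) - fst (d (i, 0))"
  by (induction n) (simp_all add: event_time_Suc, simp_all add: after_ring_def)

lemma after_ring_time_other:
  "j \<in> I \<Longrightarrow> j \<noteq> i \<Longrightarrow> event_time (after_ring I i d) j n = event_time d j n - fst (d (i, 0))"
  by (induction n) (simp_all add: event_time_Suc, simp_all add: after_ring_def)

lemma after_ring_time:
  "j \<in> I \<Longrightarrow> event_time (after_ring I i d) j n = event_time d j (if j = i then Suc n else n)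
      - fst (d (i, 0))"
  by (simp add: after_ring_time_self after_ring_time_other)

lemma after_ring_mark:
  "snd (after_ring I i d (j, n)) = snd (d (j, if j = i then Suc n else n))"
  by (simp add: after_ring_def)

lemma regular_after_ring:
  assumes reg: "regular_data I d" and i: "i \<in> I" "d \<in> fires_first I i"
  shows "regular_data I (after_ring I i d)"
  unfolding regular_data_def
proof (intro conjI ballI allI impI)
  fix j n assume j: "j \<in> I"
  from j reg show "0 < fst (snd (after_ring I i d (j, n)))" "snd (snd (after_ring I i d (j, n)))
      \<in> {1, - 1}"
    by (auto simp: after_ring_mark regular_data_def)
  have "fst (d (i, 0)) < fst (d (j, 0))" if "j \<noteq> i"
  proof -
    have "event_time d i 0 \<noteq> event_time d j 0"
      using that by (intro regular_data_no_ties[OF reg i(1) j]) simp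
    with i j show ?thesis by (auto simp: fires_first_def less_le)
  qed
  with j reg show "0 < fst (after_ring I i d (j, n))"
    by (auto simp: after_ring_def regular_data_def)
next
  fix j l n m assume "j \<in> I" "l \<in> I" "j \<noteq> l"
  then have "event_time d j n' \<noteq> event_time d l m'" for n' m' by (rule regular_data_no_ties[OF reg])
  with \<open>j \<in> I\<close> \<open>l \<in> I\<close> show "event_time (after_ring I i d) j n \<noteq> event_time (after_ring I i d) l m"
    by (simp add: after_ring_time)
qed

lemma state_before_shift:
  "state_before (\<lambda>r. \<xi> (r + w)) (s - w) \<zeta> \<longleftrightarrow> state_before \<xi> s \<zeta>"
proof -
  have "(\<forall>\<^sub>F r in at_left (s - w). \<xi> (r + w) y = \<zeta> y) \<longleftrightarrow> (\<forall>\<^sub>F r in at_left s. \<xi> r y = \<zeta> y)" for y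
    unfolding eventually_at_left_field
  proof safe
    fix c assume c: "c < s - w" "\<forall>r>c. r < s - w \<longrightarrow> \<xi> (r + w) y = \<zeta> y"
    have "\<xi> r y = \<zeta> y" if "c + w < r" "r < s" for r
      using c(2)[rule_format, of "r - w"] that by simp
    then show "\<exists>c<s. \<forall>r>c. r < s \<longrightarrow> \<xi> r y = \<zeta> y" using c(1) by (intro exI[of _ "c + w"]) auto
  next
    fix c assume c: "c < s" "\<forall>r>c. r < s \<longrightarrow> \<xi> r y = \<zeta> y"
    then show "\<exists>c<s - w. \<forall>r>c. r < s - w \<longrightarrow> \<xi> (r + w) y = \<zeta> y" by (intro exI[of _ "c - w"]) auto
  qed
  then show ?thesis by (simp add: state_before_def)
qed

text \<open>The dynamics restarted at the first ring is again driven by clock data, namely by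
\<open>after_ring I i d\<close>.\<close>

lemma window_path_after_ring:
  assumes path: "window_path g \<alpha> I \<Lambda> d \<xi>" and w: "0 \<le> fst (d (i, 0))"
  shows "window_path g \<alpha> I \<Lambda> (after_ring I i d) (\<lambda>r. \<xi> (r + fst (d (i, 0))))"
  unfolding window_path_def
proof (intro conjI ballI allI impI)
  let ?w = "fst (d (i, 0))"
  fix j n assume j: "j \<in> I"
  define n' where "n' = (if j = i then Suc n else n)"
  have time: "event_time (after_ring I i d) j n = event_time d j n' - ?w"
    using j by (simp add: after_ring_time n'_def)
  have mark: "snd (after_ring I i d (j, n)) = snd (d (j, n'))"
    by (simp add: after_ring_mark n'_def)
  obtain \<zeta> where "state_before \<xi> (event_time d j n') \<zeta>"
    "\<xi> (event_time d j n') = ring_effect g \<alpha> j (snd (d (j, n'))) \<zeta>"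
    using path j unfolding window_path_def by blast
  then show "\<exists>\<zeta>. state_before (\<lambda>r. \<xi> (r + ?w)) (event_time (after_ring I i d) j n) \<zeta> \<and>
      \<xi> (event_time (after_ring I i d) j n + ?w) = ring_effect g \<alpha> j (snd (after_ring I i d (j, n))) \<zeta>"
    unfolding time mark state_before_shift by auto
next
  let ?w = "fst (d (i, 0))"
  fix y s t assume y: "y \<in> \<Lambda>" and st: "(0::real) \<le> s" "s \<le> t"
  assume quiet: "\<forall>j\<in>I. \<forall>n. s < event_time (after_ring I i d) j n \<longrightarrow> event_time (after_ring I i d) j n
      \<le> t \<longrightarrow>
     j \<noteq> y \<and> j + snd (snd (after_ring I i d (j, n))) \<noteq> y"
  have "j \<noteq> y \<and> j + snd (snd (d (j, n))) \<noteq> y"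
    if j: "j \<in> I" and n: "s + ?w < event_time d j n" "event_time d j n \<le> t + ?w" for j n
  proof -
    obtain m where m: "n = (if j = i then Suc m else m)"
    proof (cases "j = i")
      case True
      have "n \<noteq> 0"
      proof
        assume "n = 0"
        with True n(1) st show False by simp
      qed
      then obtain m where "n = Suc m" using not0_implies_Suc by blast
      with True that show ?thesis by simp
    qed (use that in simp)
    have time: "event_time (after_ring I i d) j m = event_time d j n - ?w" using j m
        by (simp add: after_ring_time)
    have mark: "snd (after_ring I i d (j, m)) = snd (d (j, n))" by (simp add: after_ring_mark m)
    show ?thesis using quiet[rule_format, OF j, of m] n unfolding time mark by auto
  qed
  then show "\<xi> (t + ?w) y = \<xi> (s + ?w) y"
    using path y st w unfolding window_path_def by auto
qed

lemma rate_ext_mono: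
  assumes g: "rate_function g" and "k \<le> l"
  shows "rate_ext g k \<le> rate_ext g l"
proof (cases l)
  case (enat n)
  with \<open>k \<le> l\<close> obtain m where "k = enat m" "m \<le> n" by (cases k) auto
  with enat g show ?thesis by (auto simp: rate_function_def dest: monoD)
qed (use rate_ext_bounds(2)[OF g] in auto)

lemma move_mono: "\<zeta> \<le> \<zeta>' \<Longrightarrow> move x y \<zeta> \<le> move x y \<zeta>'"
proof -
  have "k \<le> l \<Longrightarrow> k - 1 \<le> l - 1" for k l :: enat
    by (cases k; cases l) (auto simp: one_enat_def)
  then show "\<zeta> \<le> \<zeta>' \<Longrightarrow> move x y \<zeta> \<le> move x y \<zeta>'"
    by (auto simp: move_def Let_def le_fun_def intro: add_right_mono)
qed

text \<open>Attractiveness. The same mark is used for both configurations. If only the larger one moves a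
particle away from \<open>i\<close>, its rate there is larger, so it has strictly more particles at \<open>i\<close> and
stays on top. Only the smaller one moving is impossible as the rate is nondecreasing.\<close>

lemma ring_effect_mono:
  assumes g: "rate_function g" and \<alpha>: "0 \<le> \<alpha> i" and le: "\<zeta> \<le> \<zeta>'"
    and m: "snd m \<noteq> 0"
  shows "ring_effect g \<alpha> i m \<zeta> \<le> ring_effect g \<alpha> i m \<zeta>'"
proof -
  have rates: "\<alpha> i * rate_ext g (\<zeta> i) \<le> \<alpha> i * rate_ext g (\<zeta>' i)"
    using \<alpha> le by (intro mult_left_mono rate_ext_mono[OF g]) (auto simp: le_fun_def)
  consider "fst m \<le> \<alpha> i * rate_ext g (\<zeta> i)"
    | "\<not> fst m \<le> \<alpha> i * rate_ext g (\<zeta> i)" "fst m \<le> \<alpha> i * rate_ext g (\<zeta>' i)"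
    | "\<not> fst m \<le> \<alpha> i * rate_ext g (\<zeta>' i)"
    by blast
  then show ?thesis
  proof cases
    case 1
    with rates le show ?thesis by (auto simp: ring_effect_def intro: move_mono)
  next
    case 2
    then have "\<zeta> i \<noteq> \<zeta>' i" by auto
    with le have "\<zeta> i < \<zeta>' i" by (auto simp: le_fun_def less_le)
    then have "\<zeta> i \<le> \<zeta>' i - 1"
      by (cases "\<zeta> i"; cases "\<zeta>' i") (auto simp: one_enat_def)
    moreover have "\<zeta> y \<le> \<zeta>' y + 1" for y
      using le by (auto simp: le_fun_def intro: order_trans[of _ "\<zeta>' y"])
    ultimately have "\<zeta> \<le> move i (i + snd m) \<zeta>'"
      using le m by (auto simp: move_def Let_def le_fun_def)
    with 2 show ?thesis by (simp add: ring_effect_def)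
  next
    case 3
    with rates le show ?thesis by (auto simp: ring_effect_def)
  qed
qed

lemma ring_effect_infinite: "\<zeta> y = \<infinity> \<Longrightarrow> ring_effect g \<alpha> i m \<zeta> y = \<infinity>"
  by (auto simp: ring_effect_def move_def Let_def)

context majorised_window
begin

text \<open>Induction on the number of rings. Up to the first ring nothing changes in \<open>\<Lambda>\<close>, and \<open>\<zeta>\<close> is
infinite elsewhere, so \<open>\<zeta>\<close> still dominates the left limit at that time; the ring preserves the
order by \<open>ring_effect_mono\<close>. The rest of the path is the path for the data seen from there.\<close>

theorem majorant_dominates:
  assumes "mono h" "regular_data {a..b} d" "window_path g \<alpha> {a..b} \<Lambda> d \<xi>" "0 \<le> t"
    and "\<xi> 0 \<le> \<zeta>" "\<And>y. y \<notin> \<Lambda> \<Longrightarrow> \<zeta> y = \<infinity>"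
  shows "h (\<xi> t) \<le> majorant n t \<zeta> d"
  using assms(2-)
proof (induction n arbitrary: d \<xi> t \<zeta>)
  case 0
  show ?case using h_bound[of "\<xi> t"] by simp
next
  case (Suc n)
  let ?I = "{a..b}"
  note reg = Suc.prems(1) and path = Suc.prems(2) and t = Suc.prems(3) and init = Suc.prems(4)
      and inf = Suc.prems(5)
  have pos: "0 < fst (d (i, m))" if "i \<in> ?I" for i m using reg that by (auto simp: regular_data_def)
  have late: "fst (d (i, 0)) \<le> event_time d i m" if "i \<in> ?I" for i m
    by (rule event_time_ge_first) (rule pos[OF that])
  have still: "\<xi> r y = \<xi> 0 y" if "y \<in> \<Lambda>" "0 \<le> r" "\<And>i. i \<in> ?I \<Longrightarrow> r < fst (d (i, 0))" for r y
  proof -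
    have "\<not> event_time d i m \<le> r" if "i \<in> ?I" for i m
      using late[OF that, of m] \<open>\<And>i. i \<in> ?I \<Longrightarrow> r < fst (d (i, 0))\<close>[OF that] by linarith
    with path that(1,2) show ?thesis unfolding window_path_def by blast
  qed
  show ?case
  proof (cases "\<forall>i\<in>?I. t < fst (d (i, 0))")
    case True
    have "\<xi> t y \<le> \<zeta> y" for y
    proof (cases "y \<in> \<Lambda>")
      case y: True
      have "\<xi> t y = \<xi> 0 y" using y t True by (intro still) auto
      then show ?thesis using init by (simp add: le_fun_def)
    qed (simp add: inf)
    then have "h (\<xi> t) \<le> h \<zeta>" by (intro monoD[OF \<open>mono h\<close>] le_funI)
    moreover have "majorant (Suc n) t \<zeta> d = h \<zeta>"
      using True by (auto intro!: sum.neutral)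
    ultimately show ?thesis by simp
  next
    case False
    have "\<exists>i\<in>?I. \<forall>j\<in>?I. fst (d (i, 0)) \<le> fst (d (j, 0))"
    proof -
      have ne: "finite ((\<lambda>i. fst (d (i, 0))) ` ?I)" "(\<lambda>i. fst (d (i, 0))) ` ?I \<noteq> {}" using ab by auto
      from Min_in[OF this] obtain i where "i \<in> ?I" "Min ((\<lambda>i. fst (d (i, 0))) ` ?I)
          = fst (d (i, 0))" by auto
      with ne show ?thesis by (metis Min_le imageI)
    qed
    then obtain i where i: "i \<in> ?I" "d \<in> fires_first ?I i" by (auto simp: fires_first_def)
    define s where "s = fst (d (i, 0))"
    have s: "0 < s" "s \<le> t"
      using pos[OF i(1)] False i(2) by (auto simp: s_def fires_first_def not_less intro: order_trans)
    have min: "s \<le> fst (d (j, 0))" if "j \<in> ?I" for j using i(2) that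
        by (auto simp: fires_first_def s_def)
    have unique: "d \<notin> fires_first ?I j" if "j \<in> ?I" "j \<noteq> i" for j
    proof
      assume "d \<in> fires_first ?I j"
      with min[OF that(1)] i(1) have "event_time d j 0 = event_time d i 0"
          by (auto simp: fires_first_def s_def intro: antisym)
      with regular_data_no_ties[OF reg that(1) i(1) that(2)] show False by blast
    qed
    have "majorant (Suc n) t \<zeta> d = (\<Sum>j\<in>?I. if d \<in> fires_first ?I j \<and> fst (d (j, 0)) \<le> t
        then majorant n (t - fst (d (j, 0))) (ring_effect g \<alpha> j (snd (d (j, 0))) \<zeta>)
            (after_ring ?I j d) else 0)"
      unfolding majorant.simps if_not_P[OF False] by simp
    \<comment> \<open>absence of ties leaves a single term in the sum defining the majorant\<close>
    also have "\<dots> = (\<Sum>j\<in>?I. if j = i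
        then majorant n (t - s) (ring_effect g \<alpha> i (snd (d (i, 0))) \<zeta>) (after_ring ?I i d) else 0)"
      using i(2) s(2) unique by (intro sum.cong refl) (auto simp: s_def)
    finally have maj: "majorant (Suc n) t \<zeta> d
        = majorant n (t - s) (ring_effect g \<alpha> i (snd (d (i, 0))) \<zeta>) (after_ring ?I i d)"
      using i(1) by simp
    obtain \<zeta>' where before: "state_before \<xi> s \<zeta>'" and at_s: "\<xi> s = ring_effect g \<alpha> i (snd (d (i, 0))) \<zeta>'"
      using path i(1) unfolding window_path_def s_def by (metis event_time_0)
    have "\<zeta>' y \<le> \<zeta> y" for y
    proof (cases "y \<in> \<Lambda>")
      case True
      have "\<forall>\<^sub>F r in at_left s. \<xi> r y = \<zeta>' y" using before by (simp add: state_before_def)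
      moreover have "\<forall>\<^sub>F r in at_left s. 0 < r \<and> r < s"
        using s(1) unfolding eventually_at_left_field by blast
      ultimately have "\<forall>\<^sub>F r in at_left s. \<xi> r y = \<zeta>' y \<and> 0 < r \<and> r < s" by eventually_elim simp
      then obtain r where r: "\<xi> r y = \<zeta>' y" "0 < r" "r < s"
        using eventually_happens'[OF trivial_limit_at_left_real[of s]] by blast
      have "\<xi> r y = \<xi> 0 y" using True r min by (intro still) (auto intro: less_le_trans)
      then show ?thesis using r(1) init by (metis le_funD)
    qed (simp add: inf)
    moreover have mark_i: "snd (snd (d (i, 0))) \<in> {1, - 1}" using reg i(1)
        unfolding regular_data_def by blast
    ultimately have "\<xi> s \<le> ring_effect g \<alpha> i (snd (d (i, 0))) \<zeta>"
      unfolding at_s using \<alpha>(1)[of i] mark_i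
      by (intro ring_effect_mono g) (auto simp: le_fun_def)
    then have "h (\<xi> (t - s + s))
        \<le> majorant n (t - s) (ring_effect g \<alpha> i (snd (d (i, 0))) \<zeta>) (after_ring ?I i d)"
      using s window_path_after_ring[OF path, of i] pos[OF i(1)]
      by (intro Suc.IH regular_after_ring[OF reg i])
        (auto simp: s_def less_imp_le intro: ring_effect_infinite inf)
    then show ?thesis unfolding maj by simp
  qed
qed

lemma harris_path_window_path:
  assumes path: "harris_path g \<alpha> w u z \<eta>\<^sub>0 \<xi>" and z: "\<And>x n. z x n \<in> {1, - 1}"
  shows "window_path g \<alpha> {a..b} \<Lambda> (\<lambda>(x, n). (w x n, u x n, z x n)) \<xi>"
proof -
  let ?d = "\<lambda>(x, n). (w x n, u x n, z x n)"
  have time: "event_time ?d = ring_time w" by (simp add: event_time_def)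
  have rings: "\<forall>x n. \<exists>\<zeta>. state_before \<xi> (ring_time w x n) \<zeta> \<and>
        \<xi> (ring_time w x n) = (if u x n \<le> \<alpha> x * rate_ext g (\<zeta> x) then move x (x + z x n) \<zeta> else \<zeta>)"
    and rest: "\<forall>y s t. 0 \<le> s \<longrightarrow> s \<le> t \<longrightarrow>
        (\<forall>x n. s < ring_time w x n \<longrightarrow> ring_time w x n \<le> t \<longrightarrow> x \<noteq> y \<and> x + z x n \<noteq> y) \<longrightarrow> \<xi> t y = \<xi> s y"
    using path unfolding harris_path_def by blast+
  show ?thesis
    unfolding window_path_def time
  proof (intro conjI ballI allI impI)
    fix i n
    show "\<exists>\<zeta>. state_before \<xi> (ring_time w i n) \<zeta> \<and> \<xi> (ring_time w i n)
        = ring_effect g \<alpha> i (snd (?d (i, n))) \<zeta>"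
      using rings[rule_format, of i n] by (simp only: ring_effect_def prod.case fst_conv snd_conv)
  next
    fix y s t assume y: "y \<in> \<Lambda>" and st: "(0::real) \<le> s" "s \<le> t"
    assume quiet: "\<forall>i\<in>{a..b}. \<forall>n. s < ring_time w i n \<longrightarrow> ring_time w i n \<le> t \<longrightarrow> i \<noteq> y \<and> i
        + snd (snd (?d (i, n))) \<noteq> y"
    have "x \<noteq> y \<and> x + z x n \<noteq> y" if "s < ring_time w x n" "ring_time w x n \<le> t" for x n
    proof (cases "x \<in> {a..b}")
      case True
      with quiet that show ?thesis by auto
    next
      case False
      moreover have "a < y" "y < b" using y \<Lambda> by auto
      ultimately show ?thesis using z[of x n] by auto
    qed
    with rest st show "\<xi> t y = \<xi> s y" by blast
  qed
qed

end

text \<open>The first waiting time at \<open>i\<close> enters only one of the two times, is independent of all the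
other waiting times and has no atoms.\<close>

lemma AE_event_times_differ:
  assumes ij: "i \<noteq> j"
  shows "AE d in data_law K. event_time d i n \<noteq> event_time d j m"
proof -
  interpret D: prob_space "data_law K" by (rule prob_space_data_law)
  interpret R: prob_space "ring_law K" by (rule prob_space_ring_law)
  interpret P: pair_prob_space "ring_law K" "data_law K" ..
  have time_meas: "(\<lambda>d. event_time d x l) \<in> borel_measurable (data_law K)" for x l
    unfolding event_time_def ring_time_def by (intro borel_measurable_sum measurable_wait_component)
  have S: "{d \<in> space (data_law K). event_time d i n \<noteq> event_time d j m} \<in> sets (data_law K)"
    by (rule borel_measurable_neq[OF time_meas time_meas])
  define c where "c d = event_time d j m - (\<Sum>l<n. fst (d (i, l)))" for d
  have c_meas [measurable]: "c \<in> borel_measurable (data_law K)"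
    unfolding c_def[abs_def] by (intro borel_measurable_diff borel_measurable_sum time_meas
        measurable_wait_component)
  have "event_time (prepend_ring i v d) i n = fst v + (\<Sum>l<n. fst (d (i, l)))" for v d
    unfolding event_time_def ring_time_def lessThan_Suc_atMost[symmetric]
    by (subst sum.lessThan_Suc_shift) (simp add: prepend_ring_def)
  moreover have "event_time (prepend_ring i v d) j m = event_time d j m" for v d
    using ij by (simp add: event_time_def ring_time_def prepend_ring_def)
  ultimately have iff: "event_time (prepend_ring i v d) i n \<noteq> event_time (prepend_ring i v d) j m
      \<longleftrightarrow> fst v \<noteq> c d" for v d
    by (auto simp: c_def)
  have set: "{x \<in> space (ring_law K \<Otimes>\<^sub>M data_law K). fst (fst x) \<noteq> c (snd x)}
      \<in> sets (ring_law K \<Otimes>\<^sub>M data_law K)"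
    by (rule borel_measurable_neq) measurable
  have "AE d in data_law K. AE v in ring_law K. fst v \<noteq> c d"
    by (intro AE_I2 AE_ring_law_fst AE_wait_law_neq)
  then have "AE v in ring_law K. AE d in data_law K. fst v \<noteq> c d"
    by (subst P.AE_commute) (use set in auto)
  then have "AE x in ring_law K \<Otimes>\<^sub>M data_law K. fst (fst x) \<noteq> c (snd x)"
    by (intro P.AE_pair_measure set) simp
  then have "AE d in distr (ring_law K
      \<Otimes>\<^sub>M data_law K) (data_law K) (\<lambda>(v, d). prepend_ring i v d). event_time d i n \<noteq> event_time d j m"
    by (subst AE_distr_iff[OF measurable_prepend_ring S]) (simp add: split_beta' iff)
  then show ?thesis by (simp only: distr_prepend_ring)
qed

lemma AE_regular_data:
  assumes K: "set_pmf K \<subseteq> {1, - 1}"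
  shows "AE d in data_law K. regular_data I d"
proof -
  have wait: "AE d in data_law K. \<forall>y. 0 < fst (d y)"
    by (intro AE_data_law_all AE_ring_law_fst AE_wait_law_pos)
  have U0: "AE u in uniform_measure lborel {0<..<1::real}. 0 < u"
    by (rule AE_uniform_measureI) auto
  have U: "AE m in mark_law K. 0 < fst m"
    unfolding mark_law_def
  proof (rule AE_distrD[where M' = "uniform_measure lborel {0<..<1::real}"])
    show "AE u in distr (uniform_measure lborel {0<..<1::real}
        \<Otimes>\<^sub>M measure_pmf K) (uniform_measure lborel {0<..<1}) fst. 0 < u"
      unfolding prob_space.distr_pair_fst[OF prob_space_measure_pmf] by (rule U0)
  qed (rule measurable_fst)
  have Z: "AE m in mark_law K. snd m \<in> {1, - 1}"
  proof -
    have "- {1, - 1} \<in> null_sets (measure_pmf K)"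
      using K by (auto simp: null_sets_def measure_pmf.emeasure_eq_measure measure_pmf_zero_iff)
    then have "UNIV \<times> (- {1, - 1}) \<in> null_sets (mark_law K)"
      unfolding mark_law_def using sets.top[of "uniform_measure lborel {0<..<1::real}"]
          by (intro measure_pmf.times_in_null_sets2) auto
    then show ?thesis by (rule AE_I') auto
  qed
  have marks: "AE d in data_law K. \<forall>y. 0 < fst (snd (d y))" "AE d in data_law K. \<forall>y. snd (snd (d y))
      \<in> {1, - 1}"
    using AE_data_law_all[OF AE_ring_law_snd[OF U]] AE_data_law_all[OF AE_ring_law_snd[OF Z]] by auto
  have "AE d in data_law K. \<forall>q. fst q \<noteq> fst (snd q) \<longrightarrow> event_time d (fst q) (fst (snd (snd q)))
      \<noteq> event_time d (fst (snd q)) (snd (snd (snd q)))"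
    by (subst AE_all_countable) (auto intro: AE_event_times_differ)
  with wait marks show ?thesis
  proof eventually_elim
    case (elim d)
    then show ?case unfolding regular_data_def by fastforce
  qed
qed

section \<open>Long times and large windows\<close>

lemma measurable_data_map:
  assumes "harris_system M K W U Z"
  shows "(\<lambda>\<omega> (x, n). (W x n \<omega>, U x n \<omega>, Z x n \<omega>)) \<in> M \<rightarrow>\<^sub>M data_law K"
    and "distr M (data_law K) (\<lambda>\<omega> (x, n). (W x n \<omega>, U x n \<omega>, Z x n \<omega>)) = data_law K"
proof -
  interpret harris_system M K W U Z by fact
  let ?X = "\<lambda>(x, n) \<omega>. (W x n \<omega>, U x n \<omega>, Z x n \<omega>)"
  have rv: "random_variable (ring_law K) (?X y)" for y
    using indep unfolding indep_vars_def by blast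
  have map_eq: "(\<lambda>\<omega> (x, n). (W x n \<omega>, U x n \<omega>, Z x n \<omega>)) = (\<lambda>\<omega>. \<lambda>y\<in>UNIV. ?X y \<omega>)"
    by (auto simp: fun_eq_iff)
  show "(\<lambda>\<omega> (x, n). (W x n \<omega>, U x n \<omega>, Z x n \<omega>)) \<in> M \<rightarrow>\<^sub>M data_law K"
    unfolding map_eq by (rule measurable_data_lawI) (use rv in simp)
  have "distr M (PiM UNIV (\<lambda>_. ring_law K)) (\<lambda>\<omega>. \<lambda>y\<in>UNIV. ?X y \<omega>)
      = PiM UNIV (\<lambda>y. distr M (ring_law K) (?X y))"
    using indep by (subst (asm) indep_vars_iff_distr_eq_PiM') (use rv in auto)
  also have "\<dots> = data_law K"
    unfolding data_law_def by (intro PiM_cong) (auto simp: law)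
  finally show "distr M (data_law K) (\<lambda>\<omega> (x, n). (W x n \<omega>, U x n \<omega>, Z x n \<omega>)) = data_law K"
    unfolding map_eq data_law_def .
qed

lemma poisson_weight_tendsto_0:
  assumes "0 < k"
  shows "((\<lambda>t. poisson_weight (k * t) m) \<longlongrightarrow> 0) at_top"
proof -
  have "filterlim (\<lambda>t. k * t) at_top at_top"
    using assms by (intro filterlim_tendsto_pos_mult_at_top[OF tendsto_const _ filterlim_ident])
  from filterlim_compose[OF tendsto_power_div_exp_0 this, of m]
  have "((\<lambda>t. (k * t) ^ m / exp (k * t) / fact m) \<longlongrightarrow> 0 / fact m) at_top"
    by (intro tendsto_divide tendsto_const) auto
  then show ?thesis by (simp add: poisson_weight_def exp_minus field_simps)
qed

context majorised_window
begin

lemma excess_nonpos: "excess m \<zeta> \<le> 0"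
  using abs_kernel_op_power_le[of h B m \<kappa> \<zeta>, OF h_bound] by (simp add: excess_def)

text \<open>The clocks of a Harris system have the law \<open>data_law\<close> and almost all their realisations are
regular, so the pathwise bound may be integrated. The comparison starts from the initial state
raised to \<open>\<infinity>\<close> off \<open>\<Lambda>\<close>.\<close>

lemma expectation_le_poisson_mixture:
  assumes harris: "harris_system M K W U Z"
    and zrp: "zero_range_process M g \<alpha> W U Z (\<lambda>x. enat (\<eta>\<^sub>0 x)) \<eta>"
    and h: "mono h" "h \<in> borel_measurable config_space" and t: "0 \<le> t"
  shows "(\<integral>\<omega>. h (\<eta> t \<omega>) \<partial>M) \<le>
    B + (\<Sum>m<n. poisson_weight (total_rate * t) m * excess m (\<lambda>x. if x \<in> \<Lambda> then enat (\<eta>\<^sub>0 x) else \<infinity>))"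
proof -
  interpret harris_system M K W U Z by fact
  let ?\<zeta> = "\<lambda>x. if x \<in> \<Lambda> then enat (\<eta>\<^sub>0 x) else \<infinity>"
  define D where "D \<omega> = (\<lambda>(x, n). (W x n \<omega>, U x n \<omega>, Z x n \<omega>))" for \<omega>
  note D = measurable_data_map[OF harris, folded D_def]
  have \<eta>_meas: "\<eta> t \<in> M \<rightarrow>\<^sub>M config_space"
    and paths: "AE \<omega> in M. harris_path g \<alpha> (\<lambda>x n. W x n \<omega>) (\<lambda>x n. U x n \<omega>) (\<lambda>x n. Z x n \<omega>)
        (\<lambda>x. enat (\<eta>\<^sub>0 x)) (\<lambda>t. \<eta> t \<omega>)"
    using zrp t unfolding zero_range_process_def by auto
  have "AE \<omega> in M. regular_data UNIV (D \<omega>)"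
    using AE_regular_data[OF set_K, of UNIV] by (intro AE_distrD[OF D(1)]) (simp only: D(2))
  with paths have le: "AE \<omega> in M. h (\<eta> t \<omega>) \<le> majorant n t ?\<zeta> (D \<omega>)"
  proof eventually_elim
    case (elim \<omega>)
    have reg: "regular_data {a..b} (D \<omega>)" using elim(2) by (auto simp: regular_data_def)
    have z: "Z x m \<omega> \<in> {1, - 1}" for x m
      using elim(2) by (auto simp: regular_data_def D_def)
    have "window_path g \<alpha> {a..b} \<Lambda> (D \<omega>) (\<lambda>t. \<eta> t \<omega>)"
      unfolding D_def by (rule harris_path_window_path[OF elim(1)]) (rule z)
    moreover have "\<eta> 0 \<omega> \<le> ?\<zeta>" using elim(1) by (auto simp: harris_path_def le_fun_def)
    ultimately show ?case by (intro majorant_dominates[OF h(1) reg _ t]) auto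
  qed
  obtain C where C: "\<And>d. \<bar>majorant n t ?\<zeta> d\<bar> \<le> C" using majorant_bounded by blast
  have "(\<integral>\<omega>. h (\<eta> t \<omega>) \<partial>M) \<le> (\<integral>\<omega>. majorant n t ?\<zeta> (D \<omega>) \<partial>M)"
  proof (rule integral_mono_AE[OF _ _ le])
    show "integrable M (\<lambda>\<omega>. h (\<eta> t \<omega>))"
      by (rule integrable_const_bound[where B = B]) (auto simp: h_bound intro:
          measurable_compose[OF \<eta>_meas h(2)])
    show "integrable M (\<lambda>\<omega>. majorant n t ?\<zeta> (D \<omega>))"
      by (rule integrable_const_bound[where B = C]) (auto simp: C intro:
          measurable_compose[OF D(1) measurable_majorant_fixed_time])
  qed
  also have "\<dots> = (\<integral>d. majorant n t ?\<zeta> d \<partial>distr M (data_law K) D)"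
    by (rule integral_distr[OF D(1) measurable_majorant_fixed_time, symmetric])
  also have "\<dots> = B + (\<Sum>m<n. poisson_weight (total_rate * t) m * excess m ?\<zeta>)"
    unfolding D(2) by (rule integral_majorant[OF t])
  finally show ?thesis .
qed

text \<open>All terms of the Poisson mixture are nonpositive, so the first \<open>N\<close> of them can be dropped; in
the others the powers of the kernel are close to the equilibrium expectation. For large \<open>t\<close>
the dropped terms carry no mass.\<close>

theorem limsup_le_equilibrium:
  assumes harris: "harris_system M K W U Z"
    and zrp: "zero_range_process M g \<alpha> W U Z (\<lambda>x. enat (\<eta>\<^sub>0 x)) \<eta>"
    and h: "mono h" "h \<in> borel_measurable config_space" and \<phi>_pos: "\<And>x. x \<in> \<Lambda> \<Longrightarrow> 0 < \<phi> x"
  shows "Limsup at_top (\<lambda>t. ereal (\<integral>\<omega>. h (\<eta> t \<omega>) \<partial>M)) \<le> ereal (measure_pmf.expectation \<mu> h)"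
proof (rule ereal_le_epsilon2)
  fix e :: real assume e: "0 < e"
  define L where "L = measure_pmf.expectation \<mu> h"
  define \<zeta> where "\<zeta> x = (if x \<in> \<Lambda> then enat (\<eta>\<^sub>0 x) else \<infinity>)" for x
  have "\<zeta> \<in> set_pmf \<mu>" by (rule finite_state_in_set_\<mu>) (auto simp: \<zeta>_def \<phi>_pos)
  from window_chain_converges[OF h_bound this]
  have "(\<lambda>m. (kernel_op \<kappa> ^^ m) h \<zeta>) \<longlonglongrightarrow> L" by (simp add: L_def)
  then have "\<forall>\<^sub>F m in sequentially. (kernel_op \<kappa> ^^ m) h \<zeta> < L + e"
    using e by (intro order_tendstoD) auto
  then obtain N where N: "\<And>m. N \<le> m \<Longrightarrow> (kernel_op \<kappa> ^^ m) h \<zeta> < L + e"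
    by (auto simp: eventually_sequentially)
  have bound: "(\<integral>\<omega>. h (\<eta> t \<omega>) \<partial>M) \<le> B + (L + e - B)
      * (1 - (\<Sum>m<N. poisson_weight (total_rate * t) m))" if t: "0 \<le> t" for t
  proof -
    let ?w = "poisson_weight (total_rate * t)"
    have w: "0 \<le> ?w m" for m using t by (intro poisson_weight_nonneg) simp
    have "(\<integral>\<omega>. h (\<eta> t \<omega>) \<partial>M) \<le> B + (L + e - B) * ((\<Sum>m<n. ?w m) - (\<Sum>m<N. ?w m))" if n: "N \<le> n" for n
    proof -
      have split: "(\<Sum>m<n. f m) = (\<Sum>m<N. f m) + (\<Sum>m\<in>{N..<n}. f m)" for f :: "nat \<Rightarrow> real"
        using sum.atLeastLessThan_concat[of 0 N n f] n by (simp add: atLeast0LessThan)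
      have "(\<integral>\<omega>. h (\<eta> t \<omega>) \<partial>M) \<le> B + (\<Sum>m<n. ?w m * excess m \<zeta>)"
        unfolding \<zeta>_def[abs_def] by (rule expectation_le_poisson_mixture[OF harris zrp h t])
      also have "(\<Sum>m<n. ?w m * excess m \<zeta>) \<le> 0 + (\<Sum>m\<in>{N..<n}. ?w m * (L + e - B))"
        unfolding split
      proof (intro add_mono sum_mono sum_nonpos mult_left_mono w)
        show "?w m * excess m \<zeta> \<le> 0" for m using w excess_nonpos by (rule mult_nonneg_nonpos)
        show "m \<in> {N..<n} \<Longrightarrow> excess m \<zeta> \<le> L + e - B" for m
          using N[of m] by (simp add: excess_def)
      qed
      also have "0 + (\<Sum>m\<in>{N..<n}. ?w m * (L + e - B)) = (L + e - B) * ((\<Sum>m<n. ?w m) - (\<Sum>m<N. ?w m))"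
        unfolding split[of ?w] by (simp add: sum_distrib_left mult.commute)
      finally show ?thesis by simp
    qed
    moreover have "(\<lambda>n. B + (L + e - B) * ((\<Sum>m<n. ?w m) - (\<Sum>m<N. ?w m))) \<longlonglongrightarrow> B + (L + e - B)
        * (1 - (\<Sum>m<N. ?w m))"
      using poisson_weight_sums[of "total_rate * t"] unfolding sums_def by (intro tendsto_intros)
    ultimately show ?thesis by (intro LIMSEQ_le_const) auto
  qed
  have "((\<lambda>t. B + (L + e - B) * (1 - (\<Sum>m<N. poisson_weight (total_rate * t) m))) \<longlongrightarrow> B + (L + e - B)
      * (1 - (\<Sum>m<N. 0))) at_top"
    by (intro tendsto_intros poisson_weight_tendsto_0 total_rate_pos)
  then have lim: "((\<lambda>t. B + (L + e - B) * (1 - (\<Sum>m<N. poisson_weight (total_rate * t) m))) \<longlongrightarrow> L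
      + e) at_top" by simp
  have "Limsup at_top (\<lambda>t. ereal (\<integral>\<omega>. h (\<eta> t \<omega>) \<partial>M)) \<le>
      Limsup at_top (\<lambda>t. ereal (B + (L + e - B) * (1 - (\<Sum>m<N. poisson_weight (total_rate * t) m))))"
    using bound by (intro Limsup_mono) (auto simp: eventually_at_top_linorder)
  also have "\<dots> = ereal (L + e)"
    using lim by (intro lim_imp_Limsup) auto
  finally show "Limsup at_top (\<lambda>t. ereal (\<integral>\<omega>. h (\<eta> t \<omega>) \<partial>M)) \<le> ereal (measure_pmf.expectation \<mu> h)
      + ereal e"
    by (simp add: L_def)
qed

end

text \<open>Pointwise convergence of probability mass functions implies convergence in \<open>L\<^sup>1\<close> by Scheffe's
lemma, as the limit has the same total mass.\<close>

lemma expectation_pmf_tendsto: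
  fixes q :: "nat \<Rightarrow> 'a pmf" and f :: "'a \<Rightarrow> real"
  assumes lim: "\<And>x. (\<lambda>j. pmf (q j) x) \<longlonglongrightarrow> pmf r x" and f: "\<And>x. \<bar>f x\<bar> \<le> B"
  shows "(\<lambda>j. measure_pmf.expectation (q j) f) \<longlonglongrightarrow> measure_pmf.expectation r f"
proof -
  let ?C = "count_space (UNIV :: 'a set)"
  have int: "integrable ?C (pmf p)" for p :: "'a pmf" by (rule integrable_pmf)
  have mass: "(\<integral>\<^sup>+ x. ennreal (pmf p x) \<partial>?C) = 1" for p :: "'a pmf"
    by (simp add: nn_integral_pmf_eq_1)
  have L1: "(\<lambda>j. \<integral>\<^sup>+ x. norm (pmf (q j) x - pmf r x) \<partial>?C) \<longlonglongrightarrow> 0"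
    by (rule Scheffe_lemma2) (use lim int in \<open>auto simp: mass\<close>)
  define T where "T j = (\<integral>x. \<bar>pmf (q j) x - pmf r x\<bar> \<partial>?C)" for j
  have intd: "integrable ?C (\<lambda>x. \<bar>pmf (q j) x - pmf r x\<bar>)" for j
    by (intro integrable_abs Bochner_Integration.integrable_diff int)
  have "(\<lambda>j. ennreal (T j)) \<longlonglongrightarrow> ennreal 0"
    using L1 intd by (simp add: T_def nn_integral_eq_integral)
  then have "T \<longlonglongrightarrow> 0"
    by (subst (asm) tendsto_ennreal_iff) (auto simp: T_def intro!: always_eventually integral_nonneg_AE)
  then have T0: "(\<lambda>j. B * T j) \<longlonglongrightarrow> 0" using tendsto_mult_left[of T 0 sequentially B] by simp
  have B0: "0 \<le> B" using order_trans[OF abs_ge_zero f] .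
  have "norm (measure_pmf.expectation (q j) f - measure_pmf.expectation r f) \<le> B * T j" for j
  proof -
    have e: "measure_pmf.expectation p f = (\<integral>x. pmf p x * f x \<partial>?C)" for p
      by (simp add: measure_pmf_eq_density integral_real_density)
    have intf: "integrable ?C (\<lambda>x. pmf p x * f x)" for p
    proof -
      have "integrable (measure_pmf p) f" by (rule integrable_pmf_bounded) (rule f)
      then show ?thesis by (simp add: measure_pmf_eq_density integrable_real_density)
    qed
    have "measure_pmf.expectation (q j) f - measure_pmf.expectation r f
        = (\<integral>x. (pmf (q j) x - pmf r x) * f x \<partial>?C)"
      unfolding e left_diff_distrib by (rule Bochner_Integration.integral_diff[OF intf intf, symmetric])
    also have "norm \<dots> \<le> (\<integral>x. \<bar>pmf (q j) x - pmf r x\<bar> * B \<partial>?C)"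
    proof (rule order_trans[OF integral_norm_bound integral_mono])
      show "integrable ?C (\<lambda>x. norm ((pmf (q j) x - pmf r x) * f x))"
        unfolding left_diff_distrib by (intro integrable_norm Bochner_Integration.integrable_diff intf)
      show "integrable ?C (\<lambda>x. \<bar>pmf (q j) x - pmf r x\<bar> * B)" using intd by simp
      show "norm ((pmf (q j) x - pmf r x) * f x) \<le> \<bar>pmf (q j) x - pmf r x\<bar> * B" for x
        using f by (simp add: abs_mult mult_left_mono)
    qed
    finally show ?thesis by (simp add: T_def mult.commute)
  qed
  then have "(\<lambda>j. measure_pmf.expectation (q j) f - measure_pmf.expectation r f) \<longlonglongrightarrow> 0"
    by (intro Lim_null_comparison[OF _ T0]) (auto intro!: always_eventually)
  then show ?thesis by (rule LIM_zero_cancel)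
qed

lemma partition_fun_isCont:
  assumes g: "rate_function g" and l: "0 \<le> l" "l < 1"
  shows "isCont (partition_fun g) l"
proof -
  obtain m where m: "l < m" "m < 1" using l dense by blast
  have "summable (\<lambda>n. inverse (g_fact g n) * m ^ n)"
    using summable_partition[OF g, of m] l m by (simp add: divide_inverse mult.commute)
  then have "isCont (\<lambda>l. \<Sum>n. inverse (g_fact g n) * l ^ n) l"
    by (rule isCont_powser) (use l m in auto)
  then show ?thesis by (simp add: partition_fun_def[abs_def] divide_inverse mult.commute)
qed

lemma pmf_theta_pmf_tendsto:
  assumes g: "rate_function g" and l: "0 \<le> l" "l < 1" and lim: "x \<longlonglongrightarrow> l" and nonneg: "\<And>j. 0 \<le> x j"
  shows "(\<lambda>j. pmf (theta_pmf g (x j)) n) \<longlonglongrightarrow> pmf (theta_pmf g l) n"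
proof -
  have "(\<lambda>j. partition_fun g (x j)) \<longlonglongrightarrow> partition_fun g l"
    by (rule isCont_tendsto_compose[OF partition_fun_isCont[OF g l] lim])
  then have "(\<lambda>j. inverse (partition_fun g (x j)) * x j ^ n / g_fact g n) \<longlonglongrightarrow>
      inverse (partition_fun g l) * l ^ n / g_fact g n"
    using partition_fun_ge_1[OF g l] g_fact_pos[OF g, of n] by (intro tendsto_intros lim) auto
  moreover have "\<forall>\<^sub>F j in sequentially. x j < 1" using lim l by (intro order_tendstoD)
  then have "\<forall>\<^sub>F j in sequentially. inverse (partition_fun g (x j)) * x j ^ n / g_fact g n
      = pmf (theta_pmf g (x j)) n"
    by eventually_elim (simp add: pmf_theta_pmf[OF g nonneg])
  ultimately show ?thesis
    unfolding pmf_theta_pmf[OF g l] by (rule Lim_transform_eventually)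
qed

lemma expectation_equilibrium_tendsto:
  fixes f :: "config \<Rightarrow> real"
  assumes g: "rate_function g" and A: "finite A" and f: "\<And>\<eta>. \<bar>f \<eta>\<bar> \<le> B"
    and \<alpha>: "\<And>x. x \<in> A \<Longrightarrow> 0 < \<alpha> x" and \<phi>: "\<And>x. x \<in> A \<Longrightarrow> 0 \<le> \<phi> x" "\<And>x. x \<in> A \<Longrightarrow> \<phi> x < \<alpha> x"
    and \<psi>: "\<And>j x. x \<in> A \<Longrightarrow> 0 \<le> \<psi> j x" and lim: "\<And>x. x \<in> A \<Longrightarrow> (\<lambda>j. \<psi> j x) \<longlonglongrightarrow> \<phi> x"
  shows "(\<lambda>j. measure_pmf.expectation (equilibrium g \<alpha> (\<psi> j) A) f)
      \<longlonglongrightarrow> measure_pmf.expectation (equilibrium g \<alpha> \<phi> A) f"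
proof (rule expectation_pmf_tendsto[OF _ f])
  fix \<eta> :: config
  have site: "(\<lambda>j. pmf (map_pmf enat (theta_pmf g (\<psi> j x / \<alpha> x))) (\<eta> x))
      \<longlonglongrightarrow> pmf (map_pmf enat (theta_pmf g (\<phi> x / \<alpha> x))) (\<eta> x)"
    if x: "x \<in> A" for x
  proof (cases "\<eta> x")
    case (enat n)
    have "(\<lambda>j. \<psi> j x / \<alpha> x) \<longlonglongrightarrow> \<phi> x / \<alpha> x"
      using \<alpha>[OF x] by (intro tendsto_divide lim x tendsto_const) auto
    then have "(\<lambda>j. pmf (theta_pmf g (\<psi> j x / \<alpha> x)) n) \<longlonglongrightarrow> pmf (theta_pmf g (\<phi> x / \<alpha> x)) n"
      using \<alpha>[OF x] \<phi>[OF x] \<psi>[OF x] by (intro pmf_theta_pmf_tendsto[OF g]) auto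
    moreover have "inj enat" by (simp add: inj_on_def)
    ultimately show ?thesis by (simp add: enat pmf_map_inj')
  next
    case infinity
    have "\<infinity> \<notin> set_pmf (map_pmf enat q)" for q by auto
    then have "pmf (map_pmf enat q) \<infinity> = 0" for q by (simp add: pmf_eq_0_set_pmf)
    then show ?thesis by (simp add: infinity)
  qed
  show "(\<lambda>j. pmf (equilibrium g \<alpha> (\<psi> j) A) \<eta>) \<longlonglongrightarrow> pmf (equilibrium g \<alpha> \<phi> A) \<eta>"
  proof (cases "\<forall>x. x \<notin> A \<longrightarrow> \<eta> x = \<infinity>")
    case True
    then show ?thesis unfolding equilibrium_def pmf_Pi[OF A] by (simp add: tendsto_prod site)
  next
    case False
    show ?thesis unfolding equilibrium_def pmf_Pi[OF A] if_not_P[OF False] by simp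
  qed
qed

definition determined_by :: "int set \<Rightarrow> (config \<Rightarrow> real) \<Rightarrow> bool" where
  "determined_by A h \<longleftrightarrow> (\<forall>\<eta> \<zeta>. (\<forall>x\<in>A. \<eta> x = \<zeta> x) \<longrightarrow> h \<eta> = h \<zeta>)"

lemma determined_byD: "determined_by A h \<Longrightarrow> (\<And>x. x \<in> A \<Longrightarrow> \<eta> x = \<zeta> x) \<Longrightarrow> h \<eta> = h \<zeta>"
  unfolding determined_by_def by blast

text \<open>Only the marginal on \<open>A\<close> matters, and in that marginal neither \<open>\<Lambda>\<close> nor the values of \<open>\<phi>\<close> off
\<open>A\<close> are visible.\<close>

lemma expectation_equilibrium_subset:
  fixes f :: "config \<Rightarrow> real"
  assumes "finite \<Lambda>" "A \<subseteq> \<Lambda>" and f: "determined_by A f"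
  shows "measure_pmf.expectation (equilibrium g \<alpha> \<phi> \<Lambda>) f
      = measure_pmf.expectation (equilibrium g \<alpha> \<phi> A) f"
proof -
  have "f (\<lambda>x. if x \<in> A then \<eta> x else \<infinity>) = f \<eta>" for \<eta> by (rule determined_byD[OF f]) simp
  then show ?thesis
    unfolding equilibrium_def Pi_pmf_subset[OF assms(1,2)] by simp
qed

lemma local_fun_finite_measurable:
  fixes f :: "(int \<Rightarrow> enat) \<Rightarrow> real"
  assumes "finite A"
  shows "f \<in> borel_measurable (PiM A (\<lambda>_. count_space UNIV))"
  using assms by (subst count_space_PiM_finite) auto

lemma local_fun_measurable:
  fixes h :: "config \<Rightarrow> real"
  assumes A: "finite A" and h: "determined_by A h"
  shows "h \<in> borel_measurable config_space"
proof -
  have "(\<lambda>\<eta>. h (restrict \<eta> A)) \<in> borel_measurable config_space"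
    by (rule measurable_compose[OF measurable_restrict_subset local_fun_finite_measurable[OF A]]) simp
  moreover have "h (restrict \<eta> A) = h \<eta>" for \<eta> by (rule determined_byD[OF h]) simp
  ultimately show ?thesis by simp
qed

text \<open>Both measures have the same image under restriction to \<open>A\<close>, namely the product over \<open>A\<close>. On
finite products of countable sets every function is measurable, so the locality of \<open>h\<close> makes
it measurable.\<close>

lemma integral_PiM_pmf_local:
  fixes h :: "config \<Rightarrow> real" and P :: "int \<Rightarrow> enat pmf"
  assumes A: "finite A" "A \<noteq> {}" and h: "determined_by A h"
  shows "(\<integral>\<xi>. h \<xi> \<partial>PiM UNIV (\<lambda>x. measure_pmf (P x))) = measure_pmf.expectation (Pi_pmf A d P) h"
proof -
  interpret product_prob_space "\<lambda>x. measure_pmf (P x)" UNIV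
    by (simp add: product_prob_space_def product_sigma_finite_def prob_space_measure_pmf
        prob_space_imp_sigma_finite product_prob_space_axioms_def)
  have res: "h (restrict \<eta> A) = h \<eta>" for \<eta> by (rule determined_byD[OF h]) simp
  have sets: "sets (PiM A (\<lambda>x. measure_pmf (P x))) = sets (PiM A (\<lambda>_. count_space UNIV))"
    by (intro sets_PiM_cong) simp_all
  have hA: "h \<in> borel_measurable (PiM A (\<lambda>x. measure_pmf (P x)))"
    using local_fun_finite_measurable[OF A(1), of h] by (simp cong: measurable_cong_sets add:
        measurable_cong_sets[OF sets])
  have "(\<integral>\<xi>. h \<xi> \<partial>PiM UNIV (\<lambda>x. measure_pmf (P x)))
      = (\<integral>\<xi>. h (restrict \<xi> A) \<partial>PiM UNIV (\<lambda>x. measure_pmf (P x)))"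
    by (simp only: res)
  also have "\<dots> = (\<integral>\<xi>. h \<xi> \<partial>distr (PiM UNIV (\<lambda>x. measure_pmf (P x))) (PiM A (\<lambda>x. measure_pmf (P x)))
      (\<lambda>\<xi>. restrict \<xi> A))"
    by (rule integral_distr[OF measurable_restrict_subset hA, symmetric]) simp
  also have "distr (PiM UNIV (\<lambda>x. measure_pmf (P x))) (PiM A (\<lambda>x. measure_pmf (P x)))
      (\<lambda>\<xi>. restrict \<xi> A) = PiM A (\<lambda>x. measure_pmf (P x))"
    by (rule distr_PiM_restrict_finite) (use A in auto)
  also have "\<dots> = distr (measure_pmf (Pi_pmf A d P)) (PiM A (\<lambda>_. count_space UNIV)) (\<lambda>\<eta>. \<lambda>x\<in>A. \<eta> x)"
  proof -
    have "prob_space.indep_vars (measure_pmf (Pi_pmf A d P)) (\<lambda>_. count_space UNIV) (\<lambda>x \<eta>. \<eta> x) A"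
      by (rule indep_vars_Pi_pmf[OF A(1)])
    then have "distr (measure_pmf (Pi_pmf A d P)) (PiM A (\<lambda>_. count_space UNIV)) (\<lambda>\<eta>. \<lambda>x\<in>A. \<eta> x) =
        PiM A (\<lambda>x. distr (measure_pmf (Pi_pmf A d P)) (count_space UNIV) (\<lambda>\<eta>. \<eta> x))"
      by (subst (asm) prob_space.indep_vars_iff_distr_eq_PiM'[OF prob_space_measure_pmf A(2)]) auto
    also have "\<dots> = PiM A (\<lambda>x. measure_pmf (P x))"
      using A(1) by (intro PiM_cong refl) (simp add: map_pmf_rep_eq[symmetric] Pi_pmf_component)
    finally show ?thesis ..
  qed
  also have "(\<integral>\<xi>. h \<xi> \<partial>distr (measure_pmf (Pi_pmf A d P)) (PiM A (\<lambda>_. count_space UNIV))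
      (\<lambda>\<eta>. \<lambda>x\<in>A. \<eta> x)) =
      measure_pmf.expectation (Pi_pmf A d P) (\<lambda>\<eta>. h (restrict \<eta> A))"
    using A(1) by (intro integral_distr local_fun_finite_measurable) (auto simp: space_PiM)
  finally show ?thesis by (simp only: res)
qed

lemma integral_mu_local:
  fixes h :: "config \<Rightarrow> real"
  assumes g: "rate_function g" and env: "environment c \<alpha>" and c: "0 < c"
    and A: "finite A" "A \<noteq> {}" and h: "determined_by A h"
  shows "(\<integral>\<xi>. h \<xi> \<partial>mu g \<alpha> c) = measure_pmf.expectation (equilibrium g \<alpha> (\<lambda>_. c) A) h"
proof -
  have "theta g (c / \<alpha> x) = measure_pmf (theta_pmf g (c / \<alpha> x))" for x
    using env c less_trans[OF c, of "\<alpha> x"] by (intro theta_eq_theta_pmf g) (auto simp: environment_def)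
  then have "mu g \<alpha> c = PiM UNIV (\<lambda>x. measure_pmf (map_pmf enat (theta_pmf g (c / \<alpha> x))))"
    by (simp add: mu_def map_pmf_rep_eq)
  then show ?thesis
    unfolding equilibrium_def by (simp only: integral_PiM_pmf_local[OF A h])
qed

theorem theorem2p1:
  fixes c p :: real and g :: "nat \<Rightarrow> real" and \<alpha> :: "int \<Rightarrow> real" and K :: "int pmf"
    and M :: "'w measure"
    and W U :: "int \<Rightarrow> nat \<Rightarrow> 'w \<Rightarrow> real" and Z :: "int \<Rightarrow> nat \<Rightarrow> 'w \<Rightarrow> int"
    and \<eta>\<^sub>0 :: "int \<Rightarrow> nat" and \<eta> :: "real \<Rightarrow> 'w \<Rightarrow> config" and h :: "config \<Rightarrow> real"
  assumes "0 < c" "c < 1"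
    and "rate_function g"
    and "1/2 < p" "p \<le> 1"
    and "pmf K 1 = p" "pmf K (- 1) = 1 - p"
    and "environment c \<alpha>"
    and "Liminf at_bot (\<lambda>x. ereal (\<alpha> x)) = ereal c"
    and "harris_system M K W U Z"
    and "zero_range_process M g \<alpha> W U Z (\<lambda>x. enat (\<eta>\<^sub>0 x)) \<eta>"
    and "bounded (range h)" "local_fun h" "mono h"
  shows "Limsup at_top (\<lambda>t. ereal (\<integral>\<omega>. h (\<eta> t \<omega>) \<partial>M)) \<le> ereal (\<integral>\<xi>. h \<xi> \<partial>(mu g \<alpha> c))"
proof -
  obtain B where B: "\<And>\<eta>. \<bar>h \<eta>\<bar> \<le> B"
    using \<open>bounded (range h)\<close> by (auto simp: bounded_iff)
  obtain A\<^sub>0 where A\<^sub>0: "finite A\<^sub>0" "determined_by A\<^sub>0 h"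
    using \<open>local_fun h\<close> unfolding local_fun_def determined_by_def by blast
  \<comment> \<open>the coordinate \<open>0\<close> is added only to make the set nonempty\<close>
  define A where "A = insert 0 A\<^sub>0"
  have A: "finite A" "A \<noteq> {}" "determined_by A h"
    using A\<^sub>0 by (auto simp: A_def determined_by_def)
  have \<alpha>: "c < \<alpha> x" "\<alpha> x \<le> 1" for x
    using \<open>environment c \<alpha>\<close> by (auto simp: environment_def)
  let ?lim = "Limsup at_top (\<lambda>t. ereal (\<integral>\<omega>. h (\<eta> t \<omega>) \<partial>M))"
  have "\<exists>\<psi>. (\<forall>x\<in>A. c \<le> \<psi> x \<and> \<psi> x \<le> c + 1 / real (Suc j)) \<and>
      ?lim \<le> ereal (measure_pmf.expectation (equilibrium g \<alpha> \<psi> A) h)" for j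
  proof -
    have "0 < 1 / real (Suc j)" by simp
    from fugacities_exist[OF assms(8,1,9,4,5) A(1) this]
    obtain a b \<Lambda> \<phi> where w: "a < b" "\<Lambda> \<subseteq> {a<..<b}" "A \<subseteq> \<Lambda>"
      "\<And>x. c \<le> \<phi> x" "\<And>x. x \<in> \<Lambda> \<Longrightarrow> \<phi> x < \<alpha> x" "\<And>x. x \<notin> \<Lambda> \<Longrightarrow> \<phi> x = \<alpha> x"
      "\<And>x. x \<in> \<Lambda> \<Longrightarrow> \<phi> x = p * \<phi> (x - 1) + (1 - p) * \<phi> (x + 1)"
      "\<And>x. x \<in> A \<Longrightarrow> \<phi> x \<le> c + 1 / real (Suc j)"
      by blast
    have \<phi>: "0 < \<phi> x" for x using w(4)[of x] \<open>0 < c\<close> by simp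
    interpret majorised_window g \<alpha> \<phi> p K a b \<Lambda> h B
      using assms w \<alpha> \<phi> B by unfold_locales (auto intro: less_imp_le less_trans)
    have "?lim \<le> ereal (measure_pmf.expectation (equilibrium g \<alpha> \<phi> \<Lambda>) h)"
      by (rule limsup_le_equilibrium[OF assms(10,11,14) local_fun_measurable[OF A(1,3)]]) (rule \<phi>)
    also have "measure_pmf.expectation (equilibrium g \<alpha> \<phi> \<Lambda>) h
        = measure_pmf.expectation (equilibrium g \<alpha> \<phi> A) h"
      by (rule expectation_equilibrium_subset[OF finite_\<Lambda> w(3) A(3)])
    finally show ?thesis using w(4,8) by blast
  qed
  then obtain \<psi> where \<psi>: "\<And>j x. x \<in> A \<Longrightarrow> c \<le> \<psi> j x" "\<And>j x. x \<in> A \<Longrightarrow> \<psi> j x \<le> c + 1 / real (Suc j)"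
    and le: "\<And>j. ?lim \<le> ereal (measure_pmf.expectation (equilibrium g \<alpha> (\<psi> j) A) h)"
    by metis
  have "(\<lambda>j. \<psi> j x) \<longlonglongrightarrow> c" if "x \<in> A" for x
  proof (rule tendsto_sandwich[OF _ _ tendsto_const])
    show "(\<lambda>j. c + 1 / real (Suc j)) \<longlonglongrightarrow> c"
      using tendsto_add[OF tendsto_const LIMSEQ_inverse_real_of_nat, of c]
          by (simp add: inverse_eq_divide)
  qed (use \<psi> that in auto)
  moreover have "0 \<le> \<psi> j x" if "x \<in> A" for j x using \<psi>(1)[OF that, of j] \<open>0 < c\<close> by simp
  ultimately have "(\<lambda>j. measure_pmf.expectation (equilibrium g \<alpha> (\<psi> j) A) h) \<longlonglongrightarrow>
      measure_pmf.expectation (equilibrium g \<alpha> (\<lambda>_. c) A) h"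
    using \<open>0 < c\<close> \<alpha>(1) less_trans[OF \<open>0 < c\<close> \<alpha>(1)]
    by (intro expectation_equilibrium_tendsto[OF \<open>rate_function g\<close> A(1) B]) auto
  then have "(\<lambda>j. ereal (measure_pmf.expectation (equilibrium g \<alpha> (\<psi> j) A) h)) \<longlonglongrightarrow>
      ereal (\<integral>\<xi>. h \<xi> \<partial>mu g \<alpha> c)"
    using integral_mu_local[OF assms(3,8,1) A] by simp
  then show ?thesis
    by (rule LIMSEQ_le_const) (use le in auto)
qed

end
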